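(* Consider the system $$\partial_t u+\partial_x\left(\frac{uv}{2}+v\right)=0,\qquad \partial_t v+\partial_x\left(u-\frac{v^2}{2}\right)=0,\qquad (t,x)\in\mathbb{R}_+\times\mathbb{T}.$$ There exists a nonempty open set $\mathcal{V}\subset\mathbb{R}^2$ such that both characteristic fields of this system are genuinely nonlinear in $\mathcal{V}$ and, moreover, for any ball $B\subset\mathcal{V}$ there exist at least two (distinct) weak solutions of this system in $C^0(\mathbb{R}^+\times\mathbb{T};B)$ with the same initial value.
   Context: $\mathbb{T}$ is the one-dimensional torus $[0,1]$ (endpoints identified). Write $\boldsymbol{u}=(u,v)$ and $f(\boldsymbol{u})=\left(\frac{uv}{2}+v,\ u-\frac{v^2}{2}\right)$, so that the system reads $\partial_t\boldsymbol{u}+\partial_x f(\boldsymbol{u})=0$. The system is strictly hyperbolic on a set if at each point $\boldsymbol{u}$ of it $Df(\boldsymbol{u})$ has two distinct real eigenvalues $\Lambda^-(\boldsymbol{u})<\Lambda^+(\boldsymbol{u})$; let $\boldsymbol{r}_\pm(\boldsymbol{u})$ be associated (nonzero, smooth in $\boldsymbol{u}$) right eigenvectors. The $i$-th characteristic field ($i=\pm$) is genuinely nonlinear in $\mathcal{V}$ if the system is strictly hyperbolic on $\mathcal{V}$ and $\nabla\Lambda^i\cdot\boldsymbol{r}_i\neq0$ at every point of $\mathcal{V}$. Weak solution: a bounded measurable function $\boldsymbol{u}(t,x)$ is a weak solution with bounded measurable initial data $\boldsymbol{u}_0$ if for all $\varphi\in C^1_0(\mathbb{R}\times\mathbb{T})$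 ($C^1$ with compact support), $$\int_0^\infty\int_{\mathbb{T}}\big(\boldsymbol{u}\,\varphi_t+f(\boldsymbol{u})\,\varphi_x\big)\,dx\,dt+\int_{\mathbb{T}}\boldsymbol{u}_0(x)\,\varphi(0,x)\,dx=0.$$ *)

theory Defs
  imports "HOL-Analysis.Analysis"
begin

text \<open>\<open>C\<^sup>k\<close> on an open set. In finite dimension, continuity of all iterated directional derivatives
  is the usual notion.\<close>

fun Ck_on :: "nat \<Rightarrow> ('a::euclidean_space \<Rightarrow> 'b::euclidean_space) \<Rightarrow> 'a set \<Rightarrow> bool" where
  "Ck_on 0 g S \<longleftrightarrow> continuous_on S g"
| "Ck_on (Suc k) g S \<longleftrightarrow>
     (\<forall>x\<in>S. g differentiable (at x)) \<and> (\<forall>h. Ck_on k (\<lambda>x. frechet_derivative g (at x) h) S)"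

definition smooth_on :: "('a::euclidean_space \<Rightarrow> 'b::euclidean_space) \<Rightarrow> 'a set \<Rightarrow> bool" where
  "smooth_on g S \<longleftrightarrow> (\<forall>k. Ck_on k g S)"

definition eigenvalues :: "('a::real_vector \<Rightarrow> 'a) \<Rightarrow> real set" where
  "eigenvalues A = {l. \<exists>w. w \<noteq> 0 \<and> A w = l *\<^sub>R w}"

definition strictly_hyperbolic_on :: "(real \<times> real \<Rightarrow> real \<times> real) \<Rightarrow> (real \<times> real) set \<Rightarrow> bool" where
  "strictly_hyperbolic_on F V \<longleftrightarrow>
     (\<forall>p\<in>V. F differentiable (at p) \<and>
        (\<exists>a b. a < b \<and> eigenvalues (frechet_derivative F (at p)) = {a, b}))"

text \<open>Meaningful at points of strict hyperbolicity, where the set of eigenvalues is a pair.\<close>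

definition speed_minus :: "(real \<times> real \<Rightarrow> real \<times> real) \<Rightarrow> real \<times> real \<Rightarrow> real" where
  "speed_minus F p = Min (eigenvalues (frechet_derivative F (at p)))"

definition speed_plus :: "(real \<times> real \<Rightarrow> real \<times> real) \<Rightarrow> real \<times> real \<Rightarrow> real" where
  "speed_plus F p = Max (eigenvalues (frechet_derivative F (at p)))"

text \<open>Genuine nonlinearity on \<open>V\<close> of the characteristic field with speed \<open>L\<close>. The eigenspaces are
  lines, so the condition does not depend on which smooth eigenvector field \<open>r\<close> is chosen.\<close>

definition genuinely_nonlinear_on ::
    "(real \<times> real \<Rightarrow> real \<times> real) \<Rightarrow> (real \<times> real \<Rightarrow> real) \<Rightarrow> (real \<times> real) set \<Rightarrow> bool" where
  "genuinely_nonlinear_on F L V \<longleftrightarrow>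
     strictly_hyperbolic_on F V \<and>
     (\<exists>r :: real \<times> real \<Rightarrow> real \<times> real. smooth_on r V \<and>
        (\<forall>p\<in>V. r p \<noteq> 0 \<and> frechet_derivative F (at p) (r p) = L p *\<^sub>R r p \<and>
           (\<exists>g. (GDERIV L p :> g) \<and> g \<bullet> r p \<noteq> 0)))"

text \<open>Functions on the torus are represented by 1-periodic functions on \<open>\<real>\<close>. Only the values of
  a space-time function at times \<open>t \<ge> 0\<close> matter.\<close>

abbreviation spacetime :: "(real \<times> real) set" where
  "spacetime \<equiv> {0..} \<times> UNIV"

definition test_function :: "(real \<times> real \<Rightarrow> real) \<Rightarrow> bool" where
  "test_function \<phi> \<longleftrightarrow>
     Ck_on 1 \<phi> UNIV \<and>
     (\<forall>t x. \<phi> (t, x + 1) = \<phi> (t, x)) \<and>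
     (\<exists>R. \<forall>t x. \<bar>t\<bar> > R \<longrightarrow> \<phi> (t, x) = 0)"

definition weak_solution ::
    "(real \<times> real \<Rightarrow> real \<times> real) \<Rightarrow> (real \<Rightarrow> real \<times> real) \<Rightarrow> (real \<times> real \<Rightarrow> real \<times> real) \<Rightarrow> bool" where
  "weak_solution F w0 w \<longleftrightarrow>
     w0 \<in> borel_measurable lebesgue \<and> bounded (range w0) \<and> (\<forall>x. w0 (x + 1) = w0 x) \<and>
     w \<in> borel_measurable (lebesgue_on spacetime) \<and> bounded (w ` spacetime) \<and>
     (\<forall>t\<ge>0. \<forall>x. w (t, x + 1) = w (t, x)) \<and>
     (\<forall>\<phi>. test_function \<phi> \<longrightarrow>
        (LINT t:{0..}|lebesgue. (LINT x:{0..1}|lebesgue.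
            deriv (\<lambda>s. \<phi> (s, x)) t *\<^sub>R w (t, x) + deriv (\<lambda>y. \<phi> (t, y)) x *\<^sub>R F (w (t, x))))
        + (LINT x:{0..1}|lebesgue. \<phi> (0, x) *\<^sub>R w0 x) = 0)"

definition flux :: "real \<times> real \<Rightarrow> real \<times> real" where
  "flux = (\<lambda>(u, v). (u * v / 2 + v, u - v\<^sup>2 / 2))"

end

theory Submission
  imports Defs
begin

text \<open>
  Write a continuous solution near a constant state \<open>(u\<^sub>0, v\<^sub>0)\<close> as \<open>u = u\<^sub>0 + p\<^sub>x\<close>, \<open>v = v\<^sub>0 + q\<^sub>x\<close>. The system says that
  the two residuals \<open>p\<^sub>t + f\<^sub>1(u, v) - f\<^sub>1(u\<^sub>0, v\<^sub>0)\<close> and \<open>q\<^sub>t + f\<^sub>2(u, v) - f\<^sub>2(u\<^sub>0, v\<^sub>0)\<close> do not depend on \<open>x\<close>; it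
  suffices to find \<open>C\<^sup>1\<close> potentials for which both vanish. They are found by convex integration in the
  style of Nash and Kuiper, starting from \<open>p = 0\<close> and a nonconstant \<open>q = q(t)\<close>, whose residual is \<open>(0, q')\<close>.
  The residual is nonzero only for \<open>1 < t < 2\<close> and every perturbation lives there, so the limit is equal
  to \<open>(u\<^sub>0, v\<^sub>0)\<close> at time \<open>0\<close>; it is not the constant solution because \<open>q\<close> is hardly moved and keeps an
  increment in time.

  A residual is reduced by fast waves. A wave of amplitude \<open>a\<close> along an eigenvector \<open>r\<^sub>\<plusminus>\<close> of \<open>Df\<close>, with a
  phase that is transported at the speed \<open>\<Lambda>\<^sup>\<plusminus>\<close>, solves the linearised system to leading order, and its
  quadratic self-interaction shifts the residual on average by \<open>a\<^sup>2\<close> times a vector close to \<open>(\<plusminus>1, -1)\<close>.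
  These two vectors are linearly independent, so a residual in the open cone around \<open>(0, 1)\<close> is reduced
  to a fraction of itself by one wave of each family, at the cost of a change of \<open>(u, v)\<close> that is of the order of the
  square root of the residual. These changes form a geometric series, hence the limit is continuous.

  Genuine nonlinearity is the obstacle. A second harmonic can cancel the oscillating part of the self-interaction
  except for its component along \<open>r\<^sub>\<plusminus>\<close>, which stays. For this flux that component is a multiple of \<open>v\<close>: both fields are linearly degenerate
  on the line \<open>v = 0\<close> and genuinely nonlinear off it. Hence \<open>V\<close> is a tiny rectangle at the origin in \<open>v > 0\<close>, where
  what is left over is a small fraction of the residual just removed and is dealt with at the next stage.

  The wave and its effect are in \<open>wave\<close>, \<open>flux_increment\<close> and \<open>wave_increment\<close>; \<open>half_stage\<close> uses one
  family, \<open>stage\<close> both, and \<open>convex_integration\<close> passes to the limit. The weak formulation is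
  recovered in \<open>potential_weak_solution\<close>, and \<open>genuinely_nonlinear_flux\<close> treats the characteristic fields.
\<close>

section \<open>Periodic functions of class C1 in time and space\<close>

definition Dt :: "(real \<Rightarrow> real \<Rightarrow> real) \<Rightarrow> real \<Rightarrow> real \<Rightarrow> real" where
  "Dt f t x = deriv (\<lambda>s. f s x) t"

definition Dx :: "(real \<Rightarrow> real \<Rightarrow> real) \<Rightarrow> real \<Rightarrow> real \<Rightarrow> real" where
  "Dx f t x = deriv (f t) x"

text \<open>Uniform bounds are part of the class because one frequency has to work for all \<open>(t, x)\<close> at once.\<close>

definition cbounded :: "(real \<Rightarrow> real \<Rightarrow> real) \<Rightarrow> bool" where
  "cbounded f \<longleftrightarrow> continuous_on UNIV (\<lambda>z. f (fst z) (snd z)) \<and> (\<exists>B. \<forall>t x. \<bar>f t x\<bar> \<le> B)"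

text \<open>The torus enters as 1-periodicity in \<open>x\<close>. Partial derivatives are used instead of the Frechet derivative
  because all estimates are for them separately.\<close>

definition PC1 :: "(real \<Rightarrow> real \<Rightarrow> real) \<Rightarrow> bool" where
  "PC1 f \<longleftrightarrow> (\<forall>t x. f t (x + 1) = f t x) \<and>
     (\<forall>t x. ((\<lambda>s. f s x) has_real_derivative Dt f t x) (at t)) \<and>
     (\<forall>t x. (f t has_real_derivative Dx f t x) (at x)) \<and>
     cbounded f \<and> cbounded (Dt f) \<and> cbounded (Dx f)"

lemma PC1D:
  assumes "PC1 f"
  shows "f t (x + 1) = f t x" "((\<lambda>s. f s x) has_real_derivative Dt f t x) (at t)"
    "(f t has_real_derivative Dx f t x) (at x)" "cbounded f" "cbounded (Dt f)" "cbounded (Dx f)"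
  using assms unfolding PC1_def by auto

text \<open>Exhibiting the partial derivatives determines \<open>Dt\<close> and \<open>Dx\<close>, so closure properties come with their
  derivative formulas.\<close>

lemma PC1I:
  assumes "\<And>t x. f t (x + 1) = f t x"
    and dt: "\<And>t x. ((\<lambda>s. f s x) has_real_derivative ft t x) (at t)"
    and dx: "\<And>t x. (f t has_real_derivative fx t x) (at x)"
    and "cbounded f" "cbounded ft" "cbounded fx"
  shows "PC1 f" "Dt f = ft" "Dx f = fx"
proof -
  show 1: "Dt f = ft" by (intro ext) (simp add: Dt_def DERIV_imp_deriv[OF dt])
  show 2: "Dx f = fx" by (intro ext) (simp add: Dx_def DERIV_imp_deriv[OF dx])
  show "PC1 f" unfolding PC1_def 1 2 using assms by auto
qed

lemma cbounded_const [simp]: "cbounded (\<lambda>t x. c)"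
  by (auto simp: cbounded_def)

lemma cbounded_add: assumes "cbounded f" "cbounded g" shows "cbounded (\<lambda>t x. f t x + g t x)"
proof -
  obtain A B where "\<forall>t x. \<bar>f t x\<bar> \<le> A" "\<forall>t x. \<bar>g t x\<bar> \<le> B"
    using assms by (auto simp: cbounded_def)
  then have "\<forall>t x. \<bar>f t x + g t x\<bar> \<le> A + B"
    by (intro allI order_trans[OF abs_triangle_ineq] add_mono) auto
  with assms show ?thesis by (auto simp: cbounded_def intro!: continuous_intros)
qed

lemma cbounded_mult: assumes "cbounded f" "cbounded g" shows "cbounded (\<lambda>t x. f t x * g t x)"
proof -
  obtain A B where AB: "\<And>t x. \<bar>f t x\<bar> \<le> A" "\<And>t x. \<bar>g t x\<bar> \<le> B"
    using assms by (auto simp: cbounded_def)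
  have "\<bar>f t x * g t x\<bar> \<le> A * B" for t x
    unfolding abs_mult using AB[of t x] by (intro mult_mono) auto
  with assms show ?thesis by (auto simp: cbounded_def intro!: continuous_intros)
qed

lemma cbounded_minus: "cbounded f \<Longrightarrow> cbounded (\<lambda>t x. - f t x)"
  by (auto simp: cbounded_def intro!: continuous_intros)

lemma cbounded_diff: "cbounded f \<Longrightarrow> cbounded g \<Longrightarrow> cbounded (\<lambda>t x. f t x - g t x)"
  using cbounded_add[OF _ cbounded_minus] by force

lemma cbounded_shift: assumes "cbounded f" shows "cbounded (\<lambda>t x. f (t + k) (x + h))"
proof -
  have "continuous_on UNIV (\<lambda>z. f (fst (fst z + k, snd z + h)) (snd (fst z + k, snd z + h)))"
    by (rule continuous_on_compose2[where f = "\<lambda>z. (fst z + k, snd z + h)" and t = UNIV])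
       (use assms in \<open>auto simp: cbounded_def intro!: continuous_intros\<close>)
  with assms show ?thesis by (auto simp: cbounded_def)
qed

lemma cbounded_slice: assumes "cbounded f" shows "cbounded (\<lambda>t x. f s x)"
proof -
  have "continuous_on UNIV (\<lambda>z. f (fst (s, snd z :: real)) (snd (s, snd z :: real)))" if "s \<in> UNIV"
    by (rule continuous_on_compose2[where f = "\<lambda>z. (s, snd z)" and t = UNIV])
       (use assms in \<open>auto simp: cbounded_def intro!: continuous_intros\<close>)
  with assms show ?thesis by (auto simp: cbounded_def)
qed

lemma cbounded_compose:
  assumes "continuous_on UNIV (F :: real \<Rightarrow> real)" "cbounded g" shows "cbounded (\<lambda>t x. F (g t x))"
proof -
  obtain B where B: "\<And>t x. \<bar>g t x\<bar> \<le> B"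
    using assms by (auto simp: cbounded_def)
  have "compact (F ` {-B..B})"
    by (intro compact_continuous_image continuous_on_subset[OF assms(1)]) auto
  then obtain C where C: "\<And>y. y \<in> {-B..B} \<Longrightarrow> \<bar>F y\<bar> \<le> C"
    by (force simp: bounded_iff dest: compact_imp_bounded)
  have "g t x \<in> {-B..B}" for t x using B[of t x] by (auto simp: abs_le_iff)
  then have "\<forall>t x. \<bar>F (g t x)\<bar> \<le> C" using C by blast
  moreover have "continuous_on UNIV (\<lambda>z. F (g (fst z) (snd z)))"
    by (rule continuous_on_compose2[OF assms(1)]) (use assms in \<open>auto simp: cbounded_def\<close>)
  ultimately show ?thesis by (auto simp: cbounded_def)
qed

lemma PC1_const: "PC1 (\<lambda>t x. c)" "Dt (\<lambda>t x. c) = (\<lambda>t x. 0)" "Dx (\<lambda>t x. c) = (\<lambda>t x. 0)"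
  by (rule PC1I[where ft = "\<lambda>t x. 0" and fx = "\<lambda>t x. 0"]; auto)+

lemma PC1_add:
  assumes "PC1 f" "PC1 g"
  shows "PC1 (\<lambda>t x. f t x + g t x)" "Dt (\<lambda>t x. f t x + g t x) = (\<lambda>t x. Dt f t x + Dt g t x)"
    "Dx (\<lambda>t x. f t x + g t x) = (\<lambda>t x. Dx f t x + Dx g t x)"
proof -
  note d = PC1D[OF assms(1)] PC1D[OF assms(2)]
  note r = PC1I[where f = "\<lambda>t x. f t x + g t x", OF _ DERIV_add[OF d(2) d(8)] DERIV_add[OF d(3) d(9)]]
  have c: "f t (x+1) + g t (x+1) = f t x + g t x" "cbounded (\<lambda>t x. f t x + g t x)"
    "cbounded (\<lambda>t x. Dt f t x + Dt g t x)" "cbounded (\<lambda>t x. Dx f t x + Dx g t x)" for t x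
    by (simp_all add: d cbounded_add)
  show "PC1 (\<lambda>t x. f t x + g t x)" "Dt (\<lambda>t x. f t x + g t x) = (\<lambda>t x. Dt f t x + Dt g t x)"
    "Dx (\<lambda>t x. f t x + g t x) = (\<lambda>t x. Dx f t x + Dx g t x)"
    using r[OF c] by auto
qed

lemma PC1_mult:
  assumes "PC1 f" "PC1 g"
  shows "PC1 (\<lambda>t x. f t x * g t x)"
    "Dt (\<lambda>t x. f t x * g t x) = (\<lambda>t x. Dt f t x * g t x + f t x * Dt g t x)"
    "Dx (\<lambda>t x. f t x * g t x) = (\<lambda>t x. Dx f t x * g t x + f t x * Dx g t x)"
proof -
  note d = PC1D[OF assms(1)] PC1D[OF assms(2)]
  have 1: "((\<lambda>s. f s x * g s x) has_real_derivative Dt f t x * g t x + f t x * Dt g t x) (at t)" for t x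
    using DERIV_mult[OF d(2)[where t = t and x = x] d(8)[where t = t and x = x]] by (simp add: algebra_simps)
  have 2: "((\<lambda>y. f t y * g t y) has_real_derivative Dx f t x * g t x + f t x * Dx g t x) (at x)" for t x
    using DERIV_mult[OF d(3)[where t = t and x = x] d(9)[where t = t and x = x]] by (simp add: algebra_simps)
  note r = PC1I[where f = "\<lambda>t x. f t x * g t x", OF _ 1 2]
  have c: "f t (x+1) * g t (x+1) = f t x * g t x" "cbounded (\<lambda>t x. f t x * g t x)"
    "cbounded (\<lambda>t x. Dt f t x * g t x + f t x * Dt g t x)"
    "cbounded (\<lambda>t x. Dx f t x * g t x + f t x * Dx g t x)" for t x
    by (simp_all add: d cbounded_add cbounded_mult)
  show "PC1 (\<lambda>t x. f t x * g t x)"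
    "Dt (\<lambda>t x. f t x * g t x) = (\<lambda>t x. Dt f t x * g t x + f t x * Dt g t x)"
    "Dx (\<lambda>t x. f t x * g t x) = (\<lambda>t x. Dx f t x * g t x + f t x * Dx g t x)"
    using r[OF c] by auto
qed

lemma PC1_cmult:
  assumes "PC1 f" shows "PC1 (\<lambda>t x. c * f t x)"
    "Dt (\<lambda>t x. c * f t x) = (\<lambda>t x. c * Dt f t x)" "Dx (\<lambda>t x. c * f t x) = (\<lambda>t x. c * Dx f t x)"
  using PC1_mult[OF PC1_const(1) assms, of c] by (auto simp: PC1_const)

lemma PC1_diff: assumes "PC1 f" "PC1 g" shows "PC1 (\<lambda>t x. f t x - g t x)"
  using PC1_add(1)[OF assms(1) PC1_cmult(1)[OF assms(2), of "-1"]] by simp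

lemma PC1_compose:
  assumes F: "\<And>y. (F has_real_derivative F' y) (at y)" and F': "continuous_on UNIV F'" and g: "PC1 g"
  shows "PC1 (\<lambda>t x. F (g t x))"
proof -
  note d = PC1D[OF g]
  have cF: "continuous_on UNIV F" using F by (auto intro: DERIV_isCont continuous_at_imp_continuous_on)
  show ?thesis
    by (rule PC1I[where ft = "\<lambda>t x. F' (g t x) * Dt g t x" and fx = "\<lambda>t x. F' (g t x) * Dx g t x"])
       (simp_all add: d DERIV_chain2[OF F d(2)] DERIV_chain2[OF F d(3)] cbounded_mult cbounded_compose cF F')
qed

lemma PC1_slice: assumes "PC1 f" shows "PC1 (\<lambda>t x. f s x)" "Dt (\<lambda>t x. f s x) = (\<lambda>t x. 0)"
    "Dx (\<lambda>t x. f s x) = (\<lambda>t x. Dx f s x)"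
proof -
  note d = PC1D[OF assms]
  note r = PC1I[where f = "\<lambda>t x. f s x", OF d(1) DERIV_const d(3) cbounded_slice[OF d(4)] cbounded_const
    cbounded_slice[OF d(6)]]
  show "PC1 (\<lambda>t x. f s x)" "Dt (\<lambda>t x. f s x) = (\<lambda>t x. 0)" "Dx (\<lambda>t x. f s x) = (\<lambda>t x. Dx f s x)"
    using r by auto
qed

lemma PC1_shift: assumes "PC1 f" shows "PC1 (\<lambda>t x. f (t + k) (x + h))"
proof -
  note d = PC1D[OF assms]
  have 0: "f (t + k) (x + 1 + h) = f (t + k) (x + h)" for t x
    using d(1)[of "t + k" "x + h"] by (simp add: add_ac)
  have 1: "((\<lambda>s. f (s + k) (x + h)) has_real_derivative Dt f (t + k) (x + h)) (at t)" for t x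
    using d(2)[of "x + h" "t + k"] by (simp add: DERIV_shift[where f = "\<lambda>s. f s (x + h)"])
  have 2: "((\<lambda>x. f (t + k) (x + h)) has_real_derivative Dx f (t + k) (x + h)) (at x)" for t x
    using d(3)[of "t + k" "x + h"] by (simp add: DERIV_shift)
  show ?thesis
    by (rule PC1I[OF 0 1 2]) (intro cbounded_shift d)+
qed

lemma Dt_Dx_periodic: assumes "PC1 f"
  shows "Dx f t (x + 1) = Dx f t x" "Dt f t (x + 1) = Dt f t x"
proof -
  note d = PC1D[OF assms]
  have "((\<lambda>y. f t (y + 1)) has_real_derivative Dx f t (x + 1)) (at x)"
    using d(3) DERIV_shift by blast
  then have "(f t has_real_derivative Dx f t (x + 1)) (at x)" by (simp add: d(1))
  then show "Dx f t (x + 1) = Dx f t x" using d(3) by (rule DERIV_unique)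
  show "Dt f t (x + 1) = Dt f t x" by (simp add: Dt_def d(1))
qed

section \<open>Cutoff functions, time windows and difference quotients\<close>

lemma PC1_time:
  assumes F: "\<And>t. (F has_real_derivative F' t) (at t)" "continuous_on UNIV F'"
    and B: "\<And>t. \<bar>F t\<bar> \<le> A" "\<And>t. \<bar>F' t\<bar> \<le> B"
  shows "PC1 (\<lambda>t x. F t)" "Dt (\<lambda>t x. F t) = (\<lambda>t x. F' t)" "Dx (\<lambda>t x. F t) = (\<lambda>t x. 0)"
proof -
  have "continuous_on UNIV F" using F(1) by (auto intro: DERIV_isCont continuous_at_imp_continuous_on)
  then have c: "cbounded (\<lambda>t x. F t)" "cbounded (\<lambda>t x. F' t)"
    unfolding cbounded_def using B F(2)
    by (auto intro!: continuous_on_compose2[of UNIV F] continuous_on_compose2[of UNIV F'] continuous_intros)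
  note r = PC1I[where f = "\<lambda>t x. F t", OF refl F(1) DERIV_const c cbounded_const]
  show "PC1 (\<lambda>t x. F t)" "Dt (\<lambda>t x. F t) = (\<lambda>t x. F' t)" "Dx (\<lambda>t x. F t) = (\<lambda>t x. 0)"
    using r by auto
qed

text \<open>The \<open>C\<^sup>1\<close> building block of all cutoffs. Potentials are differentiated only once, so this
  regularity is enough.\<close>

definition pos_sq :: "real \<Rightarrow> real" where "pos_sq y = (max 0 y)\<^sup>2"

lemma pos_sq_deriv: "(pos_sq has_real_derivative 2 * max 0 y) (at y)"
proof -
  consider "y > 0" | "y < 0" | "y = 0" by linarith
  then show ?thesis
  proof cases
    case 1
    have "((\<lambda>y. y\<^sup>2) has_real_derivative 2 * y) (at y)" by (auto intro!: derivative_eq_intros)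
    then have "(pos_sq has_real_derivative 2 * y) (at y)"
      by (rule has_field_derivative_transform_within_open[where S = "{0<..}"]) (use 1 in \<open>auto simp: pos_sq_def\<close>)
    with 1 show ?thesis by simp
  next
    case 2
    have "((\<lambda>y. 0) has_real_derivative 0) (at y)" by simp
    then have "(pos_sq has_real_derivative 0) (at y)"
      by (rule has_field_derivative_transform_within_open[where S = "{..<0}"]) (use 2 in \<open>auto simp: pos_sq_def\<close>)
    with 2 show ?thesis by simp
  next
    case 3
    have "((\<lambda>h. pos_sq h / h) \<longlongrightarrow> 0) (at 0)"
    proof (rule tendsto_sandwich[where f = "\<lambda>h. - \<bar>h\<bar>" and h = "\<lambda>h. \<bar>h\<bar>"])
      show "\<forall>\<^sub>F n in at 0. - \<bar>n\<bar> \<le> pos_sq n / n" "\<forall>\<^sub>F n in at 0. pos_sq n / n \<le> \<bar>n\<bar>"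
        by (auto simp: pos_sq_def max_def power2_eq_square intro!: always_eventually)
    qed (auto intro!: tendsto_eq_intros)
    with 3 show ?thesis by (auto simp: DERIV_def pos_sq_def)
  qed
qed

lemma pos_sq_nonneg: "0 \<le> pos_sq y" by (simp add: pos_sq_def)

lemma pos_sq_gt: "0 < y \<Longrightarrow> 0 < pos_sq y" by (simp add: pos_sq_def)

lemma pos_sq_pos: "0 < pos_sq y + pos_sq (1 - y)"
  using pos_sq_gt[of y] pos_sq_gt[of "1 - y"] pos_sq_nonneg[of y] pos_sq_nonneg[of "1 - y"] by linarith

lemma pos_sq_chain: "((\<lambda>y. pos_sq (c - y)) has_real_derivative - 2 * max 0 (c - y)) (at y)"
proof -
  have "((\<lambda>y. c - y) has_real_derivative -1) (at y)" by (auto intro!: derivative_eq_intros)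
  from DERIV_chain2[OF pos_sq_deriv this] show ?thesis by simp
qed

definition step :: "real \<Rightarrow> real" where "step y = pos_sq y / (pos_sq y + pos_sq (1 - y))"

definition step' :: "real \<Rightarrow> real" where
  "step' y = (2 * max 0 y * pos_sq (1 - y) + pos_sq y * (2 * max 0 (1 - y))) / (pos_sq y + pos_sq (1 - y))\<^sup>2"

lemma step_deriv: "(step has_real_derivative step' y) (at y)"
proof -
  have "pos_sq y + pos_sq (1 - y) \<noteq> 0" using pos_sq_pos[of y] by linarith
  from DERIV_divide[OF pos_sq_deriv DERIV_add[OF pos_sq_deriv pos_sq_chain] this]
  have "(step has_real_derivative (2 * max 0 y * (pos_sq y + pos_sq (1 - y))
      - pos_sq y * (2 * max 0 y + - 2 * max 0 (1 - y)))
      / ((pos_sq y + pos_sq (1 - y)) * (pos_sq y + pos_sq (1 - y)))) (at y)"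
    by (simp only: step_def[abs_def])
  moreover have "2 * max 0 y * (pos_sq y + pos_sq (1 - y)) - pos_sq y * (2 * max 0 y + - 2 * max 0 (1 - y))
      = 2 * max 0 y * pos_sq (1 - y) + pos_sq y * (2 * max 0 (1 - y))"
    by algebra
  ultimately show ?thesis by (simp only: step'_def power2_eq_square)
qed

lemma continuous_pos_sq: "continuous_on UNIV pos_sq"
  by (intro continuous_at_imp_continuous_on ballI DERIV_isCont[OF pos_sq_deriv])

lemma continuous_step': "continuous_on UNIV step'"
proof -
  have "pos_sq y + pos_sq (1 - y) \<noteq> 0" for y using pos_sq_pos[of y] by linarith
  then show ?thesis unfolding step'_def[abs_def]
    by (intro continuous_intros continuous_on_compose2[OF continuous_pos_sq]) auto
qed

lemma step_simps: "y \<le> 0 \<Longrightarrow> step y = 0" "y \<ge> 1 \<Longrightarrow> step y = 1"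
  by (auto simp: step_def pos_sq_def max_def)

lemma step_bounds: "0 \<le> step y" "step y \<le> 1"
  using pos_sq_pos[of y] pos_sq_nonneg[of y] pos_sq_nonneg[of "1 - y"]
  by (simp_all add: step_def divide_le_eq_1)

lemma step_symmetric: "step (1 - y) = 1 - step y"
proof -
  have "step (1 - y) + step y = 1"
    using pos_sq_pos[of y] by (simp add: step_def add.commute flip: add_divide_distrib)
  then show ?thesis by simp
qed

lemma step'_nonneg: "0 \<le> step' y"
  unfolding step'_def pos_sq_def by (intro divide_nonneg_nonneg add_nonneg_nonneg mult_nonneg_nonneg) auto

lemma step'_bounded: obtains B where "\<And>y. step' y \<le> B" "0 < B"
proof -
  have "compact (step' ` {0..1})"
    by (intro compact_continuous_image continuous_on_subset[OF continuous_step']) auto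
  then obtain C where C: "\<And>y. y \<in> {0..1} \<Longrightarrow> \<bar>step' y\<bar> \<le> C"
    by (force simp: bounded_iff dest: compact_imp_bounded)
  have "step' y \<le> \<bar>C\<bar> + 1" for y
  proof (cases "y \<in> {0..1}")
    case False then show ?thesis by (auto simp: step'_def pos_sq_def max_def)
  qed (use C[of y] in linarith)
  then show ?thesis by (rule that) auto
qed

lemma step'_outside: "y \<notin> {0..1} \<Longrightarrow> step' y = 0"
  by (auto simp: step'_def pos_sq_def max_def)

text \<open>Amplitudes enter the residual through their squares, so the partition of unity is needed for squares:
  \<open>step y + step (1 - y) = 1\<close> becomes \<open>sin\<^sup>2 + cos\<^sup>2 = 1\<close>.\<close>

definition sine_step :: "real \<Rightarrow> real" where "sine_step y = sin (pi / 2 * step y)"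

definition sine_step' :: "real \<Rightarrow> real" where "sine_step' y = cos (pi / 2 * step y) * (pi / 2 * step' y)"

lemma sine_step_deriv: "(sine_step has_real_derivative sine_step' y) (at y)"
  unfolding sine_step_def[abs_def] sine_step'_def
  by (auto intro!: derivative_eq_intros step_deriv)

lemma continuous_sine_step': "continuous_on UNIV sine_step'"
proof -
  have "continuous_on UNIV step" by (intro continuous_at_imp_continuous_on ballI DERIV_isCont[OF step_deriv])
  then show ?thesis unfolding sine_step'_def[abs_def]
    by (intro continuous_intros continuous_step')
qed

lemma continuous_sine_step: "continuous_on UNIV sine_step"
  by (intro continuous_at_imp_continuous_on ballI DERIV_isCont[OF sine_step_deriv])

lemma sine_step_simps: "y \<le> 0 \<Longrightarrow> sine_step y = 0" "y \<ge> 1 \<Longrightarrow> sine_step y = 1"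
  by (auto simp: sine_step_def step_simps)

lemma sine_step_bounds: "0 \<le> sine_step y" "sine_step y \<le> 1"
proof -
  have "pi / 2 * step y \<le> pi / 2 * 2" by (intro mult_left_mono) (use step_bounds[of y] in auto)
  then show "0 \<le> sine_step y" unfolding sine_step_def
    by (intro sin_ge_zero) (use step_bounds[of y] in auto)
qed (simp add: sine_step_def)

lemma sine_step_squares: "(sine_step y)\<^sup>2 + (sine_step (1 - y))\<^sup>2 = 1"
proof -
  have "sine_step (1 - y) = cos (pi / 2 * step y)"
    by (simp add: sine_step_def step_symmetric right_diff_distrib cos_sin_eq)
  then show ?thesis by (simp add: sine_step_def)
qed

definition window :: "real \<Rightarrow> real" where "window s = sine_step (1 + s) * sine_step (1 - s)"

lemma window_bounds: "0 \<le> window s" "window s \<le> 1"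
  by (auto simp: window_def sine_step_bounds intro: mult_le_one)

lemma window_outside: "1 \<le> \<bar>s\<bar> \<Longrightarrow> window s = 0"
  by (auto simp: window_def sine_step_simps abs_if split: if_splits)

lemma PC1_window: "PC1 (\<lambda>t x. window (k * (t - s)))"
proof -
  obtain B where B: "\<And>y. step' y \<le> B" "0 < B" using step'_bounded by blast
  have S: "\<bar>sine_step' y\<bar> \<le> pi / 2 * B" for y
  proof -
    have "\<bar>cos (pi / 2 * step y)\<bar> * \<bar>pi / 2 * step' y\<bar> \<le> 1 * (pi / 2 * B)"
      using B(1)[of y] B(2) step'_nonneg[of y] by (intro mult_mono) auto
    then show ?thesis by (simp add: sine_step'_def abs_mult)
  qed
  let ?W = "\<lambda>y. sine_step' (1 + y) * sine_step (1 - y) - sine_step (1 + y) * sine_step' (1 - y)"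
  have d: "(window has_real_derivative ?W y) (at y)" for y
    unfolding window_def[abs_def]
    by (auto intro!: derivative_eq_intros DERIV_chain2[OF sine_step_deriv])
  have c: "continuous_on UNIV (\<lambda>t. ?W (k * (t - s)) * k)"
    by (intro continuous_intros continuous_on_compose2[OF continuous_sine_step] continuous_on_compose2[OF continuous_sine_step']) auto
  have b: "\<bar>?W y\<bar> \<le> pi / 2 * B + pi / 2 * B" for y
  proof -
    have "\<bar>sine_step' (1 + y) * sine_step (1 - y)\<bar> \<le> pi / 2 * B * 1"
      unfolding abs_mult by (intro mult_mono S) (use sine_step_bounds[of "1 - y"] B in auto)
    moreover have "\<bar>sine_step (1 + y) * sine_step' (1 - y)\<bar> \<le> 1 * (pi / 2 * B)"
      unfolding abs_mult by (intro mult_mono S) (use sine_step_bounds[of "1 + y"] B in auto)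
    ultimately show ?thesis by linarith
  qed
  show ?thesis
  proof (rule PC1_time(1)[OF _ c])
    show "((\<lambda>t. window (k * (t - s))) has_real_derivative ?W (k * (t - s)) * k) (at t)" for t
      by (rule DERIV_chain2[OF d]) (auto intro!: derivative_eq_intros)
    show "\<bar>window (k * (t - s))\<bar> \<le> 1" for t using window_bounds[of "k * (t - s)"] by auto
    show "\<bar>?W (k * (t - s)) * k\<bar> \<le> (pi / 2 * B + pi / 2 * B) * \<bar>k\<bar>" for t
      unfolding abs_mult by (intro mult_right_mono b) auto
  qed
qed

lemma window_sum:
  assumes "0 \<le> y" "y \<le> real n"
  shows "(\<Sum>j\<le>n. (window (y - real j))\<^sup>2) = 1" "(\<Sum>j\<le>n. window (y - real j)) \<le> 2"
proof -
  define i where "i = nat \<lfloor>y\<rfloor>"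
  have i: "real i \<le> y" "y < real i + 1" using assms by (auto simp: i_def)
  then have le: "i \<le> n" using assms by linarith
  have out: "window (y - real j) = 0" if "j \<noteq> i" "j \<noteq> Suc i" for j
  proof -
    have "j + 1 \<le> i \<or> i + 2 \<le> j" using that by auto
    then have "real j + 1 \<le> real i \<or> real i + 2 \<le> real j" by linarith
    then show ?thesis using i by (intro window_outside) auto
  qed
  have 1: "window (y - real i) = sine_step (1 - (y - real i))"
    using i by (simp add: window_def sine_step_simps)
  have 2: "window (y - real (Suc i)) = sine_step (y - real i)"
  proof -
    have "1 - (y - real (Suc i)) \<ge> 1" "1 + (y - real (Suc i)) = y - real i" using i by auto
    then show ?thesis by (simp only: window_def sine_step_simps mult_1_right)
  qed
  have red: "(\<Sum>j\<le>n. F (window (y - real j))) = F (window (y - real i)) + F (window (y - real (Suc i)))"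
    if "F 0 = 0" for F :: "real \<Rightarrow> real"
  proof (cases "i = n")
    case True
    then have "y = real i" using i assms by auto
    then have "window (y - real (Suc i)) = 0" by (intro window_outside) auto
    moreover have "(\<Sum>j\<le>n. F (window (y - real j))) = (\<Sum>j\<in>{i}. F (window (y - real j)))"
      by (rule sum.mono_neutral_right) (use True out that in auto)
    ultimately show ?thesis using that by simp
  next
    case False
    have "(\<Sum>j\<le>n. F (window (y - real j))) = (\<Sum>j\<in>{i, Suc i}. F (window (y - real j)))"
      by (rule sum.mono_neutral_right) (use False le out that in auto)
    then show ?thesis by simp
  qed
  show "(\<Sum>j\<le>n. (window (y - real j))\<^sup>2) = 1"
    unfolding red[of "\<lambda>w. w\<^sup>2", simplified] using sine_step_squares[of "y - real i"] 1 2 by simp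
  show "(\<Sum>j\<le>n. window (y - real j)) \<le> 2"
    using red[of "\<lambda>w. w"] window_bounds(2)[of "y - real i"] window_bounds(2)[of "y - real (Suc i)"]
    by linarith
qed

text \<open>Amplitudes are square roots of residuals. They are used only where the residual exceeds a threshold \<open>c\<close>;
  below it the argument is bent upwards, which keeps the function \<open>C\<^sup>1\<close> on the whole line.\<close>

definition safe_sqrt :: "real \<Rightarrow> real \<Rightarrow> real" where
  "safe_sqrt c y = sqrt (y + pos_sq (c - y) / c)"

lemma safe_sqrt_eq: "c \<le> y \<Longrightarrow> safe_sqrt c y = sqrt y"
  by (simp add: safe_sqrt_def pos_sq_def)

text \<open>\<open>c y + (c - y)\<^sup>2\<close> is a positive definite quadratic form in \<open>(c, y)\<close>.\<close>

lemma safe_sqrt_arg: assumes "0 < c" shows "0 < y + pos_sq (c - y) / c"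
proof (cases "y \<ge> c")
  case False
  have "0 < (y - c/2)\<^sup>2 + 3/4 * c\<^sup>2" using assms by (intro add_nonneg_pos) auto
  also have "\<dots> = c * y + (c - y)\<^sup>2" by (simp add: power2_eq_square algebra_simps)
  finally have "0 < (c * y + (c - y)\<^sup>2) / c" using assms by simp
  then show ?thesis using assms False by (simp add: pos_sq_def add_divide_distrib)
qed (use assms in \<open>simp add: pos_sq_def\<close>)

lemma PC1_safe_sqrt: assumes "0 < c" "PC1 f" shows "PC1 (\<lambda>t x. safe_sqrt c (f t x))"
proof (rule PC1_compose[OF _ _ assms(2)])
  let ?F' = "\<lambda>y. inverse (sqrt (y + pos_sq (c - y) / c)) / 2 * (1 - 2 * max 0 (c - y) / c)"
  have ne: "y + pos_sq (c - y) / c > 0" for y using safe_sqrt_arg[OF assms(1)] .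
  show "(safe_sqrt c has_real_derivative ?F' y) (at y)" for y
  proof -
    have "((\<lambda>y. y + pos_sq (c - y) / c) has_real_derivative 1 - 2 * max 0 (c - y) / c) (at y)"
      using DERIV_add[OF DERIV_ident DERIV_cdivide[OF pos_sq_chain[of c y], of c]] by simp
    from DERIV_chain2[OF DERIV_real_sqrt[OF ne] this] show ?thesis
      by (simp only: safe_sqrt_def[abs_def])
  qed
  have nz: "\<forall>y\<in>UNIV. sqrt (y + pos_sq (c - y) / c) \<noteq> 0"
    using less_imp_neq[OF ne] by (metis real_sqrt_eq_zero_cancel_iff)
  have c1: "continuous_on UNIV (\<lambda>y. pos_sq (c - y))"
    by (intro continuous_at_imp_continuous_on ballI DERIV_isCont[OF pos_sq_chain])
  show "continuous_on UNIV ?F'"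
    by (intro continuous_on_mult continuous_on_inverse[OF _ nz] continuous_intros c1) (use assms in auto)
qed

definition time_supported :: "(real \<Rightarrow> real \<Rightarrow> real) \<Rightarrow> bool" where
  "time_supported g \<longleftrightarrow> (\<forall>t x. t \<notin> {1..2} \<longrightarrow> g t x = 0)"

lemma periodic_int:
  assumes "\<And>x. g (x + 1) = (g x :: 'a)" shows "g (x + of_int n) = g (x :: real)"
proof -
  have nat: "g (x + real k) = g x" for k x
  proof (induction k)
    case (Suc k)
    have "g (x + real (Suc k)) = g ((x + real k) + 1)" by (simp add: add_ac)
    then show ?case using assms Suc by simp
  qed simp
  show ?thesis
  proof (cases "0 \<le> n")
    case True then show ?thesis using nat[of x "nat n"] by simp
  next
    case False then show ?thesis using nat[of "x + of_int n" "nat (- n)"] by simp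
  qed
qed

text \<open>Periodicity in \<open>x\<close> and compact support in \<open>t\<close> reduce this to a compact rectangle, with a margin of one
  on each side so that nearby points stay inside it.\<close>

lemma uniform_continuity:
  assumes g: "cbounded g" "\<And>t x. g t (x + 1) = g t x" "\<And>t x. R < \<bar>t\<bar> \<Longrightarrow> g t x = 0" and e: "0 < e"
  obtains d where "0 < d" "\<And>t t' x x'. \<bar>t - t'\<bar> < d \<Longrightarrow> \<bar>x - x'\<bar> < d \<Longrightarrow> \<bar>g t x - g t' x'\<bar> < e"
proof -
  let ?K = "{- R - 1..R + 1} \<times> {-1..2} :: (real \<times> real) set"
  have "uniformly_continuous_on ?K (\<lambda>z. g (fst z) (snd z))"
    by (rule compact_uniformly_continuous)
      (use g(1) in \<open>auto simp: cbounded_def intro: continuous_on_subset compact_Times\<close>)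
  then obtain d where d: "0 < d" "\<And>z z'. z \<in> ?K \<Longrightarrow> z' \<in> ?K \<Longrightarrow> dist z' z < d \<Longrightarrow>
      dist (g (fst z') (snd z')) (g (fst z) (snd z)) < e"
    using e unfolding uniformly_continuous_on_def by meson
  show ?thesis
  proof (rule that[of "min 1 (d / 2)"])
    show "0 < min 1 (d / 2)" using d by auto
    fix t t' x x' :: real assume h: "\<bar>t - t'\<bar> < min 1 (d / 2)" "\<bar>x - x'\<bar> < min 1 (d / 2)"
    show "\<bar>g t x - g t' x'\<bar> < e"
    proof (cases "t \<in> {- R - 1..R + 1} \<and> t' \<in> {- R - 1..R + 1}")
      case False
      then have "R < \<bar>t\<bar>" "R < \<bar>t'\<bar>" using h by auto
      then show ?thesis using g(3) e by simp
    next
      case True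
      define y y' where "y = x + of_int (- \<lfloor>x\<rfloor>)" and "y' = x' + of_int (- \<lfloor>x\<rfloor>)"
      have "g t x = g t y" "g t' x' = g t' y'" unfolding y_def y'_def
        by (simp_all only: periodic_int[of "g t", OF g(2)] periodic_int[of "g t'", OF g(2)])
      moreover have "(t, y) \<in> ?K" "(t', y') \<in> ?K"
        using True h by (auto simp: y_def y'_def; linarith)+
      moreover have "dist (t, y) (t', y') < d"
      proof -
        have "dist (t, y) (t', y') \<le> \<bar>t - t'\<bar> + \<bar>y - y'\<bar>"
          by (simp add: dist_Pair_Pair dist_real_def sqrt_sum_squares_le_sum_abs)
        also have "\<dots> < d" using h by (auto simp: y_def y'_def)
        finally show ?thesis .
      qed
      ultimately show ?thesis using d(2)[of "(t', y')" "(t, y)"] by (simp add: dist_real_def)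
    qed
  qed
qed

lemma difference_quotient_Dx:
  assumes q: "PC1 q" "\<And>t x. R < \<bar>t\<bar> \<Longrightarrow> Dx q t x = 0" and e: "0 < e"
  obtains d where "0 < d" "\<And>h t x. 0 < \<bar>h\<bar> \<Longrightarrow> \<bar>h\<bar> < d \<Longrightarrow> \<bar>(q t (x + h) - q t x) / h - Dx q t x\<bar> \<le> e"
proof -
  obtain d where d: "0 < d" "\<And>t t' x x'. \<bar>t - t'\<bar> < d \<Longrightarrow> \<bar>x - x'\<bar> < d \<Longrightarrow> \<bar>Dx q t x - Dx q t' x'\<bar> < e"
    using uniform_continuity[OF PC1D(6)[OF q(1)] Dt_Dx_periodic(1)[OF q(1)] q(2) e] by blast
  show ?thesis
  proof (rule that[OF d(1)])
    fix h t x :: real assume h: "0 < \<bar>h\<bar>" "\<bar>h\<bar> < d"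
    have "\<exists>z. \<bar>z - x\<bar> < d \<and> q t (x + h) - q t x = h * Dx q t z"
    proof (cases "0 < h")
      case True
      then obtain z where "z > x" "z < x + h" "q t (x + h) - q t x = (x + h - x) * Dx q t z"
        using MVT2[of x "x + h" "q t" "Dx q t"] PC1D(3)[OF q(1)] by auto
      then show ?thesis using h True by (intro exI[of _ z]) auto
    next
      case False
      then obtain z where "z > x + h" "z < x" "q t x - q t (x + h) = (x - (x + h)) * Dx q t z"
        using MVT2[of "x + h" x "q t" "Dx q t"] PC1D(3)[OF q(1)] h by auto
      then show ?thesis using h False by (intro exI[of _ z]) auto
    qed
    then obtain z where z: "\<bar>z - x\<bar> < d" "q t (x + h) - q t x = h * Dx q t z" by blast
    have "\<bar>Dx q t z - Dx q t x\<bar> < e" by (rule d(2)) (use z d in auto)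
    then show "\<bar>(q t (x + h) - q t x) / h - Dx q t x\<bar> \<le> e" using z h by simp
  qed
qed

lemma time_supported_bound: "time_supported g \<Longrightarrow> 2 < \<bar>t\<bar> \<Longrightarrow> g t x = 0"
  unfolding time_supported_def by (metis atLeastAtMost_iff abs_of_nonneg linorder_not_le order_trans zero_le_one)

text \<open>Difference quotients of a \<open>C\<^sup>1\<close> function are again \<open>C\<^sup>1\<close>. Building amplitudes and phases from these
  approximate derivatives is what keeps the iteration inside the class \<open>PC1\<close>, with no loss of derivatives.\<close>

lemma PC1_approx_Dx:
  assumes q: "PC1 q" "time_supported (Dx q)" and e: "0 < e"
  obtains v where "PC1 v" "\<And>t x. \<bar>v t x - Dx q t x\<bar> \<le> e"
proof -
  obtain d where d: "0 < d" "\<And>h t x. 0 < \<bar>h\<bar> \<Longrightarrow> \<bar>h\<bar> < d \<Longrightarrow> \<bar>(q t (x + h) - q t x) / h - Dx q t x\<bar> \<le> e"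
    using difference_quotient_Dx[OF q(1) time_supported_bound[OF q(2)] e] by blast
  define h where "h = d / 2"
  let ?v = "\<lambda>t x. (1 / h) * (q (t + 0) (x + h) - q t x)"
  show ?thesis
  proof (rule that[of ?v])
    show "PC1 ?v" by (intro PC1_cmult(1) PC1_diff PC1_shift q(1))
    show "\<bar>?v t x - Dx q t x\<bar> \<le> e" for t x using d(2)[of h t x] d(1)
      by (simp add: h_def mult.commute)
  qed
qed

lemma PC1_approx_Dt:
  assumes q: "PC1 q" "time_supported (Dt q)" and e: "0 < e"
  obtains v where "PC1 v" "\<And>t x. \<bar>v t x - Dt q t x\<bar> \<le> e"
proof -
  obtain d where d: "0 < d" "\<And>t t' x x'. \<bar>t - t'\<bar> < d \<Longrightarrow> \<bar>x - x'\<bar> < d \<Longrightarrow> \<bar>Dt q t x - Dt q t' x'\<bar> < e"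
    using uniform_continuity[OF PC1D(5)[OF q(1)] Dt_Dx_periodic(2)[OF q(1)] time_supported_bound[OF q(2)] e] by blast
  define h where "h = d / 2"
  have h: "0 < h" "h < d" using d by (auto simp: h_def)
  let ?v = "\<lambda>t x. (1 / h) * (q (t + h) (x + 0) - q t x)"
  show ?thesis
  proof (rule that[of ?v])
    show "PC1 ?v" by (intro PC1_cmult(1) PC1_diff PC1_shift q(1))
    fix t x
    obtain z where z: "z > t" "z < t + h" "q (t + h) x - q t x = (t + h - t) * Dt q z x"
      using MVT2[of t "t + h" "\<lambda>s. q s x" "\<lambda>s. Dt q s x"] PC1D(2)[OF q(1)] h by auto
    have "\<bar>Dt q z x - Dt q t x\<bar> < e" by (rule d(2)) (use z h d in auto)
    then show "\<bar>?v t x - Dt q t x\<bar> \<le> e" using z h by simp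
  qed
qed

section \<open>Rapidly oscillating waves\<close>

text \<open>The phase \<open>x - (t - s) l(x)\<close> has time derivative exactly \<open>- l(x)\<close>, and \<open>x\<close>-derivative close to one as
  long as \<open>t\<close> is near \<open>s\<close>. It replaces the exact solution of the transport equation. The frequency is a
  multiple of \<open>2 \<pi>\<close> for periodicity.\<close>

definition osc :: "nat \<Rightarrow> real \<Rightarrow> (real \<Rightarrow> real) \<Rightarrow> (real \<Rightarrow> real \<Rightarrow> real) \<Rightarrow> real \<Rightarrow> real \<Rightarrow> real" where
  "osc n s l f t x = f t x * sin (2 * pi * real n * (x - (t - s) * l x)) / (2 * pi * real n)"

text \<open>Only the derivatives that fall on the phase survive at high frequency. The deviation of the \<open>x\<close>-derivative
  of the phase from one is kept proportional to the amplitude: this error does not become small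
  with the frequency and has to be summable over the time windows.\<close>

lemma oscillation:
  assumes f: "PC1 f" and lam: "PC1 lam" and supp: "\<And>t x. h \<le> \<bar>t - s\<bar> \<Longrightarrow> f t x = 0"
    and h: "\<And>x. h * \<bar>Dx lam s x\<bar> \<le> \<epsilon>" and e: "0 < e"
  shows "\<forall>\<^sub>F n in sequentially. PC1 (osc n s (lam s) f) \<and> (\<forall>t x.
      let W = osc n s (lam s) f; C = f t x * cos (2 * pi * real n * (x - (t - s) * lam s x)) in
      \<bar>W t x\<bar> \<le> e \<and> \<bar>Dt W t x + lam s x * C\<bar> \<le> e \<and> \<bar>Dx W t x - C\<bar> \<le> e + \<bar>f t x\<bar> * \<epsilon> \<and>
      (f t x = 0 \<and> Dt f t x = 0 \<and> Dx f t x = 0 \<longrightarrow> W t x = 0 \<and> Dt W t x = 0 \<and> Dx W t x = 0))"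
proof -
  note F = PC1D[OF f] and L = PC1D[OF lam]
  obtain A0 A1 A2 where A: "\<And>t x. \<bar>f t x\<bar> \<le> A0" "\<And>t x. \<bar>Dt f t x\<bar> \<le> A1" "\<And>t x. \<bar>Dx f t x\<bar> \<le> A2"
    using F(4,5,6) by (auto simp: cbounded_def)
  obtain M where M: "\<And>x. \<bar>lam s x\<bar> \<le> M" using L(4) by (auto simp: cbounded_def)
  obtain M' where M': "\<And>x. \<bar>Dx lam s x\<bar> \<le> M'" using L(6) by (auto simp: cbounded_def)
  define A where "A = \<bar>A0\<bar> + \<bar>A1\<bar> + \<bar>A2\<bar>"
  have AA: "\<bar>f t x\<bar> \<le> A" "\<bar>Dt f t x\<bar> \<le> A" "\<bar>Dx f t x\<bar> \<le> A" for t x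
    using A(1)[of t x] A(2)[of t x] A(3)[of t x] by (auto simp: A_def)
  have contf: "continuous_on UNIV (\<lambda>z. f (fst z) (snd z))" "continuous_on UNIV (\<lambda>z. Dt f (fst z) (snd z))"
     "continuous_on UNIV (\<lambda>z. Dx f (fst z) (snd z))"
    using F(4,5,6) by (auto simp: cbounded_def)
  have contl: "continuous_on UNIV (\<lambda>z::real\<times>real. lam s (snd z))" "continuous_on UNIV (\<lambda>z::real\<times>real. Dx lam s (snd z))"
    using cbounded_slice[OF L(4), of s] cbounded_slice[OF L(6), of s] by (auto simp: cbounded_def)
  have main: "PC1 (osc n s (lam s) f) \<and> (\<forall>t x.
      let W = osc n s (lam s) f; C = f t x * cos (2 * pi * real n * (x - (t - s) * lam s x)) in
      \<bar>W t x\<bar> \<le> e \<and> \<bar>Dt W t x + lam s x * C\<bar> \<le> e \<and> \<bar>Dx W t x - C\<bar> \<le> e + \<bar>f t x\<bar> * \<epsilon> \<and>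
      (f t x = 0 \<and> Dt f t x = 0 \<and> Dx f t x = 0 \<longrightarrow> W t x = 0 \<and> Dt W t x = 0 \<and> Dx W t x = 0))"
    if n: "0 < n" "A / e \<le> real n" for n
  proof -
    define N where "N = 2 * pi * real n"
    have "1 * real n \<le> 2 * pi * real n" using pi_ge_two by (intro mult_right_mono) auto
    then have "A / e \<le> N" "0 < N" using n unfolding N_def by linarith+
    then have AN: "A / N \<le> e" using e by (simp add: field_simps)
    define th where "th = (\<lambda>t x. N * (x - (t - s) * lam s x))"
    define Wt where "Wt = (\<lambda>t x. Dt f t x * sin (th t x) / N - lam s x * (f t x * cos (th t x)))"
    define Wx where "Wx = (\<lambda>t x. Dx f t x * sin (th t x) / N + f t x * cos (th t x) * (1 - (t - s) * Dx lam s x))"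
    have W: "osc n s (lam s) f = (\<lambda>t x. f t x * sin (th t x) / N)"
      by (intro ext) (simp add: osc_def th_def N_def)
    have contth: "continuous_on UNIV (\<lambda>z. th (fst z) (snd z))"
      unfolding th_def by (intro continuous_intros contl)
    have sinN: "\<bar>g * sin y / N\<bar> \<le> A / N" if "\<bar>g\<bar> \<le> A" for g y
    proof -
      have "\<bar>g * sin y\<bar> \<le> A * 1" unfolding abs_mult by (intro mult_mono that) (auto simp: A_def)
      then show ?thesis using \<open>0 < N\<close> by (simp add: abs_mult divide_right_mono)
    qed
    have fc: "\<bar>f t x * cos y\<bar> \<le> \<bar>f t x\<bar>" for t x y
      unfolding abs_mult by (simp add: mult_left_le)
    have nonres: "\<bar>f t x * cos (th t x) * ((t - s) * Dx lam s x)\<bar> \<le> \<bar>f t x\<bar> * \<epsilon>" for t x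
    proof (cases "h \<le> \<bar>t - s\<bar>")
      case False
      have "\<bar>t - s\<bar> * \<bar>Dx lam s x\<bar> \<le> h * \<bar>Dx lam s x\<bar>" using False by (intro mult_right_mono) auto
      then have "\<bar>(t - s) * Dx lam s x\<bar> \<le> \<epsilon>" using h[of x] by (simp add: abs_mult)
      then show ?thesis using fc[of t x "th t x"] by (subst abs_mult) (intro mult_mono, auto)
    qed (simp add: supp)
    have per: "osc n s (lam s) f t (x + 1) = osc n s (lam s) f t x" for t x
    proof -
      have "2 * pi * real n * (x + 1 - (t - s) * lam s (x + 1)) = 2 * pi * real n * (x - (t - s) * lam s x) + 2 * pi * real n"
        using L(1)[of s x] by (simp add: algebra_simps)
      then have "sin (2 * pi * real n * (x + 1 - (t - s) * lam s (x + 1))) = sin (2 * pi * real n * (x - (t - s) * lam s x))"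
        using sin.plus_of_nat[of "2 * pi * real n * (x - (t - s) * lam s x)" n] by (simp add: mult_ac)
      then show ?thesis by (simp add: osc_def F(1))
    qed
    have dt: "((\<lambda>t. osc n s (lam s) f t x) has_real_derivative Wt t x) (at t)" for t x
    proof -
      have "((\<lambda>t. th t x) has_real_derivative - (N * lam s x)) (at t)"
        unfolding th_def by (auto intro!: derivative_eq_intros)
      from DERIV_cdivide[OF DERIV_mult[OF F(2) DERIV_chain2[OF DERIV_sin this]], of x N]
      show ?thesis using \<open>0 < N\<close> by (simp add: W Wt_def field_simps)
    qed
    have dx: "(osc n s (lam s) f t has_real_derivative Wx t x) (at x)" for t x
    proof -
      have "(th t has_real_derivative N * (1 - (t - s) * Dx lam s x)) (at x)"
        unfolding th_def using L(3)[of s x] by (auto intro!: derivative_eq_intros)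
      from DERIV_cdivide[OF DERIV_mult[OF F(3) DERIV_chain2[OF DERIV_sin this]], of t N]
      show ?thesis using \<open>0 < N\<close> by (simp add: W Wx_def field_simps)
    qed
    have cW: "cbounded (osc n s (lam s) f)"
      unfolding W cbounded_def using sinN[OF AA(1)] \<open>0 < N\<close>
      by (auto intro!: continuous_intros contf contth)
    have cWt: "cbounded Wt"
    proof -
      have "\<bar>Wt t x\<bar> \<le> A / N + M * A" for t x
      proof -
        have "\<bar>lam s x * (f t x * cos (th t x))\<bar> \<le> M * A"
          unfolding abs_mult[of "lam s x"] using M[of x] fc[of t x "th t x"] AA(1)[of t x] by (intro mult_mono) auto
        then show ?thesis unfolding Wt_def using sinN[OF AA(2), of t x "th t x"] by linarith
      qed
      moreover have "continuous_on UNIV (\<lambda>z. Wt (fst z) (snd z))"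
        unfolding Wt_def using \<open>0 < N\<close> by (intro continuous_intros contf contth contl) auto
      ultimately show ?thesis by (auto simp: cbounded_def)
    qed
    have Wx2: "Wx t x = Dx f t x * sin (th t x) / N + f t x * cos (th t x) - f t x * cos (th t x) * ((t - s) * Dx lam s x)" for t x
      by (simp add: Wx_def algebra_simps)
    have cWx: "cbounded Wx"
    proof -
      have "\<bar>Wx t x\<bar> \<le> A / N + A + A * \<bar>\<epsilon>\<bar>" for t x
      proof -
        have "\<bar>f t x\<bar> * \<epsilon> \<le> \<bar>f t x\<bar> * \<bar>\<epsilon>\<bar>" by (intro mult_left_mono) auto
        also have "\<dots> \<le> A * \<bar>\<epsilon>\<bar>" using AA(1)[of t x] by (intro mult_right_mono) auto
        finally have "\<bar>f t x\<bar> * \<epsilon> \<le> A * \<bar>\<epsilon>\<bar>" .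
        then show ?thesis unfolding Wx2
          using sinN[OF AA(3), of t x "th t x"] fc[of t x "th t x"] AA(1)[of t x] nonres[of t x] by linarith
      qed
      moreover have "continuous_on UNIV (\<lambda>z. Wx (fst z) (snd z))"
        unfolding Wx_def using \<open>0 < N\<close> by (intro continuous_intros contf contth contl) auto
      ultimately show ?thesis by (auto simp: cbounded_def)
    qed
    note r = PC1I[OF per dt dx cW cWt cWx]
    have "\<bar>osc n s (lam s) f t x\<bar> \<le> e" for t x
      using sinN[OF AA(1), of t x "th t x"] AN by (simp add: W)
    moreover have "\<bar>Wt t x + lam s x * (f t x * cos (th t x))\<bar> \<le> e" for t x
      using sinN[OF AA(2), of t x "th t x"] AN by (simp add: Wt_def)
    moreover have "\<bar>Wx t x - f t x * cos (th t x)\<bar> \<le> e + \<bar>f t x\<bar> * \<epsilon>" for t x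
      using sinN[OF AA(3), of t x "th t x"] AN nonres[of t x] unfolding Wx2 by linarith
    moreover have "Wt t x = 0" "Wx t x = 0" "osc n s (lam s) f t x = 0"
      if "f t x = 0" "Dt f t x = 0" "Dx f t x = 0" for t x
      using that by (auto simp: Wt_def Wx_def W)
    ultimately show ?thesis using r(1) unfolding Let_def r(2) r(3) th_def N_def by blast
  qed
  have "\<forall>\<^sub>F n in sequentially. A / e \<le> real n"
    using filterlim_real_sequentially by (auto simp: filterlim_at_top)
  with eventually_gt_at_top[of 0] show ?thesis
    by eventually_elim (rule main)
qed

text \<open>A zero of a nonnegative function is a minimum. Hence a wave with nonnegative amplitude vanishes together
  with its first derivatives wherever its amplitude does.\<close>

lemma PC1_zero_min:
  assumes "PC1 f" "\<And>t x. 0 \<le> f t x" "f t x = 0" shows "Dt f t x = 0" "Dx f t x = 0"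
  using DERIV_local_min[OF PC1D(2)[OF assms(1), of x t], of 1] DERIV_local_min[OF PC1D(3)[OF assms(1), of t x], of 1] assms
  by auto

text \<open>In the limit of high frequency \<open>Dx Q\<close> is the wave \<open>c = \<surd>2 al cos \<theta>\<close> and \<open>Dx P\<close> is \<open>m c\<close> plus a second
  harmonic. The latter is there because \<open>(c\<^sup>2 - al\<^sup>2) / 2 = al\<^sup>2 cos (2 \<theta>) / 2\<close> has mean zero, hence is the derivative
  of a small function, and cancels the oscillating part of \<open>c\<^sup>2 / 2\<close> in the flux.\<close>

lemma wave:
  assumes al: "PC1 al" "\<And>t x. 0 \<le> al t x" "\<And>t x. al t x \<le> 1"
    and m: "PC1 m" "\<And>t x. \<bar>m t x\<bar> \<le> 2" and lam: "PC1 lam"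
    and supp: "\<And>t x. h \<le> \<bar>t - s\<bar> \<Longrightarrow> al t x = 0"
    and h: "\<And>x. h * \<bar>Dx lam s x\<bar> \<le> \<kappa>" and e: "0 < e" and k: "0 \<le> \<kappa>"
  obtains P Q c where "PC1 P" "PC1 Q"
    "\<And>t x. al t x = 0 \<Longrightarrow> P t x = 0 \<and> Q t x = 0 \<and> Dt P t x = 0 \<and> Dx P t x = 0 \<and> Dt Q t x = 0 \<and> Dx Q t x = 0"
    "\<And>t x. (c t x)\<^sup>2 \<le> 2 * (al t x)\<^sup>2"
    "\<And>t x. \<bar>P t x\<bar> \<le> e" "\<And>t x. \<bar>Q t x\<bar> \<le> e"
    "\<And>t x. \<bar>Dx Q t x - c t x\<bar> \<le> e + 4 * \<kappa> * al t x" "\<And>t x. \<bar>Dt Q t x + lam s x * c t x\<bar> \<le> e"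
    "\<And>t x. \<bar>Dx P t x - (m t x * c t x + ((c t x)\<^sup>2 - (al t x)\<^sup>2) / 2)\<bar> \<le> e + 4 * \<kappa> * al t x"
    "\<And>t x. \<bar>Dt P t x + lam s x * (m t x * c t x + ((c t x)\<^sup>2 - (al t x)\<^sup>2) / 2)\<bar> \<le> e"
proof -
  define f1 where "f1 = (\<lambda>t x. sqrt 2 * al t x)"
  define f2 where "f2 = (\<lambda>t x. f1 t x * m t x)"
  define f3 where "f3 = (\<lambda>t x. (1 / 2) * (al t x * al t x))"
  have p: "PC1 f1" "PC1 f2" "PC1 f3"
    unfolding f1_def f2_def f3_def by (intro PC1_cmult(1) PC1_mult(1) al m)+
  have z: "f1 t x = 0 \<and> Dt f1 t x = 0 \<and> Dx f1 t x = 0" "f2 t x = 0 \<and> Dt f2 t x = 0 \<and> Dx f2 t x = 0"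
      "f3 t x = 0 \<and> Dt f3 t x = 0 \<and> Dx f3 t x = 0" if "al t x = 0" for t x
  proof -
    note zz = that PC1_zero_min[OF al(1,2) that]
    show 1: "f1 t x = 0 \<and> Dt f1 t x = 0 \<and> Dx f1 t x = 0"
      unfolding f1_def PC1_cmult(2,3)[OF al(1)] by (simp add: zz)
    show "f2 t x = 0 \<and> Dt f2 t x = 0 \<and> Dx f2 t x = 0"
      unfolding f2_def PC1_mult(2,3)[OF p(1) m(1)] using 1 by simp
    show "f3 t x = 0 \<and> Dt f3 t x = 0 \<and> Dx f3 t x = 0"
      unfolding f3_def PC1_cmult(2,3)[OF PC1_mult(1)[OF al(1) al(1)]] PC1_mult(2,3)[OF al(1) al(1)] by (simp add: zz)
  qed
  have s: "h \<le> \<bar>t - s\<bar> \<Longrightarrow> f1 t x = 0" "h \<le> \<bar>t - s\<bar> \<Longrightarrow> f2 t x = 0" "h \<le> \<bar>t - s\<bar> \<Longrightarrow> f3 t x = 0" for t x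
    using supp[of t x] by (auto simp: f1_def f2_def f3_def)
  have sq2: "sqrt 2 \<le> 3 / 2" by (rule real_le_lsqrt) (auto simp: power2_eq_square)
  have b1: "\<bar>f1 t x\<bar> \<le> 3 / 2 * al t x" for t x
    using mult_right_mono[OF sq2 al(2)[of t x]] al(2)[of t x] by (simp add: f1_def abs_mult)
  have b2: "\<bar>f2 t x\<bar> \<le> 3 / 2 * al t x * 2" for t x
    unfolding f2_def abs_mult using b1[of t x] m(2)[of t x] by (intro mult_mono) auto
  have b3: "\<bar>f3 t x\<bar> \<le> 1 / 2 * al t x" for t x
    using al(2)[of t x] mult_right_mono[OF al(3)[of t x] al(2)[of t x]] by (simp add: f3_def abs_mult)
  have e4: "0 < e / 4" using e by simp
  let ?R = "\<lambda>f n. PC1 (osc n s (lam s) f) \<and> (\<forall>t x.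
      let W = osc n s (lam s) f; C = f t x * cos (2 * pi * real n * (x - (t - s) * lam s x)) in
      \<bar>W t x\<bar> \<le> e / 4 \<and> \<bar>Dt W t x + lam s x * C\<bar> \<le> e / 4 \<and> \<bar>Dx W t x - C\<bar> \<le> e / 4 + \<bar>f t x\<bar> * \<kappa> \<and>
      (f t x = 0 \<and> Dt f t x = 0 \<and> Dx f t x = 0 \<longrightarrow> W t x = 0 \<and> Dt W t x = 0 \<and> Dx W t x = 0))"
  have ev: "\<forall>\<^sub>F n in sequentially. ?R f1 n \<and> ?R f2 n"
    by (rule eventually_conj[OF oscillation[OF p(1) lam s(1) h e4] oscillation[OF p(2) lam s(2) h e4]])
  have ev3: "\<forall>\<^sub>F n in sequentially. ?R f3 n"
    by (rule oscillation[OF p(3) lam s(3) h e4])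
  obtain n1 where n1: "\<And>n. n \<ge> n1 \<Longrightarrow> ?R f1 n \<and> ?R f2 n"
    using ev unfolding eventually_sequentially by blast
  obtain n3 where n3: "\<And>n. n \<ge> n3 \<Longrightarrow> ?R f3 n"
    using ev3 unfolding eventually_sequentially by blast
  define n where "n = max n1 n3"
  define Q where "Q = osc n s (lam s) f1"
  define P2 where "P2 = osc n s (lam s) f2"
  define P3 where "P3 = osc (2 * n) s (lam s) f3"
  define th where "th = (\<lambda>t x. 2 * pi * real n * (x - (t - s) * lam s x))"
  define c where "c = (\<lambda>t x. f1 t x * cos (th t x))"
  have nn: "n1 \<le> n" "n3 \<le> 2 * n" by (auto simp: n_def)
  note R1 = conjunct1[OF n1[OF nn(1)]] and R2 = conjunct2[OF n1[OF nn(1)]] and R3 = n3[OF nn(2)]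
  have th2: "2 * pi * real (2 * n) * (x - (t - s) * lam s x) = 2 * th t x" for t x
    by (simp add: th_def)
  have th1: "2 * pi * real n * (x - (t - s) * lam s x) = th t x" for t x
    by (simp add: th_def)
  note R1 = R1[folded Q_def, unfolded Let_def th1] and R2 = R2[folded P2_def, unfolded Let_def th1]
    and R3 = R3[folded P3_def, unfolded Let_def th2]
  note r1 = conjunct2[OF R1, THEN spec, THEN spec, THEN conjunct1]
    conjunct2[OF R1, THEN spec, THEN spec, THEN conjunct2, THEN conjunct1]
    conjunct2[OF R1, THEN spec, THEN spec, THEN conjunct2, THEN conjunct2, THEN conjunct1]
    conjunct2[OF R1, THEN spec, THEN spec, THEN conjunct2, THEN conjunct2, THEN conjunct2, THEN mp]
  note r2 = conjunct2[OF R2, THEN spec, THEN spec, THEN conjunct1]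
    conjunct2[OF R2, THEN spec, THEN spec, THEN conjunct2, THEN conjunct1]
    conjunct2[OF R2, THEN spec, THEN spec, THEN conjunct2, THEN conjunct2, THEN conjunct1]
    conjunct2[OF R2, THEN spec, THEN spec, THEN conjunct2, THEN conjunct2, THEN conjunct2, THEN mp]
  note r3 = conjunct2[OF R3, THEN spec, THEN spec, THEN conjunct1]
    conjunct2[OF R3, THEN spec, THEN spec, THEN conjunct2, THEN conjunct1]
    conjunct2[OF R3, THEN spec, THEN spec, THEN conjunct2, THEN conjunct2, THEN conjunct1]
    conjunct2[OF R3, THEN spec, THEN spec, THEN conjunct2, THEN conjunct2, THEN conjunct2, THEN mp]
  define P where "P = (\<lambda>t x. P2 t x + P3 t x)"
  note PP = PC1_add[OF conjunct1[OF R2] conjunct1[OF R3], folded P_def]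
  have c2: "f2 t x * cos (th t x) = m t x * c t x" for t x by (simp add: f2_def c_def)
  have cc: "(c t x)\<^sup>2 = 2 * (al t x)\<^sup>2 * (cos (th t x))\<^sup>2" for t x
    by (simp add: c_def f1_def power_mult_distrib)
  have c3: "f3 t x * cos (2 * th t x) = ((c t x)\<^sup>2 - (al t x)\<^sup>2) / 2" for t x
    unfolding cc cos_double_cos by (simp add: f3_def power2_eq_square algebra_simps)
  have E1: "\<bar>f1 t x\<bar> * \<kappa> \<le> 3 / 2 * (\<kappa> * al t x)" for t x
    using mult_right_mono[OF b1[of t x] k] by (simp add: mult_ac)
  have E2: "\<bar>f2 t x\<bar> * \<kappa> \<le> 3 * (\<kappa> * al t x)" for t x
    using mult_right_mono[OF b2[of t x] k] by (simp add: mult_ac)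
  have E3: "\<bar>f3 t x\<bar> * \<kappa> \<le> 1 / 2 * (\<kappa> * al t x)" for t x
    using mult_right_mono[OF b3[of t x] k] by (simp add: mult_ac)
  have kal: "0 \<le> \<kappa> * al t x" for t x using k al(2)[of t x] by simp
  have Q: "\<bar>Q t x\<bar> \<le> e / 4" "\<bar>Dt Q t x + lam s x * c t x\<bar> \<le> e / 4" "\<bar>Dx Q t x - c t x\<bar> \<le> e / 4 + 3 / 2 * (\<kappa> * al t x)" for t x
    using r1(1)[of t x] r1(2)[of t x] r1(3)[of t x] E1[of t x] unfolding c_def by linarith+
  have P2: "\<bar>P2 t x\<bar> \<le> e / 4" "\<bar>Dt P2 t x + lam s x * (m t x * c t x)\<bar> \<le> e / 4"
    "\<bar>Dx P2 t x - m t x * c t x\<bar> \<le> e / 4 + 3 * (\<kappa> * al t x)" for t x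
    using r2(1)[of t x] r2(2)[of t x] r2(3)[of t x] E2[of t x] unfolding c2 by linarith+
  have P3: "\<bar>P3 t x\<bar> \<le> e / 4" "\<bar>Dt P3 t x + lam s x * (((c t x)\<^sup>2 - (al t x)\<^sup>2) / 2)\<bar> \<le> e / 4"
    "\<bar>Dx P3 t x - ((c t x)\<^sup>2 - (al t x)\<^sup>2) / 2\<bar> \<le> e / 4 + 1 / 2 * (\<kappa> * al t x)" for t x
    using r3(1)[of t x] r3(2)[of t x] r3(3)[of t x] E3[of t x] unfolding c3 by linarith+
  show ?thesis
  proof (rule that[of P Q c])
    show "PC1 P" by (rule PP(1))
    show "PC1 Q" using R1 by blast
    fix t x
    show "P t x = 0 \<and> Q t x = 0 \<and> Dt P t x = 0 \<and> Dx P t x = 0 \<and> Dt Q t x = 0 \<and> Dx Q t x = 0" if "al t x = 0"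
    proof -
      have "Q t x = 0 \<and> Dt Q t x = 0 \<and> Dx Q t x = 0" by (rule r1(4)[OF z(1)[OF that]])
      moreover have "P2 t x = 0 \<and> Dt P2 t x = 0 \<and> Dx P2 t x = 0" by (rule r2(4)[OF z(2)[OF that]])
      moreover have "P3 t x = 0 \<and> Dt P3 t x = 0 \<and> Dx P3 t x = 0" by (rule r3(4)[OF z(3)[OF that]])
      ultimately show ?thesis unfolding PP(2,3) by (simp add: P_def)
    qed
    show "(c t x)\<^sup>2 \<le> 2 * (al t x)\<^sup>2" unfolding cc by (simp add: mult_left_le abs_square_le_1)
    show "\<bar>P t x\<bar> \<le> e" using P2(1)[of t x] P3(1)[of t x] e by (simp add: P_def)
    show "\<bar>Q t x\<bar> \<le> e" "\<bar>Dt Q t x + lam s x * c t x\<bar> \<le> e" using Q[of t x] e by linarith+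
    show "\<bar>Dx Q t x - c t x\<bar> \<le> e + 4 * \<kappa> * al t x"
      using Q(3)[of t x] e kal[of t x] by linarith
    show "\<bar>Dx P t x - (m t x * c t x + ((c t x)\<^sup>2 - (al t x)\<^sup>2) / 2)\<bar> \<le> e + 4 * \<kappa> * al t x"
      using P2(3)[of t x] P3(3)[of t x] e kal[of t x] unfolding PP(3) by linarith
    show "\<bar>Dt P t x + lam s x * (m t x * c t x + ((c t x)\<^sup>2 - (al t x)\<^sup>2) / 2)\<bar> \<le> e"
      using P2(2)[of t x] P3(2)[of t x] e unfolding PP(2) distrib_left by linarith
  qed
qed

lemma abs_mult_le: "\<bar>a\<bar> \<le> A \<Longrightarrow> \<bar>b\<bar> \<le> B \<Longrightarrow> \<bar>a * b\<bar> \<le> A * (B::real)"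
  unfolding abs_mult by (intro mult_mono) auto

text \<open>The linear terms cancel by the choice \<open>m = l + v\<close>, the first component of the eigenvector with second component one;
  what remains of them is, up to sign, \<open>c\<close> times the characteristic polynomial of \<open>Df\<close> at \<open>l\<close>.
  Of the quadratic terms the means \<open>(l, -1) al\<^sup>2 / 2\<close> survive and, in the first equation, a multiple of \<open>v\<close>:
  this is the effect of genuine nonlinearity. Together with the cubic terms it is bounded by \<open>3 \<eta> al\<^sup>2\<close>. The \<open>e\<^sub>i\<close> are the errors of \<open>wave\<close>.\<close>

lemma flux_increment:
  fixes u v l m c al e1 e2 e3 e4 \<tau> \<eta> :: real
  defines "U \<equiv> m * c + (c\<^sup>2 - al\<^sup>2) / 2"
  assumes c: "c\<^sup>2 \<le> 2 * al\<^sup>2" and al: "0 \<le> al" "al \<le> \<eta>" and eta: "\<eta> \<le> 1 / 2"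
    and uv: "\<bar>u\<bar> \<le> \<eta>" "\<bar>v\<bar> \<le> \<eta>" and l: "\<bar>l\<bar> \<le> 3 / 2" and m: "\<bar>m - (l + v)\<bar> \<le> \<tau>" and tau: "\<tau> \<le> 1"
    and e: "\<bar>e1\<bar> \<le> \<tau>" "\<bar>e2\<bar> \<le> \<tau>" "\<bar>e3\<bar> \<le> \<tau>" "\<bar>e4\<bar> \<le> \<tau>"
  shows "\<bar>(- l * c + e2) + (U + e3) - v * (c + e1) - (c + e1)\<^sup>2 / 2 + al\<^sup>2 / 2\<bar> \<le> 6 * \<tau>"
    "\<bar>(- l * U + e4) + (u * (c + e1) + v * (U + e3) + (U + e3) * (c + e1)) / 2 + (c + e1) - l * al\<^sup>2 / 2\<bar>
      \<le> \<bar>c\<bar> * \<bar>1 + u / 2 + v\<^sup>2 / 2 - l * v / 2 - l\<^sup>2\<bar> + 3 * \<eta> * al\<^sup>2 + 12 * \<tau>"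
proof -
  have t0: "0 \<le> \<tau>" using e by linarith
  have al1: "al \<le> 1 / 2" using al eta by linarith
  have al2: "al\<^sup>2 \<le> (1 / 2)\<^sup>2" using al al1 by (intro power_mono) auto
  have "\<bar>c\<bar>\<^sup>2 \<le> 1\<^sup>2" using c al2 by (simp add: power2_eq_square)
  then have c1: "\<bar>c\<bar> \<le> 1" by (rule power2_le_imp_le) auto
  have "c\<^sup>2 \<le> 4 * al\<^sup>2" using c zero_le_power2[of al] by linarith
  then have "\<bar>c\<bar>\<^sup>2 \<le> (2 * al)\<^sup>2" by (simp add: power_mult_distrib)
  then have c2: "\<bar>c\<bar> \<le> 2 * al" by (rule power2_le_imp_le) (use al in auto)
  define \<theta> where "\<theta> = m - (l + v)"
  have me: "m = l + v + \<theta>" by (simp add: \<theta>_def)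
  have th: "\<bar>\<theta>\<bar> \<le> \<tau>" using m by (simp add: \<theta>_def)
  have vv: "\<bar>v\<bar> \<le> 1 / 2" "\<bar>u\<bar> \<le> 1 / 2" using uv eta by linarith+
  have id1: "(- l * c + e2) + (U + e3) - v * (c + e1) - (c + e1)\<^sup>2 / 2 + al\<^sup>2 / 2
      = \<theta> * c + e2 + e3 - (v + c) * e1 - e1 * e1 / 2"
    unfolding U_def me by (simp add: power2_eq_square field_simps)
  have e1: "\<bar>(v + c) * e1\<bar> \<le> 3 / 2 * \<tau>" by (rule abs_mult_le[OF _ e(1)]) (use vv c1 in linarith)
  have e11: "\<bar>e1 * e1\<bar> \<le> 1 * \<tau>" by (rule abs_mult_le[OF _ e(1)]) (use e(1) tau in linarith)
  note B = abs_mult_le[OF th c1] e1 e11 e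
  show "\<bar>(- l * c + e2) + (U + e3) - v * (c + e1) - (c + e1)\<^sup>2 / 2 + al\<^sup>2 / 2\<bar> \<le> 6 * \<tau>"
    unfolding id1 by (rule abs_leI; use B[THEN abs_le_D1] B[THEN abs_le_D2] t0 in linarith)
  define K where "K = 1 + u / 2 + v\<^sup>2 / 2 - l * v / 2 - l\<^sup>2"
  have id2: "(- l * U + e4) + (u * (c + e1) + v * (U + e3) + (U + e3) * (c + e1)) / 2 + (c + e1) - l * al\<^sup>2 / 2
      = c * K + v * (3 / 4 * c\<^sup>2 - al\<^sup>2 / 4) + c * (c\<^sup>2 - al\<^sup>2) / 4
        + \<theta> * (c * (v / 2 - l) + c * c / 2) + e4 + u * e1 / 2 + v * e3 / 2 + U * e1 / 2 + c * e3 / 2 + e1 * e3 / 2 + e1"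
    unfolding U_def me K_def by (simp add: power2_eq_square field_simps)
  have ac: "\<bar>c\<^sup>2 - al\<^sup>2\<bar> \<le> al\<^sup>2"
    by (rule abs_leI; use c zero_le_power2[of c] in linarith)
  have b1: "\<bar>v * (3 / 4 * c\<^sup>2 - al\<^sup>2 / 4)\<bar> \<le> \<eta> * (5 / 4 * al\<^sup>2)"
    by (rule abs_mult_le[OF uv(2)], rule abs_leI; use c zero_le_power2[of c] zero_le_power2[of al] in linarith)
  have b2: "\<bar>c * (c\<^sup>2 - al\<^sup>2)\<bar> \<le> (2 * \<eta>) * al\<^sup>2" by (rule abs_mult_le[OF _ ac]) (use c2 al in linarith)
  have b3: "\<bar>\<theta> * (c * (v / 2 - l) + c * c / 2)\<bar> \<le> \<tau> * 3"
  proof (rule abs_mult_le[OF th])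
    have h: "\<bar>c * (v / 2 - l)\<bar> \<le> 1 * 2" by (rule abs_mult_le[OF c1]) (use vv l in linarith)
    note hh = h abs_mult_le[OF c1 c1]
    show "\<bar>c * (v / 2 - l) + c * c / 2\<bar> \<le> 3"
      by (rule abs_leI; use hh[THEN abs_le_D1] hh[THEN abs_le_D2] in linarith)
  qed
  have b4: "\<bar>e1 * e3\<bar> \<le> 1 * \<tau>" by (rule abs_mult_le[OF _ e(3)]) (use e(1) tau in linarith)
  have b5: "\<bar>U * e1\<bar> \<le> 4 * \<tau>"
  proof (rule abs_mult_le[OF _ e(1)])
    have h: "\<bar>m * c\<bar> \<le> 3 * 1" by (rule abs_mult_le[OF _ c1]) (use m l vv tau in linarith)
    have "\<bar>c\<^sup>2 - al\<^sup>2\<bar> \<le> 1" using ac al2 by (simp add: power2_eq_square)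
    note hh = h this
    show "\<bar>U\<bar> \<le> 4" unfolding U_def
      by (rule abs_leI; use hh[THEN abs_le_D1] hh[THEN abs_le_D2] in \<open>simp add: diff_divide_distrib; linarith\<close>)
  qed
  have b6: "\<bar>c * K\<bar> \<le> \<bar>c\<bar> * \<bar>K\<bar>" by (simp add: abs_mult)
  have b7: "0 \<le> \<eta> * al\<^sup>2" using al by auto
  note B = b1 b2 b3 b4 b5 b6 abs_mult_le[OF vv(2) e(1)] abs_mult_le[OF vv(1) e(3)] abs_mult_le[OF c1 e(3)] e
  show "\<bar>(- l * U + e4) + (u * (c + e1) + v * (U + e3) + (U + e3) * (c + e1)) / 2 + (c + e1) - l * al\<^sup>2 / 2\<bar>
      \<le> \<bar>c\<bar> * \<bar>1 + u / 2 + v\<^sup>2 / 2 - l * v / 2 - l\<^sup>2\<bar> + 3 * \<eta> * al\<^sup>2 + 12 * \<tau>"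
    unfolding id2 K_def[symmetric] by (rule abs_leI; use B[THEN abs_le_D1] B[THEN abs_le_D2] b7 t0 in linarith)
qed

section \<open>Pointwise effect of a wave on the residual\<close>

lemma abs_add_le: "\<bar>a\<bar> \<le> A \<Longrightarrow> \<bar>b\<bar> \<le> B \<Longrightarrow> \<bar>a + b\<bar> \<le> A + (B::real)"
  by linarith

lemma abs_diff_le: "\<bar>a\<bar> \<le> A \<Longrightarrow> \<bar>b\<bar> \<le> B \<Longrightarrow> \<bar>a - b\<bar> \<le> A + (B::real)"
  by linarith

lemma abs_half_le: "\<bar>a\<bar> \<le> A \<Longrightarrow> \<bar>a / 2\<bar> \<le> A / (2::real)"
  by linarith

text \<open>One wave with \<open>al\<^sup>2 = 2 b\<^sup>2\<close>, added after other waves of the same family. Here \<open>(ub, vb)\<close> is the state before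
  all of them, \<open>(ut, vt)\<close> a regularisation of it whose exact speed is \<open>lt\<close>, and \<open>(uc, vc)\<close> the current state.
  The speed \<open>l\<close> is close to \<open>lt\<close>, yet the characteristic polynomial at the current state is still
  small: earlier waves move the state almost along \<open>(\<sigma>, 1)\<close>, and along this eigendirection the speed hardly
  varies since \<open>v\<close> is small. This is what makes overlapping waves of one family harmless.\<close>

lemma wave_increment:
  fixes \<sigma> \<epsilon> \<eta> \<kappa> a b e ub vb ut vt lt l m c uc vc px pt qx qt :: real
  assumes sig: "\<sigma> = 1 \<or> \<sigma> = -1" and eta: "\<eta> = 20 * \<epsilon>" "\<eta> \<le> 1 / 10" and kap: "0 \<le> \<kappa>" "\<kappa> \<le> \<epsilon>"
    and ab: "0 \<le> b" "b \<le> a" "a \<le> \<epsilon>" and e: "0 \<le> e" "e \<le> \<kappa>"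
    and base: "\<bar>ub\<bar> \<le> \<epsilon>" "\<bar>vb\<bar> \<le> \<epsilon>"
    and char: "1 + ut / 2 + vt\<^sup>2 / 2 - lt * vt / 2 - lt\<^sup>2 = 0"
    and near: "\<bar>ub - ut\<bar> \<le> \<kappa>" "\<bar>vb - vt\<bar> \<le> \<kappa>" "\<bar>l - lt\<bar> \<le> \<kappa>" "\<bar>lt - \<sigma>\<bar> \<le> 3 * \<epsilon>"
    and cur: "\<bar>vc - vb\<bar> \<le> 6 * a + \<kappa>" "\<bar>(uc - ub) - \<sigma> * (vc - vb)\<bar> \<le> 20 * \<eta> * a + \<kappa>"
    and m: "\<bar>m - (l + vc)\<bar> \<le> e / 50" and c: "c\<^sup>2 \<le> 4 * b\<^sup>2"
    and q: "\<bar>qx - c\<bar> \<le> e / 50 + 6 * \<kappa> * b" "\<bar>qt + l * c\<bar> \<le> e / 50"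
    and p: "\<bar>px - (m * c + (c\<^sup>2 - 2 * b\<^sup>2) / 2)\<bar> \<le> e / 50 + 6 * \<kappa> * b"
      "\<bar>pt + l * (m * c + (c\<^sup>2 - 2 * b\<^sup>2) / 2)\<bar> \<le> e / 50"
  shows "\<bar>qx\<bar> \<le> 3 * b + e" "\<bar>px - \<sigma> * qx\<bar> \<le> 10 * \<eta> * b + e"
    "\<bar>pt + (uc * qx + vc * px + px * qx) / 2 + qx - \<sigma> * b\<^sup>2\<bar> \<le> (100 * \<eta> * a + 200 * \<kappa>) * b + e"
    "\<bar>qt + px - vc * qx - qx\<^sup>2 / 2 + b\<^sup>2\<bar> \<le> 200 * \<kappa> * b + e"
proof -
  define U where "U = m * c + (c\<^sup>2 - 2 * b\<^sup>2) / 2"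
  define T where "T = e / 50 + 6 * (\<kappa> * b)"
  define dv where "dv = vc - vb"
  have \<epsilon>: "0 \<le> \<epsilon>" "\<epsilon> \<le> 1 / 200" using eta kap by linarith+
  have kb: "0 \<le> \<kappa> * b" using kap ab by simp
  have kb1: "\<kappa> * b \<le> 1 / 200 * b" using kap \<epsilon> ab by (intro mult_right_mono) auto
  have kb2: "\<kappa> * b \<le> 1 / 20 * (\<eta> * b)" using mult_right_mono[OF kap(2) ab(1)] eta by simp
  have b1: "b \<le> 1 / 200" using ab \<epsilon> by linarith
  have T: "0 \<le> T" "T \<le> 1" "T \<le> e / 50 + 6 / 200 * b" using kb kb1 e kap \<epsilon> b1 by (auto simp: T_def)
  have "\<bar>c\<bar>\<^sup>2 \<le> (2 * b)\<^sup>2" using c by (simp add: power_mult_distrib)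
  then have c2: "\<bar>c\<bar> \<le> 2 * b" by (rule power2_le_imp_le) (use ab in auto)
  have sb: "\<bar>\<sigma>\<bar> = 1" using sig by auto
  have l\<sigma>: "\<bar>l - \<sigma>\<bar> \<le> \<eta> / 5" using near(3,4) kap eta by linarith
  have dv1: "\<bar>dv\<bar> \<le> 6 * a + \<kappa>" using cur(1) by (simp add: dv_def)
  have dv: "\<bar>dv\<bar> \<le> 7 * \<epsilon>" using dv1 ab kap by linarith
  have vc: "\<bar>vc\<bar> \<le> 8 * \<epsilon>" using dv base unfolding dv_def by linarith
  have "20 * \<eta> * a \<le> 20 * (1 / 10) * \<epsilon>" using eta ab \<epsilon> by (intro mult_mono) auto
  moreover have "\<bar>\<sigma> * dv\<bar> = \<bar>dv\<bar>" using sb by (simp add: abs_mult)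
  ultimately have uc: "\<bar>uc\<bar> \<le> 11 * \<epsilon>" using cur(2) dv base kap unfolding dv_def by linarith
  have l1: "\<bar>l\<bar> \<le> 3 / 2" "\<bar>lt\<bar> \<le> 3 / 2" using near(3,4) sb \<epsilon> kap by linarith+
  have vt: "\<bar>vt\<bar> \<le> 1 / 2" using near(2) base \<epsilon> kap by linarith
  have q1: "\<bar>qx - c\<bar> \<le> T" and p1: "\<bar>px - U\<bar> \<le> T" and q2: "\<bar>qt + l * c\<bar> \<le> T" and p2: "\<bar>pt + l * U\<bar> \<le> T"
    and mT: "\<bar>m - (l + vc)\<bar> \<le> T"
    using q p m kb by (auto simp: T_def U_def mult.assoc)
  show "\<bar>qx\<bar> \<le> 3 * b + e" using q1 c2 T e ab by linarith
  have cb: "c\<^sup>2 - 2 * b\<^sup>2 \<le> 2 * b\<^sup>2" "- (2 * b\<^sup>2) \<le> c\<^sup>2 - 2 * b\<^sup>2" using c zero_le_power2[of c] by linarith+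
  have bb: "b\<^sup>2 \<le> a * b" using ab by (simp add: power2_eq_square mult_right_mono)
  have eb: "0 \<le> \<eta> * b" using eta \<epsilon> ab by simp
  have b2: "b\<^sup>2 \<le> 1 / 20 * (\<eta> * b)"
  proof -
    have "b * b \<le> \<epsilon> * b" using ab by (intro mult_right_mono) auto
    then show ?thesis using eta by (simp add: power2_eq_square)
  qed
  show "\<bar>px - \<sigma> * qx\<bar> \<le> 10 * \<eta> * b + e"
  proof -
    have id: "px - \<sigma> * qx = (m - \<sigma>) * c + (c\<^sup>2 - 2 * b\<^sup>2) / 2 + (px - U) - \<sigma> * (qx - c)"
      unfolding U_def by (simp add: algebra_simps)
    have m1: "\<bar>m - \<sigma>\<bar> \<le> 2 * \<eta>" using l\<sigma> vc eta \<epsilon> m e kap by linarith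
    have s1: "\<bar>\<sigma> * (qx - c)\<bar> \<le> 1 * T" by (rule abs_mult_le) (use sb q1 in auto)
    have mc: "\<bar>(m - \<sigma>) * c\<bar> \<le> 4 * (\<eta> * b)" using abs_mult_le[OF m1 c2] by simp
    have cb': "\<bar>c\<^sup>2 - 2 * b\<^sup>2\<bar> \<le> 2 * b\<^sup>2" using cb by (intro abs_leI) linarith+
    note B = abs_diff_le[OF abs_add_le[OF abs_add_le[OF mc abs_half_le[OF cb']] p1] s1]
    have T2: "2 * T \<le> \<eta> * b + e" using kb2 e eb by (simp add: T_def)
    have "\<bar>px - \<sigma> * qx\<bar> \<le> 10 * (\<eta> * b) + e" unfolding id
      by (rule order_trans[OF B]) (use b2 eb T2 in linarith)
    then show ?thesis by (simp add: mult.assoc)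
  qed
  define K where "K = 1 + uc / 2 + vc\<^sup>2 / 2 - l * vc / 2 - l\<^sup>2"
  have K: "\<bar>K\<bar> \<le> 16 * (\<eta> * a) + 7 * \<kappa>"
  proof -
    have id: "K = (ub - ut) / 2 + (vb - vt) * (vb + vt) / 2 - (l * (vb - vt) + vt * (l - lt)) / 2 - (l - lt) * (l + lt)
        + ((uc - ub) - \<sigma> * dv) / 2 + dv * (\<sigma> - l) / 2 + dv * (2 * vb + dv) / 2
        + (1 + ut / 2 + vt\<^sup>2 / 2 - lt * vt / 2 - lt\<^sup>2)"
      unfolding K_def dv_def by (simp add: power2_eq_square field_simps)
    have h1: "\<bar>vb + vt\<bar> \<le> 1" using vt base \<epsilon> by linarith
    have h2: "\<bar>l + lt\<bar> \<le> 3" using l1 by linarith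
    have h3: "\<bar>\<sigma> - l\<bar> \<le> \<eta>" using l\<sigma> eta \<epsilon> by linarith
    have h4: "\<bar>2 * vb + dv\<bar> \<le> \<eta>" using base dv eta \<epsilon> by linarith
    have "\<kappa> * \<eta> \<le> \<kappa> * (1 / 10)" using kap eta by (intro mult_left_mono) auto
    then have "(6 * a + \<kappa>) * \<eta> \<le> 6 * (\<eta> * a) + \<kappa> / 10" by (simp add: algebra_simps)
    then have h5: "\<bar>dv * (\<sigma> - l)\<bar> \<le> 6 * (\<eta> * a) + \<kappa> / 10" "\<bar>dv * (2 * vb + dv)\<bar> \<le> 6 * (\<eta> * a) + \<kappa> / 10"
      using abs_mult_le[OF dv1 h3] abs_mult_le[OF dv1 h4] by linarith+
    have h6: "\<bar>(uc - ub) - \<sigma> * dv\<bar> \<le> 20 * (\<eta> * a) + \<kappa>" using cur(2) by (simp add: dv_def mult.assoc)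
    have h7: "0 \<le> \<eta> * a" using eta \<epsilon> ab by simp
    note B = abs_add_le[OF abs_add_le[OF abs_add_le[OF abs_diff_le[OF abs_diff_le[OF abs_add_le[OF abs_half_le[OF near(1)]
      abs_half_le[OF abs_mult_le[OF near(2) h1]]] abs_half_le[OF abs_add_le[OF abs_mult_le[OF l1(1) near(2)] abs_mult_le[OF vt near(3)]]]]
      abs_mult_le[OF near(3) h2]] abs_half_le[OF h6]] abs_half_le[OF h5(1)]] abs_half_le[OF h5(2)]]
    show ?thesis unfolding id char add_0_right
      by (rule order_trans[OF B]) (use h7 kap in \<open>simp add: field_simps\<close>)
  qed
  have al2: "(sqrt 2 * b)\<^sup>2 = 2 * b\<^sup>2" by (simp add: power_mult_distrib)
  have sq2: "sqrt 2 \<le> 3 / 2" by (rule real_le_lsqrt) (auto simp: power2_eq_square)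
  have al: "sqrt 2 * b \<le> \<eta>"
    using mult_right_mono[OF sq2 ab(1)] ab eta \<epsilon> by linarith
  have hc: "c\<^sup>2 \<le> 2 * (sqrt 2 * b)\<^sup>2" unfolding al2 using c by simp
  have p1': "\<bar>px - (m * c + (c\<^sup>2 - (sqrt 2 * b)\<^sup>2) / 2)\<bar> \<le> T" unfolding al2 using p1 by (simp add: U_def)
  have p2': "\<bar>pt + l * (m * c + (c\<^sup>2 - (sqrt 2 * b)\<^sup>2) / 2)\<bar> \<le> T" unfolding al2 using p2 by (simp add: U_def)
  have al0: "0 \<le> sqrt 2 * b" and eta2: "\<eta> \<le> 1 / 2" using ab eta by auto
  have ucvc: "\<bar>uc\<bar> \<le> \<eta>" "\<bar>vc\<bar> \<le> \<eta>" using uc vc eta \<epsilon> by linarith+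
  have cancel: "- l * c + (qt + l * c) = qt" "- l * U + (pt + l * U) = pt" "c + (qx - c) = qx" "U + (px - U) = px"
    "2 * b\<^sup>2 / 2 = b\<^sup>2" "l * (2 * b\<^sup>2) / 2 = l * b\<^sup>2"
    by simp_all
  note F = flux_increment[OF hc al0 al eta2 ucvc l1(1) mT T(2) q1 q2 p1' p2', unfolded al2, folded U_def K_def, unfolded cancel]
  show "\<bar>qt + px - vc * qx - qx\<^sup>2 / 2 + b\<^sup>2\<bar> \<le> 200 * \<kappa> * b + e"
    by (rule order_trans[OF F(1)]) (use e kb in \<open>simp add: T_def\<close>)
  have "\<bar>c\<bar> * \<bar>K\<bar> \<le> 2 * b * (16 * (\<eta> * a) + 7 * \<kappa>)"
    by (intro mult_mono c2 K) (use ab in auto)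
  also have "\<dots> = 32 * (\<eta> * (a * b)) + 14 * (\<kappa> * b)" by (simp add: algebra_simps)
  finally have cK: "\<bar>c\<bar> * \<bar>K\<bar> \<le> 32 * (\<eta> * (a * b)) + 14 * (\<kappa> * b)" .
  have ebb: "\<eta> * b\<^sup>2 \<le> \<eta> * (a * b)" using bb eta \<epsilon> by (intro mult_left_mono) auto
  have "\<bar>(l - \<sigma>) * b\<^sup>2\<bar> \<le> \<eta> * b\<^sup>2" by (rule abs_mult_le) (use l\<sigma> eta \<epsilon> in auto)
  then have ls: "\<bar>l * b\<^sup>2 - \<sigma> * b\<^sup>2\<bar> \<le> \<eta> * b\<^sup>2" by (simp add: left_diff_distrib)
  have F1': "\<bar>pt + (uc * qx + vc * px + px * qx) / 2 + qx - l * b\<^sup>2\<bar> \<le> \<bar>c\<bar> * \<bar>K\<bar> + 6 * (\<eta> * b\<^sup>2) + 12 * T"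
    using F(2) by simp
  have id: "(100 * \<eta> * a + 200 * \<kappa>) * b = 100 * (\<eta> * (a * b)) + 200 * (\<kappa> * b)" by (simp add: algebra_simps)
  have 0: "0 \<le> \<eta> * (a * b)" using eta \<epsilon> ab by simp
  have tri: "\<bar>x - z\<bar> \<le> A + B" if "\<bar>x - y\<bar> \<le> A" "\<bar>y - z\<bar> \<le> B" for x y z A B :: real
    using that by linarith
  show "\<bar>pt + (uc * qx + vc * px + px * qx) / 2 + qx - \<sigma> * b\<^sup>2\<bar> \<le> (100 * \<eta> * a + 200 * \<kappa>) * b + e"
    unfolding id
    by (rule order_trans[OF tri[OF F1' ls]]) (use ebb cK e kb 0 in \<open>simp add: T_def\<close>)
qed

text \<open>The roots of the characteristic polynomial are \<open>- v / 4 \<plusminus> sqrt (1 + 9 v\<^sup>2 / 16 + u / 2)\<close>.\<close>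

lemma characteristic_speed:
  fixes \<sigma> u v \<epsilon> :: real
  assumes "\<sigma> = 1 \<or> \<sigma> = -1" "\<bar>u\<bar> \<le> 2 * \<epsilon>" "\<bar>v\<bar> \<le> 2 * \<epsilon>" "\<epsilon> \<le> 1 / 200"
  defines "l \<equiv> - v / 4 + \<sigma> * safe_sqrt (1 / 2) (1 + (9 / 16 * (v * v) + u / 2))"
  shows "1 + u / 2 + v\<^sup>2 / 2 - l * v / 2 - l\<^sup>2 = 0" "\<bar>l - \<sigma>\<bar> \<le> 3 * \<epsilon>"
proof -
  define y where "y = 9 / 16 * (v * v) + u / 2"
  have e: "0 \<le> \<epsilon>" using assms by linarith
  have vv: "\<bar>v * v\<bar> \<le> 2 * \<epsilon> * (1 / 100)" by (rule abs_mult_le) (use assms in linarith)+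
  have y: "\<bar>y\<bar> \<le> 2 * \<epsilon>" using vv assms e unfolding y_def by linarith
  then have y2: "1 / 2 \<le> 1 + y" using assms(4) by linarith
  define r where "r = sqrt (1 + y)"
  have r: "r\<^sup>2 = 1 + y" "0 \<le> r" using y2 by (auto simp: r_def)
  have l: "l = - v / 4 + \<sigma> * r" unfolding l_def r_def y_def[symmetric] using y2 by (simp add: safe_sqrt_eq)
  have s: "\<sigma> * \<sigma> = 1" using assms(1) by auto
  have "l\<^sup>2 = v\<^sup>2 / 16 - \<sigma> * v * r / 2 + (\<sigma> * \<sigma>) * r\<^sup>2" unfolding l by (simp add: power2_eq_square field_simps)
  then show "1 + u / 2 + v\<^sup>2 / 2 - l * v / 2 - l\<^sup>2 = 0" unfolding s r l y_def
    by (simp add: power2_eq_square field_simps)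
  have "(r - 1) * (r + 1) = y" using r by (simp add: power2_eq_square algebra_simps)
  then have "\<bar>r - 1\<bar> * (r + 1) = \<bar>y\<bar>" using r by (metis abs_mult abs_of_nonneg add_nonneg_nonneg zero_le_one)
  moreover have "\<bar>r - 1\<bar> * 1 \<le> \<bar>r - 1\<bar> * (r + 1)" using r by (intro mult_left_mono) auto
  ultimately have "\<bar>r - 1\<bar> \<le> 2 * \<epsilon>" using y by (metis mult_1_right order_trans)
  moreover have "\<bar>\<sigma> * (r - 1)\<bar> = \<bar>r - 1\<bar>" using assms(1) by auto
  moreover have "l - \<sigma> = \<sigma> * (r - 1) - v / 4" by (simp add: l algebra_simps)
  ultimately show "\<bar>l - \<sigma>\<bar> \<le> 3 * \<epsilon>" using assms by linarith
qed

section \<open>A half stage: waves of one family\<close>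

definition residual1 :: "real \<Rightarrow> real \<Rightarrow> (real \<Rightarrow> real \<Rightarrow> real) \<Rightarrow> (real \<Rightarrow> real \<Rightarrow> real) \<Rightarrow> real \<Rightarrow> real \<Rightarrow> real" where
  "residual1 u0 v0 p q t x = Dt p t x + ((u0 + Dx p t x) * (v0 + Dx q t x) / 2 + (v0 + Dx q t x)) - (u0 * v0 / 2 + v0)"

definition residual2 :: "real \<Rightarrow> real \<Rightarrow> (real \<Rightarrow> real \<Rightarrow> real) \<Rightarrow> (real \<Rightarrow> real \<Rightarrow> real) \<Rightarrow> real \<Rightarrow> real \<Rightarrow> real" where
  "residual2 u0 v0 p q t x = Dt q t x + ((u0 + Dx p t x) - (v0 + Dx q t x)\<^sup>2 / 2) - (u0 - v0\<^sup>2 / 2)"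

lemma window_sum_scaled:
  assumes "0 < J" "t \<in> {1..2}"
  shows "(\<Sum>i<Suc J. (window (real J * (t - (1 + real i / real J))))\<^sup>2) = 1"
    "(\<Sum>i<Suc J. window (real J * (t - (1 + real i / real J)))) \<le> 2"
proof -
  have eq: "real J * (t - (1 + real i / real J)) = real J * (t - 1) - real i" for i
    using assms by (simp add: field_simps)
  have "0 \<le> real J * (t - 1)" using assms by simp
  moreover have "real J * (t - 1) \<le> real J * 1" by (rule mult_left_mono) (use assms in auto)
  then have "real J * (t - 1) \<le> real J" by simp
  ultimately show "(\<Sum>i<Suc J. (window (real J * (t - (1 + real i / real J))))\<^sup>2) = 1"
    "(\<Sum>i<Suc J. window (real J * (t - (1 + real i / real J)))) \<le> 2"
    unfolding eq lessThan_Suc_atMost using window_sum by blast+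
qed

text \<open>The phases of \<open>osc\<close> are good only for short times. Time is therefore cut into windows whose squares sum to one,
  and one wave per window is added, one after the other, each with a frequency chosen after the
  previous ones. The constants are chosen in the order \<open>\<kappa>\<close>, \<open>J\<close>, \<open>e\<close>: errors governed by \<open>\<kappa>\<close>
  (regularised speed, distorted phase) carry a factor of the local amplitude and are summed with the at most two overlapping windows, while
  the pure frequency errors \<open>e\<close> are summed over all \<open>J + 1\<close> windows and are chosen last.\<close>

lemma half_stage:
  fixes \<sigma> \<epsilon> \<tau> u0 v0 :: real
  assumes sig: "\<sigma> = 1 \<or> \<sigma> = -1" and eps: "0 < \<epsilon>" "\<epsilon> \<le> 1 / 200" and tau: "0 < \<tau>"
    and pq: "PC1 p" "PC1 q" "time_supported (Dx p)" "time_supported (Dx q)"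
    and uv: "\<And>t x. \<bar>u0 + Dx p t x\<bar> \<le> \<epsilon>" "\<And>t x. \<bar>v0 + Dx q t x\<bar> \<le> \<epsilon>"
    and a: "PC1 a" "\<And>t x. 0 \<le> a t x" "\<And>t x. a t x \<le> \<epsilon>" "time_supported a"
  obtains p' q' where "PC1 p'" "PC1 q'"
    "\<And>t x. a t x = 0 \<Longrightarrow> p' t x = p t x \<and> q' t x = q t x \<and> Dt p' t x = Dt p t x \<and> Dx p' t x = Dx p t x
        \<and> Dt q' t x = Dt q t x \<and> Dx q' t x = Dx q t x"
    "\<And>t x. \<bar>p' t x - p t x\<bar> \<le> \<tau>" "\<And>t x. \<bar>q' t x - q t x\<bar> \<le> \<tau>"
    "\<And>t x. \<bar>Dx q' t x - Dx q t x\<bar> \<le> 6 * a t x + \<tau>" "\<And>t x. \<bar>Dx p' t x - Dx p t x\<bar> \<le> 8 * a t x + \<tau>"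
    "\<And>t x. \<bar>residual1 u0 v0 p' q' t x - residual1 u0 v0 p q t x - \<sigma> * (a t x)\<^sup>2\<bar> \<le> 4000 * \<epsilon> * (a t x)\<^sup>2 + \<tau>"
    "\<And>t x. \<bar>residual2 u0 v0 p' q' t x - residual2 u0 v0 p q t x + (a t x)\<^sup>2\<bar> \<le> \<tau>"
proof -
  (* kappa: accuracy of the regularised speed and of the phases; eta bounds the state during the half stage. *)
  define \<kappa> where "\<kappa> = min \<epsilon> (\<tau> / 2000)"
  define \<eta> where "\<eta> = 20 * \<epsilon>"
  have kap: "0 < \<kappa>" "\<kappa> \<le> \<epsilon>" "2000 * \<kappa> \<le> \<tau>" using eps tau by (auto simp: \<kappa>_def min_def)
  have eta: "\<eta> = 20 * \<epsilon>" "\<eta> \<le> 1 / 10" using eps by (auto simp: \<eta>_def)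
  obtain pa where pa: "PC1 pa" "\<And>t x. \<bar>pa t x - Dx p t x\<bar> \<le> \<kappa>" using PC1_approx_Dx[OF pq(1,3) kap(1)] by blast
  obtain qa where qa: "PC1 qa" "\<And>t x. \<bar>qa t x - Dx q t x\<bar> \<le> \<kappa>" using PC1_approx_Dx[OF pq(2,4) kap(1)] by blast
  define ut where "ut = (\<lambda>t x. u0 + pa t x)"
  define vt where "vt = (\<lambda>t x. v0 + qa t x)"
  have utvt: "PC1 ut" "PC1 vt" unfolding ut_def vt_def by (intro PC1_add(1) PC1_const(1) pa(1) qa(1))+
  have near: "\<bar>(u0 + Dx p t x) - ut t x\<bar> \<le> \<kappa>" "\<bar>(v0 + Dx q t x) - vt t x\<bar> \<le> \<kappa>" for t x
    using pa(2)[of t x] qa(2)[of t x] by (auto simp: ut_def vt_def)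
  have small: "\<bar>ut t x\<bar> \<le> 2 * \<epsilon>" "\<bar>vt t x\<bar> \<le> 2 * \<epsilon>" for t x
    using near[of t x] uv[of t x] kap(2) by linarith+
  define lam where "lam = (\<lambda>t x. (- 1 / 4) * vt t x +
      \<sigma> * safe_sqrt (1 / 2) (1 + ((9 / 16) * (vt t x * vt t x) + (1 / 2) * ut t x)))"
  have lam: "PC1 lam" unfolding lam_def
    by (intro PC1_add(1) PC1_cmult(1) PC1_safe_sqrt PC1_mult(1) PC1_const(1) utvt) auto
  have lamc: "1 + ut t x / 2 + (vt t x)\<^sup>2 / 2 - lam t x * vt t x / 2 - (lam t x)\<^sup>2 = 0" "\<bar>lam t x - \<sigma>\<bar> \<le> 3 * \<epsilon>" for t x
    using characteristic_speed[OF sig small eps(2), of t x t x] by (auto simp: lam_def)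
  obtain B1 B2 where B12: "\<And>t x. \<bar>Dx lam t x\<bar> \<le> B1" "\<And>t x. \<bar>Dt lam t x\<bar> \<le> B2"
    using PC1D(5,6)[OF lam] by (auto simp: cbounded_def)
  (* Within a window of length 1 / J neither the phase nor the speed changes by more than kappa. *)
  obtain J0 :: nat where J0: "(\<bar>B1\<bar> + \<bar>B2\<bar>) / \<kappa> < real J0" using reals_Archimedean2 by blast
  define J where "J = Suc J0"
  have J: "0 < J" "(\<bar>B1\<bar> + \<bar>B2\<bar>) \<le> \<kappa> * real J" using J0 kap(1) by (auto simp: J_def field_simps)
  have BJ: "1 / real J * \<bar>Dx lam s x\<bar> \<le> \<kappa>" "1 / real J * \<bar>Dt lam s x\<bar> \<le> \<kappa>" for s x
    using B12(1)[of s x] B12(2)[of s x] J by (auto simp: field_simps)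
  define e where "e = \<kappa> / real (Suc J)"
  have e: "0 < e" "0 \<le> e" "e \<le> \<kappa>" "real n * e \<le> \<kappa>" if "n \<le> Suc J" for n
  proof -
    show "0 < e" "0 \<le> e" using kap by (auto simp: e_def)
    show "e \<le> \<kappa>" unfolding e_def using kap by (simp add: field_simps)
    have "real n * e \<le> real (Suc J) * e" using that kap by (intro mult_right_mono) (auto simp: e_def)
    then show "real n * e \<le> \<kappa>" by (simp add: e_def)
  qed
  define s where "s = (\<lambda>i::nat. 1 + real i / real J)"
  define b where "b = (\<lambda>i t x. a t x * window (real J * (t - s i)))"
  have b: "0 \<le> b i t x" "b i t x \<le> a t x" for i t x
    using a(2)[of t x] window_bounds[of "real J * (t - s i)"] by (auto simp: b_def mult_left_le)
  define S where "S = (\<lambda>n t x. \<Sum>i<n. b i t x)"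
  define S2 where "S2 = (\<lambda>n t x. \<Sum>i<n. (b i t x)\<^sup>2)"
  have a0: "t \<notin> {1..2} \<Longrightarrow> a t x = 0" for t x using a(4) by (auto simp: time_supported_def)
  have S: "S n t x \<le> 2 * a t x" "0 \<le> S n t x" if "n \<le> Suc J" for n t x
  proof -
    show "0 \<le> S n t x" unfolding S_def by (intro sum_nonneg b)
    show "S n t x \<le> 2 * a t x"
    proof (cases "t \<in> {1..2}")
      case True
      have "S n t x \<le> (\<Sum>i<Suc J. b i t x)" unfolding S_def
        by (rule sum_mono2) (use that b in auto)
      also have "\<dots> = a t x * (\<Sum>i<Suc J. window (real J * (t - (1 + real i / real J))))"
        by (simp only: b_def s_def sum_distrib_left)
      also have "\<dots> \<le> a t x * 2" by (intro mult_left_mono window_sum_scaled(2) J True a)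
      finally show ?thesis by simp
    qed (simp add: S_def b_def a0)
  qed
  have S2f: "S2 (Suc J) t x = (a t x)\<^sup>2" for t x
  proof (cases "t \<in> {1..2}")
    case True
    have "S2 (Suc J) t x = (a t x)\<^sup>2 * (\<Sum>i<Suc J. (window (real J * (t - (1 + real i / real J))))\<^sup>2)"
      by (simp only: S2_def b_def s_def power_mult_distrib sum_distrib_left)
    then show ?thesis using window_sum_scaled(1)[OF J(1) True] by simp
  qed (simp add: S2_def b_def a0)
  (* After n windows: the fourth line says that the state has moved almost along (sigma, 1), which is what
     keeps the characteristic polynomial small for the next wave. *)
  define Inv where "Inv = (\<lambda>n p' q' t x.
      (a t x = 0 \<longrightarrow> p' t x = p t x \<and> q' t x = q t x \<and> Dt p' t x = Dt p t x \<and> Dx p' t x = Dx p t x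
        \<and> Dt q' t x = Dt q t x \<and> Dx q' t x = Dx q t x) \<and>
      \<bar>p' t x - p t x\<bar> \<le> real n * e \<and> \<bar>q' t x - q t x\<bar> \<le> real n * e \<and>
      \<bar>Dx q' t x - Dx q t x\<bar> \<le> 3 * S n t x + real n * e \<and>
      \<bar>(Dx p' t x - Dx p t x) - \<sigma> * (Dx q' t x - Dx q t x)\<bar> \<le> 10 * \<eta> * S n t x + real n * e \<and>
      \<bar>residual1 u0 v0 p' q' t x - residual1 u0 v0 p q t x - \<sigma> * S2 n t x\<bar>
         \<le> (100 * \<eta> * a t x + 200 * \<kappa>) * S n t x + real n * e \<and>
      \<bar>residual2 u0 v0 p' q' t x - residual2 u0 v0 p q t x + S2 n t x\<bar> \<le> 200 * \<kappa> * S n t x + real n * e)"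
  have step: "\<exists>p' q'. PC1 p' \<and> PC1 q' \<and> (\<forall>t x. Inv n p' q' t x)" if "n \<le> Suc J" for n
    using that
  proof (induction n)
    case 0
    show ?case by (rule exI[of _ p], rule exI[of _ q]) (simp add: pq Inv_def S_def S2_def)
  next
    case (Suc n)
    have n: "n \<le> Suc J" "n \<le> J" using Suc.prems by auto
    obtain p' q' where IH: "PC1 p'" "PC1 q'" "\<And>t x. Inv n p' q' t x" using Suc.IH[OF n(1)] by blast
    have sup: "time_supported (Dx q')"
      using IH(3) pq(4) a(4) unfolding time_supported_def Inv_def by metis
    have e50: "0 < e / 50" using e(1)[OF n(1)] by simp
    obtain qb where qb: "PC1 qb" "\<And>t x. \<bar>qb t x - Dx q' t x\<bar> \<le> e / 50" using PC1_approx_Dx[OF IH(2) sup e50] by blast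
    define al where "al = (\<lambda>t x. sqrt 2 * (a t x * window (real J * (t - s n))))"
    define m where "m = (\<lambda>t x. lam (s n) x + (v0 + qb t x))"
    have alb: "al t x = sqrt 2 * b n t x" for t x by (simp add: al_def b_def)
    have sq2: "sqrt 2 \<le> 3 / 2" by (rule real_le_lsqrt) (auto simp: power2_eq_square)
    have alb2: "al t x \<le> 3 / 2 * b n t x" for t x
      unfolding alb by (intro mult_right_mono sq2 b)
    have al: "PC1 al" unfolding al_def by (intro PC1_cmult(1) PC1_mult(1) a(1) PC1_window)
    have alp: "0 \<le> al t x" "al t x \<le> 1" for t x
      using b[of n t x] a(3)[of t x] eps alb2[of t x] by (auto simp: alb)
    have mP: "PC1 m" unfolding m_def by (intro PC1_add(1) PC1_const(1) PC1_slice(1) lam qb(1))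
    have I: "\<bar>Dx q' t x - Dx q t x\<bar> \<le> 6 * a t x + \<kappa>"
      "\<bar>(Dx p' t x - Dx p t x) - \<sigma> * (Dx q' t x - Dx q t x)\<bar> \<le> 20 * \<eta> * a t x + \<kappa>" for t x
    proof -
      have i: "\<bar>Dx q' t x - Dx q t x\<bar> \<le> 3 * S n t x + real n * e"
        "\<bar>(Dx p' t x - Dx p t x) - \<sigma> * (Dx q' t x - Dx q t x)\<bar> \<le> 10 * \<eta> * S n t x + real n * e"
        using IH(3)[of t x] unfolding Inv_def by blast+
      show "\<bar>Dx q' t x - Dx q t x\<bar> \<le> 6 * a t x + \<kappa>"
        by (rule order_trans[OF i(1)]) (use S(1)[OF n(1), of t x] e(4)[OF n(1)] in linarith)
      have "10 * \<eta> * S n t x \<le> 10 * \<eta> * (2 * a t x)" using eta eps S(1)[OF n(1)] by (intro mult_left_mono) auto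
      then show "\<bar>(Dx p' t x - Dx p t x) - \<sigma> * (Dx q' t x - Dx q t x)\<bar> \<le> 20 * \<eta> * a t x + \<kappa>"
        by (intro order_trans[OF i(2)]) (use e(4)[OF n(1)] in \<open>simp add: mult_ac\<close>)
    qed
    have vc: "\<bar>v0 + Dx q' t x\<bar> \<le> 1 / 10" for t x
      using I(1)[of t x] uv(2)[of t x] a(3)[of t x] eps kap by linarith
    have m2: "\<bar>m t x\<bar> \<le> 2" for t x
      using vc[of t x] qb(2)[of t x] lamc(2)[of "s n" x] sig eps kap e(3)[OF n(1)] unfolding m_def by linarith
    have sup': "1 / real J \<le> \<bar>t - s n\<bar> \<Longrightarrow> al t x = 0" for t x
    proof -
      assume "1 / real J \<le> \<bar>t - s n\<bar>"
      then have "1 \<le> real J * \<bar>t - s n\<bar>" using J(1) by (simp add: field_simps)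
      then have "1 \<le> \<bar>real J * (t - s n)\<bar>" by (simp add: abs_mult)
      then show "al t x = 0" by (simp add: al_def window_outside)
    qed
    obtain P Q c where W: "PC1 P" "PC1 Q"
      "\<And>t x. al t x = 0 \<Longrightarrow> P t x = 0 \<and> Q t x = 0 \<and> Dt P t x = 0 \<and> Dx P t x = 0 \<and> Dt Q t x = 0 \<and> Dx Q t x = 0"
      "\<And>t x. (c t x)\<^sup>2 \<le> 2 * (al t x)\<^sup>2"
      "\<And>t x. \<bar>P t x\<bar> \<le> e / 50" "\<And>t x. \<bar>Q t x\<bar> \<le> e / 50"
      "\<And>t x. \<bar>Dx Q t x - c t x\<bar> \<le> e / 50 + 4 * \<kappa> * al t x" "\<And>t x. \<bar>Dt Q t x + lam (s n) x * c t x\<bar> \<le> e / 50"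
      "\<And>t x. \<bar>Dx P t x - (m t x * c t x + ((c t x)\<^sup>2 - (al t x)\<^sup>2) / 2)\<bar> \<le> e / 50 + 4 * \<kappa> * al t x"
      "\<And>t x. \<bar>Dt P t x + lam (s n) x * (m t x * c t x + ((c t x)\<^sup>2 - (al t x)\<^sup>2) / 2)\<bar> \<le> e / 50"
      using wave[OF al alp mP m2 lam sup' BJ(1) e50 less_imp_le[OF kap(1)]] by blast
    define p'' where "p'' = (\<lambda>t x. p' t x + P t x)"
    define q'' where "q'' = (\<lambda>t x. q' t x + Q t x)"
    note dp = PC1_add[OF IH(1) W(1), folded p''_def] and dq = PC1_add[OF IH(2) W(2), folded q''_def]
    have "Inv (Suc n) p'' q'' t x" for t x
    proof -
      note i = IH(3)[of t x, unfolded Inv_def]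
      define B where "B = b n t x"
      define px pt qx qt uc vc where "px = Dx P t x" and "pt = Dt P t x" and "qx = Dx Q t x" and "qt = Dt Q t x"
        and "uc = u0 + Dx p' t x" and "vc = v0 + Dx q' t x"
      have BS: "S (Suc n) t x = S n t x + B" "S2 (Suc n) t x = S2 n t x + B\<^sup>2"
        by (simp_all add: S_def S2_def B_def)
      have ne: "real (Suc n) * e = real n * e + e" by (simp add: algebra_simps)
      have r1: "residual1 u0 v0 p'' q'' t x - residual1 u0 v0 p' q' t x = pt + (uc * qx + vc * px + px * qx) / 2 + qx"
        unfolding residual1_def dp dq px_def pt_def qx_def uc_def vc_def by (simp add: field_simps)
      have r2: "residual2 u0 v0 p'' q'' t x - residual2 u0 v0 p' q' t x = qt + px - vc * qx - qx\<^sup>2 / 2"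
        unfolding residual2_def dp dq px_def qt_def qx_def uc_def vc_def by (simp add: field_simps power2_eq_square)
      have inc: "\<bar>qx\<bar> \<le> 3 * B + e \<and> \<bar>px - \<sigma> * qx\<bar> \<le> 10 * \<eta> * B + e \<and>
        \<bar>pt + (uc * qx + vc * px + px * qx) / 2 + qx - \<sigma> * B\<^sup>2\<bar> \<le> (100 * \<eta> * a t x + 200 * \<kappa>) * B + e \<and>
        \<bar>qt + px - vc * qx - qx\<^sup>2 / 2 + B\<^sup>2\<bar> \<le> 200 * \<kappa> * B + e"
      proof (cases "al t x = 0")
        case True
        then have "B = 0" by (simp add: alb B_def)
        then show ?thesis using W(3)[OF True] e(2)[OF n(1)] by (simp add: px_def pt_def qx_def qt_def)
      next
        case False
        then have ts: "\<bar>t - s n\<bar> < 1 / real J" using sup' by force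
        (* The speed is frozen at the centre of the window. *)
        have l: "\<bar>lam (s n) x - lam t x\<bar> \<le> \<kappa>"
        proof (cases "t = s n")
          case neq: False
          have "\<exists>z. \<bar>lam (s n) x - lam t x\<bar> = \<bar>t - s n\<bar> * \<bar>Dt lam z x\<bar>"
          proof (cases "t < s n")
            case True
            then show ?thesis using MVT2[OF True, of "\<lambda>t. lam t x" "\<lambda>t. Dt lam t x"] PC1D(2)[OF lam]
              by (metis abs_mult abs_minus_commute)
          next
            case False
            then have "s n < t" using neq by simp
            then show ?thesis using MVT2[of "s n" t "\<lambda>t. lam t x" "\<lambda>t. Dt lam t x"] PC1D(2)[OF lam]
              by (metis abs_mult abs_minus_commute)
          qed
          then obtain z where "\<bar>lam (s n) x - lam t x\<bar> = \<bar>t - s n\<bar> * \<bar>Dt lam z x\<bar>" by blast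
          also have "\<dots> \<le> 1 / real J * \<bar>Dt lam z x\<bar>" using ts by (intro mult_right_mono) auto
          finally show ?thesis using BJ(2)[of z x] by linarith
        qed (use kap in simp)
        have al2: "(al t x)\<^sup>2 = 2 * B\<^sup>2" by (simp add: alb B_def power_mult_distrib)
        have k6: "4 * \<kappa> * al t x \<le> 6 * \<kappa> * B"
          using mult_left_mono[OF alb2[of t x], of "4 * \<kappa>"] kap by (simp add: B_def)
        have m1: "\<bar>m t x - (lam (s n) x + vc)\<bar> \<le> e / 50" using qb(2)[of t x] by (simp add: m_def vc_def)
        have c4: "(c t x)\<^sup>2 \<le> 4 * B\<^sup>2" using W(4)[of t x] unfolding al2 by simp
        have w7: "\<bar>qx - c t x\<bar> \<le> e / 50 + 6 * \<kappa> * B" unfolding qx_def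
          by (rule order_trans[OF W(7)]) (use k6 in simp)
        have w9: "\<bar>px - (m t x * c t x + ((c t x)\<^sup>2 - 2 * B\<^sup>2) / 2)\<bar> \<le> e / 50 + 6 * \<kappa> * B" unfolding px_def al2[symmetric]
          by (rule order_trans[OF W(9)]) (use k6 in simp)
        have w8: "\<bar>qt + lam (s n) x * c t x\<bar> \<le> e / 50" using W(8) by (simp add: qt_def)
        have w10: "\<bar>pt + lam (s n) x * (m t x * c t x + ((c t x)\<^sup>2 - 2 * B\<^sup>2) / 2)\<bar> \<le> e / 50"
          using W(10)[of t x] unfolding al2 by (simp add: pt_def)
        have cur: "\<bar>vc - (v0 + Dx q t x)\<bar> \<le> 6 * a t x + \<kappa>"
          "\<bar>(uc - (u0 + Dx p t x)) - \<sigma> * (vc - (v0 + Dx q t x))\<bar> \<le> 20 * \<eta> * a t x + \<kappa>"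
          using I[of t x] by (simp_all add: uc_def vc_def)
        show ?thesis
          by (intro conjI; rule wave_increment[OF sig eta less_imp_le[OF kap(1)] kap(2) b(1)[of n t x, folded B_def]
            b(2)[of n t x, folded B_def] a(3) e(2)[OF n(1)] e(3)[OF n(1)] uv(1)[of t x] uv(2)[of t x] lamc(1)[of t x]
            near[of t x] l lamc(2)[of t x] cur m1 c4 w7 w8 w9 w10])
      qed
      have tri: "\<bar>z - x - (A + B)\<bar> \<le> C + D" if "\<bar>y - x - A\<bar> \<le> C" "\<bar>z - y - B\<bar> \<le> D" for x y z A B C D :: real
        using that by linarith
      show ?thesis unfolding Inv_def
      proof (intro conjI)
        show "a t x = 0 \<longrightarrow> p'' t x = p t x \<and> q'' t x = q t x \<and> Dt p'' t x = Dt p t x \<and> Dx p'' t x = Dx p t x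
          \<and> Dt q'' t x = Dt q t x \<and> Dx q'' t x = Dx q t x"
        proof
          assume z: "a t x = 0"
          then have "al t x = 0" by (simp add: al_def)
          from W(3)[OF this] i z show "p'' t x = p t x \<and> q'' t x = q t x \<and> Dt p'' t x = Dt p t x \<and> Dx p'' t x = Dx p t x
            \<and> Dt q'' t x = Dt q t x \<and> Dx q'' t x = Dx q t x"
            unfolding dp dq by (simp add: p''_def q''_def)
        qed
        show "\<bar>p'' t x - p t x\<bar> \<le> real (Suc n) * e" unfolding ne
          using W(5)[of t x] i e(2)[OF n(1)] unfolding p''_def by linarith
        show "\<bar>q'' t x - q t x\<bar> \<le> real (Suc n) * e" unfolding ne
          using W(6)[of t x] i e(2)[OF n(1)] unfolding q''_def by linarith
        show "\<bar>Dx q'' t x - Dx q t x\<bar> \<le> 3 * S (Suc n) t x + real (Suc n) * e"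
        proof -
          have "\<bar>Dx q' t x - Dx q t x\<bar> \<le> 3 * S n t x + real n * e" "\<bar>Dx Q t x\<bar> \<le> 3 * B + e"
            using i inc by (simp_all add: qx_def)
          then have "\<bar>(Dx q' t x - Dx q t x) + Dx Q t x\<bar> \<le> (3 * S n t x + real n * e) + (3 * B + e)"
            by (rule abs_add_le)
          then show ?thesis unfolding ne BS dq by (simp add: algebra_simps)
        qed
        have "\<bar>(Dx p'' t x - \<sigma> * Dx q'' t x) - (Dx p t x - \<sigma> * Dx q t x) - (0 + 0)\<bar> \<le> (10 * \<eta> * S n t x + real n * e) + (10 * \<eta> * B + e)"
          by (rule tri[where y = "Dx p' t x - \<sigma> * Dx q' t x"])
             (use i inc in \<open>simp_all add: dp dq px_def qx_def algebra_simps\<close>)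
        then show "\<bar>(Dx p'' t x - Dx p t x) - \<sigma> * (Dx q'' t x - Dx q t x)\<bar> \<le> 10 * \<eta> * S (Suc n) t x + real (Suc n) * e"
          unfolding ne BS by (simp add: algebra_simps)
        have "\<bar>residual1 u0 v0 p'' q'' t x - residual1 u0 v0 p q t x - (\<sigma> * S2 n t x + \<sigma> * B\<^sup>2)\<bar>
          \<le> ((100 * \<eta> * a t x + 200 * \<kappa>) * S n t x + real n * e) + ((100 * \<eta> * a t x + 200 * \<kappa>) * B + e)"
          by (rule tri[where y = "residual1 u0 v0 p' q' t x"]) (use i inc in \<open>simp_all add: r1\<close>)
        then show "\<bar>residual1 u0 v0 p'' q'' t x - residual1 u0 v0 p q t x - \<sigma> * S2 (Suc n) t x\<bar>
          \<le> (100 * \<eta> * a t x + 200 * \<kappa>) * S (Suc n) t x + real (Suc n) * e"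
          unfolding ne BS by (simp add: distrib_left)
        have "\<bar>residual2 u0 v0 p'' q'' t x - residual2 u0 v0 p q t x - (- S2 n t x + - B\<^sup>2)\<bar>
          \<le> (200 * \<kappa> * S n t x + real n * e) + (200 * \<kappa> * B + e)"
          by (rule tri[where y = "residual2 u0 v0 p' q' t x"]) (use i inc in \<open>simp_all add: r2\<close>)
        then show "\<bar>residual2 u0 v0 p'' q'' t x - residual2 u0 v0 p q t x + S2 (Suc n) t x\<bar>
          \<le> 200 * \<kappa> * S (Suc n) t x + real (Suc n) * e"
          unfolding ne BS by (simp add: distrib_left)
      qed
    qed
    then show ?case using dp(1) dq(1) by blast
  qed
  obtain p' q' where R: "PC1 p'" "PC1 q'" "\<And>t x. Inv (Suc J) p' q' t x" using step[OF order_refl] by blast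
  have ne: "real (Suc J) * e = \<kappa>" by (simp add: e_def)
  show ?thesis
  proof (rule that[OF R(1,2)])
    fix t x
    note i = R(3)[of t x, unfolded Inv_def ne S2f]
    have Sa: "0 \<le> S (Suc J) t x" "S (Suc J) t x \<le> 2 * a t x" using S[of "Suc J" t x] by auto
    have a1: "a t x \<le> 1" using a(3)[of t x] eps by linarith
    show "p' t x = p t x \<and> q' t x = q t x \<and> Dt p' t x = Dt p t x \<and> Dx p' t x = Dx p t x
        \<and> Dt q' t x = Dt q t x \<and> Dx q' t x = Dx q t x" if "a t x = 0" using i that by blast
    show "\<bar>p' t x - p t x\<bar> \<le> \<tau>" "\<bar>q' t x - q t x\<bar> \<le> \<tau>" using i kap by linarith+
    have v: "\<bar>Dx q' t x - Dx q t x\<bar> \<le> 6 * a t x + \<kappa>" using i Sa by linarith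
    then show "\<bar>Dx q' t x - Dx q t x\<bar> \<le> 6 * a t x + \<tau>" using kap by linarith
    have u: "\<bar>(Dx p' t x - Dx p t x) - \<sigma> * (Dx q' t x - Dx q t x)\<bar> \<le> 10 * \<eta> * S (Suc J) t x + \<kappa>" using i by blast
    have "10 * \<eta> * S (Suc J) t x \<le> 1 * (2 * a t x)" using Sa eta eps by (intro mult_mono) auto
    moreover have "\<bar>\<sigma> * (Dx q' t x - Dx q t x)\<bar> = \<bar>Dx q' t x - Dx q t x\<bar>" using sig by auto
    ultimately show "\<bar>Dx p' t x - Dx p t x\<bar> \<le> 8 * a t x + \<tau>" using u v kap by linarith
    have ka: "\<kappa> * a t x \<le> \<kappa>" using kap a1 by (simp add: mult_left_le)
    have "(100 * \<eta> * a t x + 200 * \<kappa>) * S (Suc J) t x \<le> (100 * \<eta> * a t x + 200 * \<kappa>) * (2 * a t x)"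
      using Sa eta eps kap a(2)[of t x] by (intro mult_left_mono) auto
    also have "\<dots> = 4000 * \<epsilon> * (a t x)\<^sup>2 + 400 * (\<kappa> * a t x)" unfolding \<eta>_def by (simp add: power2_eq_square algebra_simps)
    finally have h: "(100 * \<eta> * a t x + 200 * \<kappa>) * S (Suc J) t x + \<kappa> \<le> 4000 * \<epsilon> * (a t x)\<^sup>2 + \<tau>" using ka kap by linarith
    show "\<bar>residual1 u0 v0 p' q' t x - residual1 u0 v0 p q t x - \<sigma> * (a t x)\<^sup>2\<bar> \<le> 4000 * \<epsilon> * (a t x)\<^sup>2 + \<tau>"
      using i h by (meson order_trans)
    have "200 * \<kappa> * S (Suc J) t x \<le> 200 * \<kappa> * (2 * a t x)" using Sa kap by (intro mult_left_mono) auto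
    also have "\<dots> = 400 * (\<kappa> * a t x)" by simp
    finally have "200 * \<kappa> * S (Suc J) t x + \<kappa> \<le> \<tau>" using ka kap by linarith
    then show "\<bar>residual2 u0 v0 p' q' t x - residual2 u0 v0 p q t x + (a t x)\<^sup>2\<bar> \<le> \<tau>"
      using i by (meson order_trans)
  qed
qed

section \<open>A stage: waves of both families\<close>

text \<open>The residual lies in the narrow cone around \<open>(0, 1)\<close> of slope \<open>e\<close>. For \<open>e > 0\<close> the first inequality
  contains \<open>residual2 \<ge> 0\<close>, and where the second residual vanishes so does the first.\<close>

definition almost_solution :: "real \<Rightarrow> real \<Rightarrow> real \<Rightarrow> real \<Rightarrow> (real \<Rightarrow> real \<Rightarrow> real) \<Rightarrow> (real \<Rightarrow> real \<Rightarrow> real) \<Rightarrow> bool" where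
  "almost_solution u0 v0 d e p q \<longleftrightarrow> PC1 p \<and> PC1 q \<and>
     time_supported (Dt p) \<and> time_supported (Dx p) \<and> time_supported (Dt q) \<and> time_supported (Dx q) \<and>
     (\<forall>t x. \<bar>residual1 u0 v0 p q t x\<bar> \<le> e * residual2 u0 v0 p q t x \<and> residual2 u0 v0 p q t x \<le> d\<^sup>2)"

lemma residual_approx:
  assumes pq: "PC1 p" "PC1 q" and sup: "time_supported (Dt p)" "time_supported (Dx p)" "time_supported (Dt q)" "time_supported (Dx q)"
    and uv: "\<And>t x. \<bar>u0 + Dx p t x\<bar> \<le> 1" "\<And>t x. \<bar>v0 + Dx q t x\<bar> \<le> 1" and \<tau>: "0 < \<tau>"
  obtains g1 g2 where "PC1 g1" "PC1 g2" "\<And>t x. \<bar>g1 t x - residual1 u0 v0 p q t x\<bar> \<le> \<tau>"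
    "\<And>t x. \<bar>g2 t x - residual2 u0 v0 p q t x\<bar> \<le> \<tau>"
proof -
  define k where "k = min 1 (\<tau> / 6)"
  have k: "0 < k" "k \<le> 1" "6 * k \<le> \<tau>" using \<tau> by (auto simp: k_def min_def)
  obtain pt where pt: "PC1 pt" "\<And>t x. \<bar>pt t x - Dt p t x\<bar> \<le> k" using PC1_approx_Dt[OF pq(1) sup(1) k(1)] by blast
  obtain px where px: "PC1 px" "\<And>t x. \<bar>px t x - Dx p t x\<bar> \<le> k" using PC1_approx_Dx[OF pq(1) sup(2) k(1)] by blast
  obtain qt where qt: "PC1 qt" "\<And>t x. \<bar>qt t x - Dt q t x\<bar> \<le> k" using PC1_approx_Dt[OF pq(2) sup(3) k(1)] by blast
  obtain qx where qx: "PC1 qx" "\<And>t x. \<bar>qx t x - Dx q t x\<bar> \<le> k" using PC1_approx_Dx[OF pq(2) sup(4) k(1)] by blast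
  define u where "u = (\<lambda>t x. u0 + px t x)"
  define v where "v = (\<lambda>t x. v0 + qx t x)"
  have uvP: "PC1 u" "PC1 v" unfolding u_def v_def by (intro PC1_add(1) PC1_const(1) px(1) qx(1))+
  show ?thesis
  proof (rule that[of "\<lambda>t x. (pt t x + ((1 / 2) * (u t x * v t x) + v t x)) + - (u0 * v0 / 2 + v0)"
        "\<lambda>t x. (qt t x + (u t x + (- 1 / 2) * (v t x * v t x))) + - (u0 - v0\<^sup>2 / 2)"])
    show "PC1 (\<lambda>t x. (pt t x + ((1 / 2) * (u t x * v t x) + v t x)) + - (u0 * v0 / 2 + v0))"
      "PC1 (\<lambda>t x. (qt t x + (u t x + (- 1 / 2) * (v t x * v t x))) + - (u0 - v0\<^sup>2 / 2))"
      by (intro PC1_add(1) PC1_cmult(1) PC1_mult(1) PC1_const(1) pt(1) qt(1) uvP)+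
    fix t x
    define U V where "U = u0 + Dx p t x" and "V = v0 + Dx q t x"
    have du: "\<bar>u t x - U\<bar> \<le> k" and dv: "\<bar>v t x - V\<bar> \<le> k"
      using px(2)[of t x] qx(2)[of t x] by (simp_all add: u_def v_def U_def V_def)
    have V: "\<bar>V\<bar> \<le> 1" "\<bar>U\<bar> \<le> 1" using uv[of t x] by (simp_all add: U_def V_def)
    have v2: "\<bar>v t x\<bar> \<le> 2" "\<bar>v t x + V\<bar> \<le> 3" using dv V k by linarith+
    have id1: "(pt t x + ((1 / 2) * (u t x * v t x) + v t x)) + - (u0 * v0 / 2 + v0) - residual1 u0 v0 p q t x
      = (pt t x - Dt p t x) + ((u t x - U) * v t x + U * (v t x - V)) / 2 + (v t x - V)"
      unfolding residual1_def U_def[symmetric] V_def[symmetric] by (simp add: field_simps)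
    show "\<bar>(pt t x + ((1 / 2) * (u t x * v t x) + v t x)) + - (u0 * v0 / 2 + v0) - residual1 u0 v0 p q t x\<bar> \<le> \<tau>"
      unfolding id1
      by (rule order_trans[OF abs_add_le[OF abs_add_le[OF pt(2) abs_half_le[OF abs_add_le[OF
         abs_mult_le[OF du v2(1)] abs_mult_le[OF V(2) dv]]]] dv]]) (use k in simp)
    have id2: "(qt t x + (u t x + (- 1 / 2) * (v t x * v t x))) + - (u0 - v0\<^sup>2 / 2) - residual2 u0 v0 p q t x
      = (qt t x - Dt q t x) + (u t x - U) - (v t x - V) * (v t x + V) / 2"
      unfolding residual2_def U_def[symmetric] V_def[symmetric] by (simp add: field_simps power2_eq_square)
    show "\<bar>(qt t x + (u t x + (- 1 / 2) * (v t x * v t x))) + - (u0 - v0\<^sup>2 / 2) - residual2 u0 v0 p q t x\<bar> \<le> \<tau>"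
      unfolding id2
      by (rule order_trans[OF abs_diff_le[OF abs_add_le[OF qt(2) du] abs_half_le[OF abs_mult_le[OF dv v2(2)]]]])
         (use k in simp)
  qed
qed

lemma sine_step_PC1: "PC1 f \<Longrightarrow> PC1 (\<lambda>t x. sine_step (f t x))"
  by (rule PC1_compose[OF sine_step_deriv continuous_sine_step'])

text \<open>Solving \<open>a\<^sub>+\<^sup>2 (1, -1) + a\<^sub>-\<^sup>2 (-1, -1) = (- g\<^sub>1, \<delta> / 4 - g\<^sub>2)\<close> for the amplitudes turns a residual \<open>(g\<^sub>1, g\<^sub>2)\<close> into
  \<open>(0, \<delta> / 4)\<close> with \<open>\<delta> = d\<^sup>2\<close>; the right-hand side is in the cone as soon as \<open>g\<^sub>2 \<ge> \<delta> / 2\<close> and \<open>e \<le> 1 / 4\<close>. Where \<open>g\<^sub>2 < \<delta> / 2\<close> nothing is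
  done, and a cutoff interpolates up to \<open>g\<^sub>2 = 3 \<delta> / 4\<close>. In this way the residual stays supported in the
  original time interval and every new error is made where the second residual is comparable to \<open>\<delta>\<close>.
  The slope \<open>e\<close> is allowed to grow, which leaves room for errors that do not scale with the cutoff.\<close>

lemma stage:
  fixes \<epsilon> d e e' \<tau> u0 v0 :: real
  assumes ok: "almost_solution u0 v0 d e p q" and d: "0 < d" and e: "1 / 8 \<le> e" "e < e'" "e' \<le> 1 / 4"
    and eps: "\<epsilon> = 1 / 1000000" and tau: "0 < \<tau>"
    and uv: "\<And>t x. \<bar>u0 + Dx p t x\<bar> \<le> \<epsilon> - 24 * d" "\<And>t x. \<bar>v0 + Dx q t x\<bar> \<le> \<epsilon> - 24 * d"
  obtains p' q' where "almost_solution u0 v0 (19 / 20 * d) e' p' q'"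
    "\<And>t x. \<bar>p' t x - p t x\<bar> \<le> \<tau>" "\<And>t x. \<bar>q' t x - q t x\<bar> \<le> \<tau>"
    "\<And>t x. \<bar>Dx p' t x - Dx p t x\<bar> \<le> 24 * d" "\<And>t x. \<bar>Dx q' t x - Dx q t x\<bar> \<le> 24 * d"
proof -
  define \<delta> where "\<delta> = d\<^sup>2"
  have \<delta>: "0 < \<delta>" using d by (simp add: \<delta>_def)
  define k where "k = min (min d (\<tau> / 2)) (\<delta> * (e' - e) / 1000)"
  have k0: "0 < k" using d tau \<delta> e by (auto simp: k_def)
  have k: "k \<le> d" "2 * k \<le> \<tau>" "1000 * k \<le> \<delta> * (e' - e)" by (auto simp: k_def)
  have "\<delta> * (e' - e) \<le> \<delta> * (1 / 8)" using \<delta> e by (intro mult_left_mono) auto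
  then have k2: "8000 * k \<le> \<delta>" using k by linarith
  have deps: "24 * d \<le> \<epsilon>" using uv(1)[of 0 0] by linarith
  note O = ok[unfolded almost_solution_def]
  have pq: "PC1 p" "PC1 q" and sup: "time_supported (Dt p)" "time_supported (Dx p)" "time_supported (Dt q)" "time_supported (Dx q)"
    using O by blast+
  define r1 where "r1 = residual1 u0 v0 p q"
  define r2 where "r2 = residual2 u0 v0 p q"
  have r: "\<bar>r1 t x\<bar> \<le> e * r2 t x" "r2 t x \<le> \<delta>" for t x using O by (auto simp: r1_def r2_def \<delta>_def)
  have r2p: "0 \<le> r2 t x" for t x
  proof -
    have "0 \<le> e * r2 t x" using r(1)[of t x] by linarith
    then show ?thesis using e by (simp add: zero_le_mult_iff)
  qed
  have r14: "\<bar>r1 t x\<bar> \<le> 1 / 4 * r2 t x" for t x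
    using r(1)[of t x] mult_right_mono[of e "1 / 4" "r2 t x"] e r2p[of t x] by linarith
  have uv1: "\<bar>u0 + Dx p t x\<bar> \<le> 1" "\<bar>v0 + Dx q t x\<bar> \<le> 1" for t x
    using uv[of t x] d eps by linarith+
  obtain g1 g2 where g: "PC1 g1" "PC1 g2" "\<And>t x. \<bar>g1 t x - r1 t x\<bar> \<le> k" "\<And>t x. \<bar>g2 t x - r2 t x\<bar> \<le> k"
    using residual_approx[OF pq sup uv1 k0] unfolding r1_def r2_def by blast
  (* The cutoff is 0 for g2 below delta / 2 and 1 for g2 above 3 delta / 4. *)
  define om where "om = (\<lambda>t x. sine_step ((4 / \<delta>) * g2 t x + - 2))"
  (* The squared amplitudes that solve the two linear equations. *)
  define zp where "zp = (\<lambda>t x. (1 / 2) * ((g2 t x + - (\<delta> / 4)) + (- 1) * g1 t x))"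
  define zm where "zm = (\<lambda>t x. (1 / 2) * ((g2 t x + - (\<delta> / 4)) + g1 t x))"
  define ap where "ap = (\<lambda>t x. om t x * safe_sqrt (\<delta> / 32) (zp t x))"
  define am where "am = (\<lambda>t x. om t x * safe_sqrt (\<delta> / 32) (zm t x))"
  have P: "PC1 ap" "PC1 am" unfolding ap_def am_def om_def zp_def zm_def
    by (intro PC1_mult(1) sine_step_PC1 PC1_safe_sqrt PC1_add(1) PC1_cmult(1) PC1_const(1) g(1,2); use \<delta> in simp)+
  have om: "0 \<le> om t x" "om t x \<le> 1" for t x by (simp_all add: om_def sine_step_bounds)
  have om0: "om t x = 0" if "g2 t x \<le> \<delta> / 2" for t x
    unfolding om_def by (rule sine_step_simps) (use that \<delta> in \<open>simp add: field_simps\<close>)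
  have om1: "om t x = 1" if "3 / 4 * \<delta> \<le> g2 t x" for t x
    unfolding om_def by (rule sine_step_simps) (use that \<delta> in \<open>simp add: field_simps\<close>)
  have zeq: "zp t x = g2 t x / 2 - \<delta> / 8 - g1 t x / 2" "zm t x = g2 t x / 2 - \<delta> / 8 + g1 t x / 2" for t x
    by (simp_all add: zp_def zm_def field_simps)
  have z: "\<delta> / 32 \<le> zp t x" "\<delta> / 32 \<le> zm t x" "zp t x \<le> \<delta>" "zm t x \<le> \<delta>" if "\<delta> / 2 < g2 t x" for t x
    using that g(3)[of t x] g(4)[of t x] r14[of t x] r(2)[of t x] k2 k0 unfolding zeq by linarith+
  have sq: "0 \<le> ap t x \<and> (ap t x)\<^sup>2 = (om t x)\<^sup>2 * zp t x \<and> 0 \<le> am t x \<and> (am t x)\<^sup>2 = (om t x)\<^sup>2 * zm t x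
      \<and> ap t x \<le> d \<and> am t x \<le> d" for t x
  proof (cases "\<delta> / 2 < g2 t x")
    case True
    note zz = z[OF True]
    have s: "ap t x = om t x * sqrt (zp t x)" "am t x = om t x * sqrt (zm t x)"
      using zz by (simp_all add: ap_def am_def safe_sqrt_eq)
    have "sqrt (zp t x) \<le> d" "sqrt (zm t x) \<le> d" using zz d by (auto intro!: real_le_lsqrt simp: \<delta>_def[symmetric])
    then have "om t x * sqrt (zp t x) \<le> 1 * d" "om t x * sqrt (zm t x) \<le> 1 * d"
      using om[of t x] zz \<delta> by (intro mult_mono; auto)+
    then show ?thesis unfolding s using om[of t x] zz \<delta> by (simp add: power_mult_distrib)
  qed (use om0[of t x] d in \<open>simp add: ap_def am_def\<close>)
  have r0: "r2 t x = 0" if "t \<notin> {1..2}" for t x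
    using that sup unfolding r2_def residual2_def time_supported_def by simp
  have "time_supported om" unfolding time_supported_def
  proof (intro allI impI)
    fix t x :: real assume "t \<notin> {1..2}"
    then show "om t x = 0" using r0[of t x] g(4)[of t x] k2 k0 by (intro om0) linarith
  qed
  then have T: "time_supported ap" "time_supported am" by (auto simp: time_supported_def ap_def am_def)
  have e200: "0 < \<epsilon>" "\<epsilon> \<le> 1 / 200" using eps by auto
  have uve: "\<bar>u0 + Dx p t x\<bar> \<le> \<epsilon>" "\<bar>v0 + Dx q t x\<bar> \<le> \<epsilon>" for t x using uv[of t x] d by linarith+
  have aple: "0 \<le> ap t x" "ap t x \<le> \<epsilon>" "0 \<le> am t x" "am t x \<le> \<epsilon>" for t x
    using sq[of t x] deps d by linarith+
  obtain p1 q1 where H1: "PC1 p1" "PC1 q1"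
    "\<And>t x. ap t x = 0 \<Longrightarrow> p1 t x = p t x \<and> q1 t x = q t x \<and> Dt p1 t x = Dt p t x \<and> Dx p1 t x = Dx p t x
        \<and> Dt q1 t x = Dt q t x \<and> Dx q1 t x = Dx q t x"
    "\<And>t x. \<bar>p1 t x - p t x\<bar> \<le> k" "\<And>t x. \<bar>q1 t x - q t x\<bar> \<le> k"
    "\<And>t x. \<bar>Dx q1 t x - Dx q t x\<bar> \<le> 6 * ap t x + k" "\<And>t x. \<bar>Dx p1 t x - Dx p t x\<bar> \<le> 8 * ap t x + k"
    "\<And>t x. \<bar>residual1 u0 v0 p1 q1 t x - residual1 u0 v0 p q t x - 1 * (ap t x)\<^sup>2\<bar> \<le> 4000 * \<epsilon> * (ap t x)\<^sup>2 + k"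
    "\<And>t x. \<bar>residual2 u0 v0 p1 q1 t x - residual2 u0 v0 p q t x + (ap t x)\<^sup>2\<bar> \<le> k"
    using half_stage[OF disjI1[OF refl] e200 k0 pq sup(2,4) uve P(1) aple(1,2) T(1)] by blast
  have sup1: "time_supported (Dt p1)" "time_supported (Dx p1)" "time_supported (Dt q1)" "time_supported (Dx q1)"
    using sup H1(3) T(1) unfolding time_supported_def by metis+
  have D1: "\<bar>Dx p1 t x - Dx p t x\<bar> \<le> 9 * d" "\<bar>Dx q1 t x - Dx q t x\<bar> \<le> 9 * d" for t x
    using H1(6)[of t x] H1(7)[of t x] sq[of t x] k(1) by linarith+
  have uv2: "\<bar>u0 + Dx p1 t x\<bar> \<le> \<epsilon>" "\<bar>v0 + Dx q1 t x\<bar> \<le> \<epsilon>" for t x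
    using uv[of t x] D1[of t x] d by linarith+
  obtain p2 q2 where H2: "PC1 p2" "PC1 q2"
    "\<And>t x. am t x = 0 \<Longrightarrow> p2 t x = p1 t x \<and> q2 t x = q1 t x \<and> Dt p2 t x = Dt p1 t x \<and> Dx p2 t x = Dx p1 t x
        \<and> Dt q2 t x = Dt q1 t x \<and> Dx q2 t x = Dx q1 t x"
    "\<And>t x. \<bar>p2 t x - p1 t x\<bar> \<le> k" "\<And>t x. \<bar>q2 t x - q1 t x\<bar> \<le> k"
    "\<And>t x. \<bar>Dx q2 t x - Dx q1 t x\<bar> \<le> 6 * am t x + k" "\<And>t x. \<bar>Dx p2 t x - Dx p1 t x\<bar> \<le> 8 * am t x + k"
    "\<And>t x. \<bar>residual1 u0 v0 p2 q2 t x - residual1 u0 v0 p1 q1 t x - - 1 * (am t x)\<^sup>2\<bar> \<le> 4000 * \<epsilon> * (am t x)\<^sup>2 + k"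
    "\<And>t x. \<bar>residual2 u0 v0 p2 q2 t x - residual2 u0 v0 p1 q1 t x + (am t x)\<^sup>2\<bar> \<le> k"
    using half_stage[OF disjI2[OF refl] e200 k0 H1(1,2) sup1(2,4) uv2 P(2) aple(3,4) T(2)] by blast
  have sup2: "time_supported (Dt p2)" "time_supported (Dx p2)" "time_supported (Dt q2)" "time_supported (Dx q2)"
    using sup1 H2(3) T(2) unfolding time_supported_def by metis+
  have res: "\<bar>residual1 u0 v0 p2 q2 t x\<bar> \<le> e' * residual2 u0 v0 p2 q2 t x \<and> residual2 u0 v0 p2 q2 t x \<le> 9 / 10 * \<delta>" for t x
  proof (cases "\<delta> / 2 < g2 t x")
    case False
    then have "ap t x = 0" "am t x = 0" using om0[of t x] by (simp_all add: ap_def am_def)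
    then have "residual1 u0 v0 p2 q2 t x = r1 t x" "residual2 u0 v0 p2 q2 t x = r2 t x"
      using H1(3)[of t x] H2(3)[of t x] by (simp_all add: residual1_def residual2_def r1_def r2_def)
    moreover have "e * r2 t x \<le> e' * r2 t x" using e r2p by (intro mult_right_mono) auto
    moreover have "r2 t x \<le> 9 / 10 * \<delta>" using False g(4)[of t x] k2 \<delta> by linarith
    ultimately show ?thesis using r(1)[of t x] by simp
  next
    case True
    define R1 R2 w where "R1 = residual1 u0 v0 p2 q2 t x" and "R2 = residual2 u0 v0 p2 q2 t x" and "w = (om t x)\<^sup>2"
    have w: "0 \<le> w" "w \<le> 1" using om[of t x] by (auto simp: w_def power_le_one)
    define G1 G2 E1 E2 where "G1 = g1 t x" and "G2 = g2 t x" and "E1 = r1 t x" and "E2 = r2 t x"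
    have aa: "(ap t x)\<^sup>2 = w * zp t x" "(am t x)\<^sup>2 = w * zm t x" using sq[of t x] by (auto simp: w_def)
    have dif: "(ap t x)\<^sup>2 - (am t x)\<^sup>2 = - (w * G1)" and sm: "(ap t x)\<^sup>2 + (am t x)\<^sup>2 = w * (G2 - \<delta> / 4)"
      unfolding aa zp_def zm_def G1_def G2_def by (simp_all add: algebra_simps)
    have G: "\<bar>G1 - E1\<bar> \<le> k" "\<bar>G2 - E2\<bar> \<le> k" "\<delta> / 2 < G2" "\<bar>E1\<bar> \<le> e * E2" "E2 \<le> \<delta>" "0 \<le> E2"
      using g(3,4)[of t x] True r[of t x] r2p[of t x] by (simp_all add: G1_def G2_def E1_def E2_def)
    have "4000 * \<epsilon> * (ap t x)\<^sup>2 + k + (4000 * \<epsilon> * (am t x)\<^sup>2 + k) = (1 / 250) * ((ap t x)\<^sup>2 + (am t x)\<^sup>2) + 2 * k"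
      unfolding eps by simp
    moreover have "w * (G2 - \<delta> / 4) \<le> w * \<delta>" using w G k2 k0 by (intro mult_left_mono) linarith+
    ultimately have "\<bar>R1 - E1 - ((ap t x)\<^sup>2 - (am t x)\<^sup>2)\<bar> \<le> (1 / 250) * (w * \<delta>) + 2 * k"
      using H1(8)[of t x] H2(8)[of t x] unfolding R1_def E1_def r1_def sm by linarith
    then have R1: "\<bar>R1 - E1 + w * G1\<bar> \<le> (1 / 250) * (w * \<delta>) + 2 * k" unfolding dif by simp
    have "\<bar>R2 - E2 + ((ap t x)\<^sup>2 + (am t x)\<^sup>2)\<bar> \<le> 2 * k"
      using H1(9)[of t x] H2(9)[of t x] unfolding R2_def E2_def r2_def by linarith
    then have R2: "\<bar>R2 - E2 + w * (G2 - \<delta> / 4)\<bar> \<le> 2 * k" unfolding sm .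
    have wk: "\<bar>w * (G1 - E1)\<bar> \<le> 1 * k" "\<bar>w * (G2 - E2)\<bar> \<le> 1 * k" by (intro abs_mult_le G; use w in simp)+
    have R1': "\<bar>R1 - (1 - w) * E1\<bar> \<le> (1 / 250) * (w * \<delta>) + 3 * k"
    proof -
      have "R1 - (1 - w) * E1 = (R1 - E1 + w * G1) - w * (G1 - E1)" by (simp add: algebra_simps)
      then show ?thesis using abs_diff_le[OF R1 wk(1)] by simp
    qed
    have R2': "\<bar>R2 - ((1 - w) * E2 + w * \<delta> / 4)\<bar> \<le> 3 * k"
    proof -
      have "R2 - ((1 - w) * E2 + w * \<delta> / 4) = (R2 - E2 + w * (G2 - \<delta> / 4)) - w * (G2 - E2)" by (simp add: algebra_simps)
      then show ?thesis using abs_diff_le[OF R2 wk(2)] by simp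
    qed
    have "(1 - w) * \<bar>E1\<bar> \<le> (1 - w) * (e * E2)" using w G by (intro mult_left_mono) auto
    then have "\<bar>(1 - w) * E1\<bar> \<le> e * ((1 - w) * E2)" using w by (simp add: abs_mult mult_ac)
    then have A: "\<bar>R1\<bar> \<le> e * ((1 - w) * E2) + (1 / 250) * (w * \<delta>) + 3 * k" using R1' by linarith
    define X where "X = (1 - w) * E2"
    have X: "(1 - w) * (\<delta> / 3) \<le> X" unfolding X_def using w G k2 k0 by (intro mult_left_mono) linarith+
    define Y where "Y = w * \<delta>"
    have Y: "0 \<le> Y" using w \<delta> by (simp add: Y_def)
    have X': "\<delta> / 3 - Y / 3 \<le> X" using X by (simp add: Y_def algebra_simps)
    have Bn: "X + Y / 4 - 3 * k \<le> R2" using R2' unfolding X_def Y_def by linarith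
    (* X is what the cutoff leaves of the old residual and Y / 4 is the part that was set to delta / 4. The slope
       is kept on X with the gain e' - e and on Y because 1 / 250 is much less than e' / 4. *)
    have "e * X + (1 / 250) * Y + 3 * k \<le> e' * (X + Y / 4 - 3 * k)"
    proof -
      have a1: "(e' - e) * (\<delta> / 3 - Y / 3) \<le> (e' - e) * X" using X' e by (intro mult_left_mono) auto
      have a2: "1 / 8 * (Y / 4) \<le> e' * (Y / 4)" using e Y by (intro mult_right_mono) auto
      have a3: "e' * (3 * k) \<le> 1 * (3 * k)" using e k0 by (intro mult_right_mono) auto
      have a4: "(e' - e) * (Y / 3) \<le> 1 / 8 * (Y / 3)" using e Y by (intro mult_right_mono) auto
      have a4': "(e' - e) * (Y / 3) = (e' - e) * Y / 3" by simp
      have a5: "(e' - e) * (\<delta> / 3 - Y / 3) = \<delta> * (e' - e) / 3 - (e' - e) * (Y / 3)" by (simp add: algebra_simps)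
      have a6: "e' * (X + Y / 4 - 3 * k) = e * X + (e' - e) * X + e' * (Y / 4) - e' * (3 * k)" by (simp add: algebra_simps)
      have wY: "(e' - e) * Y \<le> \<delta> * (e' - e)" using mult_left_mono[OF w(2), of "\<delta> * (e' - e)"] e \<delta> by (simp add: Y_def mult_ac)
      have Y8: "(e' - e) * Y \<le> 1 / 8 * Y" using e Y by (intro mult_right_mono) auto
      have split: "(\<delta> * (e' - e)) / 8 \<le> \<delta> * (e' - e) / 3 - (e' - e) * Y / 3 + 1 / 32 * Y - 1 / 250 * Y"
        using wY Y8 Y by linarith
      show ?thesis unfolding a6 using a1 a2 a3 split a5 a4' k(3) k0 by linarith
    qed
    also have "\<dots> \<le> e' * R2" using Bn e by (intro mult_left_mono) auto
    finally have F: "\<bar>R1\<bar> \<le> e' * R2" using A unfolding X_def Y_def by linarith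
    have "R2 \<le> 9 / 10 * \<delta>"
    proof (cases "3 / 4 * \<delta> \<le> G2")
      case True
      then have "w = 1" using om1[of t x] by (simp add: w_def G2_def)
      then show ?thesis using R2' k2 \<delta> by simp
    next
      case False
      have "0 \<le> w * (G2 - \<delta> / 4)" using w G \<delta> by (intro mult_nonneg_nonneg) auto
      then show ?thesis using R2 G False k2 \<delta> by linarith
    qed
    then show ?thesis using F by (simp add: R1_def R2_def)
  qed
  show ?thesis
  proof (rule that[of p2 q2])
    have "9 / 10 * \<delta> \<le> (19 / 20 * d)\<^sup>2" using \<delta> by (simp add: \<delta>_def power_mult_distrib power2_eq_square)
    then show "almost_solution u0 v0 (19 / 20 * d) e' p2 q2"
      unfolding almost_solution_def using H2(1,2) sup2 res by (meson order_trans)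
    fix t x
    show "\<bar>p2 t x - p t x\<bar> \<le> \<tau>" "\<bar>q2 t x - q t x\<bar> \<le> \<tau>"
      using H1(4,5)[of t x] H2(4,5)[of t x] k(2) by linarith+
    show "\<bar>Dx p2 t x - Dx p t x\<bar> \<le> 24 * d" "\<bar>Dx q2 t x - Dx q t x\<bar> \<le> 24 * d"
      using D1[of t x] H2(6)[of t x] H2(7)[of t x] sq[of t x] k(1) d by linarith+
  qed
qed

section \<open>Iteration and limit\<close>

lemma geometric_limit:
  fixes a :: "nat \<Rightarrow> real"
  assumes r: "0 \<le> r" "r < 1" and a: "\<And>n. \<bar>a (Suc n) - a n\<bar> \<le> c * r ^ n"
  obtains L where "\<And>n. \<bar>L - a n\<bar> \<le> c / (1 - r) * r ^ n"
proof -
  have c: "0 \<le> c" using a[of 0] by simp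
  have tail: "\<bar>a (n + k) - a n\<bar> \<le> c / (1 - r) * (r ^ n - r ^ (n + k))" for n k
  proof (induction k)
    case (Suc k)
    have "c * r ^ (n + k) = c / (1 - r) * (r ^ (n + k) - r ^ (n + Suc k))" using r by (simp add: field_simps)
    then have "\<bar>a (n + Suc k) - a (n + k)\<bar> \<le> c / (1 - r) * (r ^ (n + k) - r ^ (n + Suc k))" using a[of "n + k"] by simp
    from abs_add_le[OF Suc.IH this] show ?case by (simp add: algebra_simps)
  qed simp
  have cr: "0 \<le> c / (1 - r)" using c r by simp
  have tail2: "\<bar>a m - a n\<bar> \<le> c / (1 - r) * r ^ n" if "n \<le> m" for m n
  proof -
    have "c / (1 - r) * (r ^ n - r ^ m) \<le> c / (1 - r) * r ^ n" using cr r by (intro mult_left_mono) auto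
    then show ?thesis using tail[of n "m - n"] that by simp
  qed
  have lim0: "(\<lambda>n. c / (1 - r) * r ^ n) \<longlonglongrightarrow> 0"
    using tendsto_mult_left[OF LIMSEQ_realpow_zero[OF r], of "c / (1 - r)"] by simp
  have "Cauchy a"
  proof (rule metric_CauchyI)
    fix e :: real assume "0 < e"
    then have "\<forall>\<^sub>F n in sequentially. c / (1 - r) * r ^ n < e / 2" using order_tendstoD(2)[OF lim0, of "e / 2"] by simp
    then obtain N where N: "c / (1 - r) * r ^ N < e / 2" by (auto simp: eventually_sequentially)
    have "dist (a m) (a n) < e" if "N \<le> m" "N \<le> n" for m n
      using tail2[OF that(1)] tail2[OF that(2)] N unfolding dist_real_def by linarith
    then show "\<exists>M. \<forall>m\<ge>M. \<forall>n\<ge>M. dist (a m) (a n) < e" by blast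
  qed
  then obtain L where L: "a \<longlonglongrightarrow> L" using Cauchy_convergent_iff convergent_def by blast
  have "\<bar>L - a n\<bar> \<le> c / (1 - r) * r ^ n" for n
  proof (rule tendsto_upperbound)
    show "(\<lambda>m. \<bar>a m - a n\<bar>) \<longlonglongrightarrow> \<bar>L - a n\<bar>" by (intro tendsto_intros L)
    show "\<forall>\<^sub>F m in sequentially. \<bar>a m - a n\<bar> \<le> c / (1 - r) * r ^ n"
      using tail2 by (auto simp: eventually_sequentially)
  qed simp
  then show ?thesis by (rule that)
qed

lemma derivative_uniform_limit:
  fixes f :: "nat \<Rightarrow> real \<Rightarrow> real"
  assumes d: "\<And>n x. (f n has_real_derivative f' n x) (at x)"
    and lim: "\<And>n x. \<bar>g x - f n x\<bar> \<le> b n" "\<And>n x. \<bar>g' x - f' n x\<bar> \<le> b n" "b \<longlonglongrightarrow> 0"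
  shows "(g has_real_derivative g' x) (at x)"
proof -
  have conv: "(\<lambda>n. f n x) \<longlonglongrightarrow> g x" for x
    by (rule Lim_transform_bound[OF _ lim(3), of "\<lambda>n. f n x - g x", THEN LIM_zero_cancel])
       (use lim(1) in \<open>auto simp: abs_minus_commute intro!: always_eventually order_trans[OF _ abs_ge_self]\<close>)
  have "\<exists>h. \<forall>x\<in>UNIV. (\<lambda>n. f n x) \<longlonglongrightarrow> h x \<and> (h has_derivative (*) (g' x)) (at x within UNIV)"
  proof (rule has_derivative_sequence)
    show "(f n has_derivative (*) (f' n x)) (at x within UNIV)" for n x
      using d[of n x] by (simp add: has_field_derivative_def)
    show "\<forall>\<^sub>F n in sequentially. \<forall>x\<in>UNIV. \<forall>h. norm (f' n x * h - g' x * h) \<le> e * norm h" if "e > 0" for e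
    proof -
      have "\<forall>\<^sub>F n in sequentially. b n < e" using order_tendstoD(2)[OF lim(3) that] .
      then show ?thesis
      proof eventually_elim
        case (elim n)
        show ?case
        proof (intro ballI allI)
          fix x h
          have "\<bar>f' n x - g' x\<bar> * \<bar>h\<bar> \<le> e * \<bar>h\<bar>"
            using lim(2)[of x n] elim by (intro mult_right_mono) (auto simp: abs_minus_commute)
          then show "norm (f' n x * h - g' x * h) \<le> e * norm h"
            by (simp add: abs_mult flip: left_diff_distrib)
        qed
      qed
    qed
  qed (use conv[of 0] in auto)
  then obtain h where h: "\<And>x. (\<lambda>n. f n x) \<longlonglongrightarrow> h x" "\<And>x. (h has_derivative (*) (g' x)) (at x)" by auto
  have "h = g" using LIMSEQ_unique[OF h(1) conv] by auto
  then show ?thesis using h(2) by (simp add: has_field_derivative_def)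
qed

lemma cbounded_uniform_limit:
  assumes f: "\<And>n. cbounded (f n)" and lim: "\<And>n t x. \<bar>g t x - f n t x\<bar> \<le> b n" "b \<longlonglongrightarrow> 0"
  shows "cbounded g"
proof -
  obtain B where B: "\<And>t x. \<bar>f 0 t x\<bar> \<le> B" using f[of 0] by (auto simp: cbounded_def)
  have "\<bar>g t x\<bar> \<le> B + b 0" for t x using B[of t x] lim(1)[of t x 0] by linarith
  moreover have "continuous_on UNIV (\<lambda>z. g (fst z) (snd z))"
  proof (rule uniform_limit_theorem)
    show "uniform_limit UNIV (\<lambda>n z. f n (fst z) (snd z)) (\<lambda>z. g (fst z) (snd z)) sequentially"
    proof (rule uniform_limitI)
      fix e :: real assume "0 < e"
      from order_tendstoD(2)[OF lim(2) this]
      show "\<forall>\<^sub>F n in sequentially. \<forall>z\<in>UNIV. dist (f n (fst z) (snd z)) (g (fst z) (snd z)) < e"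
      proof eventually_elim
        case (elim n)
        show ?case
        proof
          fix z show "dist (f n (fst z) (snd z)) (g (fst z) (snd z)) < e"
            using lim(1)[of "fst z" "snd z" n] elim unfolding dist_real_def by linarith
        qed
      qed
    qed
  qed (use f in \<open>auto simp: cbounded_def\<close>)
  ultimately show ?thesis by (auto simp: cbounded_def)
qed

lemma PC1_uniform_limit:
  assumes f: "\<And>n. PC1 (f n)" and lim: "\<And>n t x. \<bar>g t x - f n t x\<bar> \<le> b n" "\<And>n t x. \<bar>gt t x - Dt (f n) t x\<bar> \<le> b n"
    "\<And>n t x. \<bar>gx t x - Dx (f n) t x\<bar> \<le> b n" "b \<longlonglongrightarrow> 0"
  shows "PC1 g" "Dt g = gt" "Dx g = gx"
proof -
  have per: "g t (x + 1) = g t x" for t x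
  proof -
    have bnd: "\<bar>g t (x + 1) - g t x\<bar> \<le> b n + b n" for n
      using lim(1)[of t "x + 1" n] lim(1)[of t x n] PC1D(1)[OF f, of n t x] by linarith
    have "(\<lambda>n. b n + b n) \<longlonglongrightarrow> 0" using tendsto_add[OF lim(4) lim(4)] by simp
    from tendsto_lowerbound[OF this always_eventually[OF allI[OF bnd]] sequentially_bot]
    have "\<bar>g t (x + 1) - g t x\<bar> \<le> 0" .
    then show ?thesis by simp
  qed
  have dt: "((\<lambda>s. g s x) has_real_derivative gt t x) (at t)" for t x
    by (rule derivative_uniform_limit[where f = "\<lambda>n s. f n s x" and f' = "\<lambda>n s. Dt (f n) s x" and g' = "\<lambda>s. gt s x"])
       (rule PC1D(2)[OF f] lim)+
  have dx: "(g t has_real_derivative gx t x) (at x)" for t x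
    by (rule derivative_uniform_limit[where f = "\<lambda>n. f n t" and f' = "\<lambda>n. Dx (f n) t" and g' = "gx t"])
       (rule PC1D(3)[OF f] lim)+
  note c = cbounded_uniform_limit[OF PC1D(4)[OF f] lim(1,4)] cbounded_uniform_limit[OF PC1D(5)[OF f] lim(2,4)]
    cbounded_uniform_limit[OF PC1D(6)[OF f] lim(3,4)]
  show "PC1 g" "Dt g = gt" "Dx g = gx" by (rule PC1I[OF per dt dx c])+
qed

text \<open>An error in the fluxes that depends on time only is invisible in the system, so a function of time is an
  admissible starting potential although it carries all of the residual.\<close>

lemma initial_almost_solution:
  assumes d: "0 < d"
  obtains k where "0 < k" "almost_solution u0 v0 d (1 / 8) (\<lambda>t x. 0) (\<lambda>t x. k * step (t - 1))"
    "Dx (\<lambda>t x. k * step (t - 1)) = (\<lambda>t x. 0)"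
proof -
  obtain B where B: "\<And>y. step' y \<le> B" "0 < B" using step'_bounded by blast
  define k where "k = d\<^sup>2 / B"
  have k: "0 < k" "k * B = d\<^sup>2" using d B by (auto simp: k_def)
  have der: "((\<lambda>t. k * step (t - 1)) has_real_derivative k * step' (t - 1)) (at t)" for t
    using DERIV_cmult[OF DERIV_chain2[OF step_deriv, of "\<lambda>t. t - 1" 1 t UNIV], of k]
    by (auto intro!: derivative_eq_intros DERIV_chain2[OF step_deriv])
  have cont: "continuous_on UNIV (\<lambda>t. k * step' (t - 1))"
    by (intro continuous_on_mult continuous_on_const continuous_on_compose2[OF continuous_step'] continuous_intros) auto
  have kB: "0 \<le> k * step' y" "k * step' y \<le> d\<^sup>2" for y
    using k mult_left_mono[OF B(1)[of y], of k] step'_nonneg[of y] by auto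
  have b: "\<bar>k * step (t - 1)\<bar> \<le> k" "\<bar>k * step' (t - 1)\<bar> \<le> d\<^sup>2" for t
    using step_bounds[of "t - 1"] k kB[of "t - 1"] by (simp_all add: abs_mult mult_left_le)
  note q = PC1_time[OF der cont b]
  show ?thesis
  proof (rule that[OF k(1)])
    show "almost_solution u0 v0 d (1 / 8) (\<lambda>t x. 0) (\<lambda>t x. k * step (t - 1))"
      unfolding almost_solution_def residual1_def residual2_def time_supported_def q(2,3) PC1_const(2,3)
      using q(1) PC1_const(1) kB step'_outside by auto
  qed (rule q(3))
qed

text \<open>The changes of \<open>(u, v)\<close> are at most \<open>24 d\<^sub>n\<close> with \<open>d\<^sub>n = (19 / 20)\<^sup>n d\<^sub>0\<close>, and \<open>24 d\<^sub>n = 480 (d\<^sub>n - d\<^sub>n\<^sub>+\<^sub>1)\<close>, so they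
  telescope to at most \<open>480 d\<^sub>0\<close>. The time derivatives converge because the residuals and the fluxes do. The
  limit is not constant: \<open>q\<close> starts with the increment \<open>k\<close> and changes by at most \<open>k / 4\<close> at each point.\<close>

lemma convex_integration:
  fixes u0 v0 \<rho> :: real
  assumes uv: "\<bar>u0\<bar> \<le> 1 / 2000000" "\<bar>v0\<bar> \<le> 1 / 2000000" and rho: "0 < \<rho>"
  obtains p q where "PC1 p" "PC1 q" "time_supported (Dx p)" "time_supported (Dx q)"
    "\<And>t x. \<bar>Dx p t x\<bar> \<le> \<rho>" "\<And>t x. \<bar>Dx q t x\<bar> \<le> \<rho>"
    "\<And>t x. residual1 u0 v0 p q t x = 0" "\<And>t x. residual2 u0 v0 p q t x = 0"
    "\<exists>t\<ge>0. \<exists>x. Dx p t x \<noteq> 0 \<or> Dx q t x \<noteq> 0"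
proof -
  define \<epsilon> :: real where "\<epsilon> = 1 / 1000000"
  define d0 where "d0 = min (\<epsilon> / 960) (\<rho> / 480)"
  have d0: "0 < d0" "960 * d0 \<le> \<epsilon>" "480 * d0 \<le> \<rho>" using rho by (auto simp: d0_def \<epsilon>_def min_def)
  define d where "d = (\<lambda>n. d0 * (19 / 20) ^ n)"
  have d: "0 < d n" "d n \<le> d0" "d (Suc n) = 19 / 20 * d n" for n
    using d0 by (auto simp: d_def mult_left_le power_le_one)
  (* An increasing sequence of slopes that stays between 1 / 8 and 1 / 4. *)
  define e :: "nat \<Rightarrow> real" where "e = (\<lambda>n. 1 / 4 - 1 / 8 * (1 / 2) ^ n)"
  have e: "1 / 8 \<le> e n" "e n < e (Suc n)" "e n \<le> 1 / 4" for n
    by (auto simp: e_def power_le_one)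
  obtain k where k: "0 < k" "almost_solution u0 v0 d0 (1 / 8) (\<lambda>t x. 0) (\<lambda>t x. k * step (t - 1))"
    "Dx (\<lambda>t x. k * step (t - 1)) = (\<lambda>t x. 0)"
    using initial_almost_solution[OF d0(1)] by blast
  define Pn where "Pn = (\<lambda>n (z :: (real \<Rightarrow> real \<Rightarrow> real) \<times> (real \<Rightarrow> real \<Rightarrow> real)).
     almost_solution u0 v0 (d n) (e n) (fst z) (snd z) \<and>
     (\<forall>t x. \<bar>Dx (fst z) t x\<bar> \<le> 480 * d0 - 480 * d n \<and> \<bar>Dx (snd z) t x\<bar> \<le> 480 * d0 - 480 * d n) \<and>
     (n = 0 \<longrightarrow> snd z = (\<lambda>t x. k * step (t - 1))))"
  define Qn where "Qn = (\<lambda>n (z :: (real \<Rightarrow> real \<Rightarrow> real) \<times> (real \<Rightarrow> real \<Rightarrow> real)) z'.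
     \<forall>t x. \<bar>fst z' t x - fst z t x\<bar> \<le> k / 8 * (1 / 2) ^ n \<and> \<bar>snd z' t x - snd z t x\<bar> \<le> k / 8 * (1 / 2) ^ n \<and>
       \<bar>Dx (fst z') t x - Dx (fst z) t x\<bar> \<le> 24 * d n \<and> \<bar>Dx (snd z') t x - Dx (snd z) t x\<bar> \<le> 24 * d n)"
  have "\<exists>f. \<forall>n. Pn n (f n) \<and> Qn n (f n) (f (Suc n))"
  proof (rule dependent_nat_choice)
    show "\<exists>z. Pn 0 z"
      by (rule exI[of _ "(\<lambda>t x. 0, \<lambda>t x. k * step (t - 1))"]) (use k in \<open>simp add: Pn_def d_def e_def PC1_const\<close>)
    fix z n assume z: "Pn n z"
    have b: "\<bar>Dx (fst z) t x\<bar> \<le> 480 * d0 - 480 * d n" "\<bar>Dx (snd z) t x\<bar> \<le> 480 * d0 - 480 * d n" for t x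
      using z by (auto simp: Pn_def)
    have uv': "\<bar>u0 + Dx (fst z) t x\<bar> \<le> \<epsilon> - 24 * d n" "\<bar>v0 + Dx (snd z) t x\<bar> \<le> \<epsilon> - 24 * d n" for t x
      using b[of t x] uv d0 d(1)[of n] unfolding \<epsilon>_def by linarith+
    have ok: "almost_solution u0 v0 (d n) (e n) (fst z) (snd z)" using z by (simp add: Pn_def)
    have tau: "0 < k / 8 * (1 / 2) ^ n" using k by simp
    obtain p' q' where s: "almost_solution u0 v0 (19 / 20 * d n) (e (Suc n)) p' q'"
      "\<And>t x. \<bar>p' t x - fst z t x\<bar> \<le> k / 8 * (1 / 2) ^ n" "\<And>t x. \<bar>q' t x - snd z t x\<bar> \<le> k / 8 * (1 / 2) ^ n"
      "\<And>t x. \<bar>Dx p' t x - Dx (fst z) t x\<bar> \<le> 24 * d n" "\<And>t x. \<bar>Dx q' t x - Dx (snd z) t x\<bar> \<le> 24 * d n"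
      using stage[OF ok d(1) e(1,2) e(3) \<epsilon>_def tau uv'] by blast
    have "480 * d0 - 480 * d (Suc n) = 480 * d0 - 480 * d n + 24 * d n" using d(3)[of n] by linarith
    then have "\<bar>Dx p' t x\<bar> \<le> 480 * d0 - 480 * d (Suc n)" "\<bar>Dx q' t x\<bar> \<le> 480 * d0 - 480 * d (Suc n)" for t x
      using b[of t x] s(4)[of t x] s(5)[of t x] by linarith+
    then have "Pn (Suc n) (p', q')" using s(1) unfolding d(3)[symmetric] Pn_def by simp
    moreover have "Qn n z (p', q')" using s by (simp add: Qn_def)
    ultimately show "\<exists>y. Pn (Suc n) y \<and> Qn n z y" by blast
  qed
  then obtain f where f: "\<And>n. Pn n (f n)" "\<And>n. Qn n (f n) (f (Suc n))" by blast
  define p where "p = (\<lambda>n. fst (f n))"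
  define q where "q = (\<lambda>n. snd (f n))"
  have ok: "almost_solution u0 v0 (d n) (e n) (p n) (q n)"
    and b: "\<bar>Dx (p n) t x\<bar> \<le> 480 * d0 - 480 * d n" "\<bar>Dx (q n) t x\<bar> \<le> 480 * d0 - 480 * d n" for n t x
    using f(1)[of n] by (auto simp: Pn_def p_def q_def)
  have q0: "q 0 = (\<lambda>t x. k * step (t - 1))" using f(1)[of 0] by (simp add: Pn_def q_def)
  have diff: "\<bar>p (Suc n) t x - p n t x\<bar> \<le> k / 8 * (1 / 2) ^ n" "\<bar>q (Suc n) t x - q n t x\<bar> \<le> k / 8 * (1 / 2) ^ n"
    "\<bar>Dx (p (Suc n)) t x - Dx (p n) t x\<bar> \<le> 24 * d0 * (19 / 20) ^ n" "\<bar>Dx (q (Suc n)) t x - Dx (q n) t x\<bar> \<le> 24 * d0 * (19 / 20) ^ n" for n t x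
    using f(2)[of n] by (auto simp: Qn_def p_def q_def d_def mult.assoc)
  have PC: "PC1 (p n)" "PC1 (q n)" and sup: "time_supported (Dx (p n))" "time_supported (Dx (q n))" for n
    using ok[of n] by (auto simp: almost_solution_def)
  have r: "0 \<le> (1 / 2 :: real)" "(1 / 2 :: real) < 1" "0 \<le> (19 / 20 :: real)" "(19 / 20 :: real) < 1" by auto
  have "\<exists>L. \<forall>n. \<bar>L - p n t x\<bar> \<le> k / 4 * (1 / 2) ^ n" for t x
    using geometric_limit[OF r(1,2), of "\<lambda>n. p n t x", OF diff(1)] by (simp add: field_simps) blast
  then obtain P where P: "\<And>n t x. \<bar>P t x - p n t x\<bar> \<le> k / 4 * (1 / 2) ^ n" by metis
  have "\<exists>L. \<forall>n. \<bar>L - q n t x\<bar> \<le> k / 4 * (1 / 2) ^ n" for t x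
    using geometric_limit[OF r(1,2), of "\<lambda>n. q n t x", OF diff(2)] by (simp add: field_simps) blast
  then obtain Q where Q: "\<And>n t x. \<bar>Q t x - q n t x\<bar> \<le> k / 4 * (1 / 2) ^ n" by metis
  have "\<exists>L. \<forall>n. \<bar>L - Dx (p n) t x\<bar> \<le> 480 * d n" for t x
    using geometric_limit[OF r(3,4), of "\<lambda>n. Dx (p n) t x", OF diff(3)] by (simp add: d_def field_simps) blast
  then obtain PX where PX: "\<And>n t x. \<bar>PX t x - Dx (p n) t x\<bar> \<le> 480 * d n" by metis
  have "\<exists>L. \<forall>n. \<bar>L - Dx (q n) t x\<bar> \<le> 480 * d n" for t x
    using geometric_limit[OF r(3,4), of "\<lambda>n. Dx (q n) t x", OF diff(4)] by (simp add: d_def field_simps) blast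
  then obtain QX where QX: "\<And>n t x. \<bar>QX t x - Dx (q n) t x\<bar> \<le> 480 * d n" by metis
  define PT where "PT = (\<lambda>t x. (u0 * v0 / 2 + v0) - ((u0 + PX t x) * (v0 + QX t x) / 2 + (v0 + QX t x)))"
  define QT where "QT = (\<lambda>t x. (u0 - v0\<^sup>2 / 2) - ((u0 + PX t x) - (v0 + QX t x)\<^sup>2 / 2))"
  define bd where "bd = (\<lambda>n. 2000 * d n + k / 4 * (1 / 2) ^ n)"
  have bd0: "bd \<longlonglongrightarrow> 0"
  proof -
    have "(\<lambda>n. 2000 * (d0 * (19 / 20) ^ n) + k / 4 * (1 / 2) ^ n) \<longlonglongrightarrow> 2000 * (d0 * 0) + k / 4 * 0"
      by (intro tendsto_intros LIMSEQ_realpow_zero) auto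
    then show ?thesis by (simp add: bd_def[abs_def] d_def)
  qed
  have kp: "0 \<le> k / 4 * (1 / 2) ^ n" for n using k by simp
  have dsq: "(d n)\<^sup>2 \<le> d n" for n
  proof -
    have "d n \<le> 1" using d(2)[of n] d0 by (simp add: \<epsilon>_def)
    then show ?thesis using d(1)[of n] mult_left_le[of "d n" "d n"] by (simp add: power2_eq_square)
  qed
  have res: "\<bar>residual1 u0 v0 (p n) (q n) t x\<bar> \<le> d n" "\<bar>residual2 u0 v0 (p n) (q n) t x\<bar> \<le> d n" for n t x
  proof -
    have o: "\<bar>residual1 u0 v0 (p n) (q n) t x\<bar> \<le> e n * residual2 u0 v0 (p n) (q n) t x"
      "residual2 u0 v0 (p n) (q n) t x \<le> (d n)\<^sup>2" using ok[of n] by (auto simp: almost_solution_def)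
    have "0 \<le> e n * residual2 u0 v0 (p n) (q n) t x" using o(1) by linarith
    then have nn: "0 \<le> residual2 u0 v0 (p n) (q n) t x" using e(1)[of n] by (simp add: zero_le_mult_iff)
    then have "e n * residual2 u0 v0 (p n) (q n) t x \<le> 1 * residual2 u0 v0 (p n) (q n) t x"
      using e(3)[of n] by (intro mult_right_mono) auto
    then show "\<bar>residual1 u0 v0 (p n) (q n) t x\<bar> \<le> d n" "\<bar>residual2 u0 v0 (p n) (q n) t x\<bar> \<le> d n"
      using o nn dsq[of n] by linarith+
  qed
  have uvn: "\<bar>u0 + Dx (p n) t x\<bar> \<le> 1" "\<bar>v0 + Dx (q n) t x\<bar> \<le> 1" for n t x
    using b[of n t x] uv d0 d(1)[of n] unfolding \<epsilon>_def by linarith+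
  have le0: "\<bar>y\<bar> \<le> c" if "\<And>n. \<bar>y - z n\<bar> \<le> 480 * d n" "\<And>n. \<bar>z n\<bar> \<le> c" for y c :: real and z
  proof (rule tendsto_lowerbound)
    show "(\<lambda>n. c + bd n) \<longlonglongrightarrow> c" using tendsto_add[OF tendsto_const[of c] bd0] by simp
    have "\<bar>y\<bar> \<le> c + bd n" for n
      using that(1)[of n] that(2)[of n] kp[of n] d(1)[of n] unfolding bd_def by linarith
    then show "\<forall>\<^sub>F n in sequentially. \<bar>y\<bar> \<le> c + bd n" by (rule always_eventually[OF allI])
  qed simp
  have UV: "\<bar>u0 + PX t x\<bar> \<le> 1" "\<bar>v0 + QX t x\<bar> \<le> 1" for t x
    using le0[of "u0 + PX t x" "\<lambda>n. u0 + Dx (p n) t x" 1, OF _ uvn(1)] le0[of "v0 + QX t x" "\<lambda>n. v0 + Dx (q n) t x" 1, OF _ uvn(2)]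
      PX QX by simp_all
  have PTb: "\<bar>PT t x - Dt (p n) t x\<bar> \<le> bd n" for n t x
  proof -
    define U V U' V' where "U = u0 + PX t x" and "V = v0 + QX t x" and "U' = u0 + Dx (p n) t x" and "V' = v0 + Dx (q n) t x"
    have h: "\<bar>U' - U\<bar> \<le> 480 * d n" "\<bar>V' - V\<bar> \<le> 480 * d n"
      using PX[of t x n] QX[of t x n] by (simp_all add: U_def V_def U'_def V'_def abs_minus_commute)
    have h1: "\<bar>V'\<bar> \<le> 1" "\<bar>U\<bar> \<le> 1" using uvn UV by (simp_all add: U_def V'_def)
    have id: "PT t x - Dt (p n) t x = ((U' - U) * V' + U * (V' - V)) / 2 + (V' - V) - residual1 u0 v0 (p n) (q n) t x"
      unfolding PT_def residual1_def U_def[symmetric] V_def[symmetric] U'_def[symmetric] V'_def[symmetric] by (simp add: field_simps)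
    show ?thesis unfolding id
      by (rule order_trans[OF abs_diff_le[OF abs_add_le[OF abs_half_le[OF abs_add_le[OF abs_mult_le[OF h(1) h1(1)] abs_mult_le[OF h1(2) h(2)]]] h(2)] res(1)]])
         (use kp[of n] d(1)[of n] in \<open>simp add: bd_def\<close>)
  qed
  have QTb: "\<bar>QT t x - Dt (q n) t x\<bar> \<le> bd n" for n t x
  proof -
    define U V U' V' where "U = u0 + PX t x" and "V = v0 + QX t x" and "U' = u0 + Dx (p n) t x" and "V' = v0 + Dx (q n) t x"
    have h: "\<bar>U' - U\<bar> \<le> 480 * d n" "\<bar>V' - V\<bar> \<le> 480 * d n"
      using PX[of t x n] QX[of t x n] by (simp_all add: U_def V_def U'_def V'_def abs_minus_commute)
    have "\<bar>V'\<bar> \<le> 1" "\<bar>V\<bar> \<le> 1" using uvn UV by (simp_all add: V_def V'_def)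
    then have h1: "\<bar>V' + V\<bar> \<le> 2" by linarith
    have id: "QT t x - Dt (q n) t x = (U' - U) - (V' - V) * (V' + V) / 2 - residual2 u0 v0 (p n) (q n) t x"
      unfolding QT_def residual2_def U_def[symmetric] V_def[symmetric] U'_def[symmetric] V'_def[symmetric] by (simp add: field_simps power2_eq_square)
    show ?thesis unfolding id
      by (rule order_trans[OF abs_diff_le[OF abs_diff_le[OF h(1) abs_half_le[OF abs_mult_le[OF h(2) h1]]] res(2)]])
         (use kp[of n] d(1)[of n] in \<open>simp add: bd_def\<close>)
  qed
  have Pb: "\<bar>P t x - p n t x\<bar> \<le> bd n" and Qb: "\<bar>Q t x - q n t x\<bar> \<le> bd n"
    and PXb: "\<bar>PX t x - Dx (p n) t x\<bar> \<le> bd n" and QXb: "\<bar>QX t x - Dx (q n) t x\<bar> \<le> bd n" for n t x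
    using P[of t x n] Q[of t x n] PX[of t x n] QX[of t x n] kp[of n] d(1)[of n] unfolding bd_def by linarith+
  note LP = PC1_uniform_limit[OF PC(1) Pb PTb PXb bd0] and LQ = PC1_uniform_limit[OF PC(2) Qb QTb QXb bd0]
  have R: "residual1 u0 v0 P Q t x = 0" "residual2 u0 v0 P Q t x = 0" for t x
    unfolding residual1_def residual2_def LP LQ PT_def QT_def by simp_all
  have brho: "\<bar>Dx (p n) t x\<bar> \<le> \<rho>" "\<bar>Dx (q n) t x\<bar> \<le> \<rho>" for n t x
    using b[of n t x] d0(3) d(1)[of n] by linarith+
  show ?thesis
  proof (rule that[OF LP(1) LQ(1) _ _ _ _ R])
    show "time_supported (Dx P)" "time_supported (Dx Q)" unfolding LP LQ time_supported_def
    proof (safe)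
      fix t x :: real assume t: "t \<notin> {1..2}"
      have z: "Dx (p n) t x = 0" "Dx (q n) t x = 0" for n using sup[of n] t by (auto simp: time_supported_def)
      have "\<bar>PX t x\<bar> \<le> 0" by (rule le0[OF PX]) (simp add: z)
      then show "PX t x = 0" by simp
      have "\<bar>QX t x\<bar> \<le> 0" by (rule le0[OF QX]) (simp add: z)
      then show "QX t x = 0" by simp
    qed
    show "\<bar>Dx P t x\<bar> \<le> \<rho>" "\<bar>Dx Q t x\<bar> \<le> \<rho>" for t x unfolding LP LQ
      by (rule le0[OF PX brho(1)], rule le0[OF QX brho(2)])
    show "\<exists>t\<ge>0. \<exists>x. Dx P t x \<noteq> 0 \<or> Dx Q t x \<noteq> 0"
    proof (rule ccontr)
      assume "\<not> ?thesis"
      then have z: "PX t x = 0" "QX t x = 0" if "0 \<le> t" for t x using that unfolding LP LQ by auto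
      have "Dt Q t x = 0" if "0 \<le> t" for t x unfolding LQ QT_def by (simp add: z[OF that])
      moreover obtain y where "0 < y" "Q 3 0 - Q 0 0 = (3 - 0) * Dt Q y 0"
        using MVT2[of 0 3 "\<lambda>t. Q t 0" "\<lambda>t. Dt Q t 0"] PC1D(2)[OF LQ(1)] by auto
      ultimately have "Q 3 0 = Q 0 0" by simp
      moreover have "\<bar>Q 3 0 - k\<bar> \<le> k / 4" "\<bar>Q 0 0\<bar> \<le> k / 4"
        using Q[of 3 0 0] Q[of 0 0 0] by (simp_all add: q0 step_simps)
      ultimately show False using k(1) by linarith
    qed
  qed
qed

section \<open>From potentials to weak solutions\<close>

lemma cbounded_continuous:
  assumes "cbounded f"
  shows "continuous_on S (\<lambda>(t, x). f t x)" "continuous_on S' (f t)" "continuous_on S' (\<lambda>t. f t x)"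
proof -
  have c: "continuous_on UNIV (\<lambda>z. f (fst z) (snd z))" using assms by (simp add: cbounded_def)
  then show "continuous_on S (\<lambda>(t, x). f t x)" by (auto simp: case_prod_beta' intro: continuous_on_subset)
  have "continuous_on S' (\<lambda>x. (t, x))" "continuous_on S' (\<lambda>t. (t, x))" by (intro continuous_intros)+
  from continuous_on_compose2[OF c this(1)] continuous_on_compose2[OF c this(2)]
  show "continuous_on S' (f t)" "continuous_on S' (\<lambda>t. f t x)" by simp_all
qed

definition box_integral :: "real \<Rightarrow> (real \<Rightarrow> real \<Rightarrow> real) \<Rightarrow> real" where
  "box_integral T f = integral {0..T} (\<lambda>t. integral {0..1} (f t))"

lemma inner_integral_continuous: "cbounded f \<Longrightarrow> continuous_on S (\<lambda>t. integral {0..1} (f t))"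
  using integral_continuous_on_param[of S 0 1 f] cbounded_continuous(1) by auto

lemma inner_integrable: "cbounded f \<Longrightarrow> f t integrable_on {0..1}"
  by (intro integrable_continuous_interval cbounded_continuous)

lemma box_integral_add:
  assumes "cbounded f" "cbounded g"
  shows "box_integral T (\<lambda>t x. f t x + g t x) = box_integral T f + box_integral T g"
  unfolding box_integral_def using assms
  by (simp add: integral_add[OF inner_integrable inner_integrable] integral_add integrable_continuous_interval inner_integral_continuous)

lemma box_integral_cmult: "box_integral T (\<lambda>t x. c * f t x) = c * box_integral T f"
  unfolding box_integral_def by simp

lemma box_integral_bound:
  assumes "cbounded f" "0 \<le> T" "\<And>t x. \<bar>f t x\<bar> \<le> e" shows "\<bar>box_integral T f\<bar> \<le> e * T"
proof -
  have "norm (integral {0..1} (f t)) \<le> e * (1 - 0)" for t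
    by (rule integral_bound) (use assms cbounded_continuous in auto)
  then have "norm (integral {0..T} (\<lambda>t. integral {0..1} (f t))) \<le> e * (T - 0)"
    by (intro integral_bound) (use assms inner_integral_continuous in auto)
  then show ?thesis by (simp add: box_integral_def)
qed

lemma box_integral_Dt:
  assumes f: "PC1 f" and T: "0 \<le> T" "\<And>x. f T x = 0"
  shows "box_integral T (Dt f) = - integral {0..1} (f 0)"
proof -
  have "box_integral T (Dt f) = integral {0..1} (\<lambda>x. integral {0..T} (\<lambda>t. Dt f t x))"
    using integral_swap_continuous[of 0 0 T 1 "Dt f"] cbounded_continuous(1)[OF PC1D(5)[OF f]]
    by (simp add: box_integral_def)
  moreover have "integral {0..T} (\<lambda>t. Dt f t x) = - f 0 x" for x
  proof -
    have "((\<lambda>t. Dt f t x) has_integral (f T x - f 0 x)) {0..T}"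
      by (rule fundamental_theorem_of_calculus[OF T(1)])
         (use PC1D(2)[OF f] in \<open>auto simp: has_real_derivative_iff_has_vector_derivative[symmetric] intro: has_field_derivative_at_within\<close>)
    then show ?thesis using T(2) by (simp add: integral_unique)
  qed
  ultimately show ?thesis by simp
qed

lemma integral_Dx_zero: assumes f: "PC1 f" shows "integral {0..1} (Dx f t) = 0"
proof -
  have "(Dx f t has_integral (f t 1 - f t 0)) {0..1}"
    by (rule fundamental_theorem_of_calculus)
       (use PC1D(3)[OF f] in \<open>auto simp: has_real_derivative_iff_has_vector_derivative[symmetric] intro: has_field_derivative_at_within\<close>)
  then show ?thesis using PC1D(1)[OF f, of t 0] by (simp add: integral_unique)
qed

lemma periodic_integral_shift:
  fixes F :: "real \<Rightarrow> real"
  assumes c: "continuous_on UNIV F" and per: "\<And>x. F (x + 1) = F x" and h: "0 < h" "h < 1"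
  shows "integral {0..1} (\<lambda>x. F (x + h)) = integral {0..1} F"
proof -
  have i: "F integrable_on {a..b}" for a b by (intro integrable_continuous_interval continuous_on_subset[OF c]) auto
  have "integral {0..1} (\<lambda>x. F (x + h)) = integral {h..1 + h} F"
    using integral_shift_real_ivl[where a = h and c = h and b = "1 + h" and f = F] by simp
  also have "\<dots> = integral {h..1} F + integral {1..1 + h} F"
    using Henstock_Kurzweil_Integration.integral_combine[where a = h and c = 1 and b = "1 + h" and f = F] h i by simp
  also have "integral {1..1 + h} F = integral {0..h} F"
    using integral_shift_real_ivl[where a = 1 and c = 1 and b = "1 + h" and f = F] per by simp
  finally show ?thesis using Henstock_Kurzweil_Integration.integral_combine[where a = 0 and c = h and b = 1 and f = F] h i by simp
qed

text \<open>The integrand is a Jacobian determinant, hence formally a divergence. Since both functions are only \<open>C\<^sup>1\<close>, the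
  \<open>x\<close>-derivative of \<open>p\<close> is first replaced by a difference quotient, which may be integrated by parts in time;
  then the shift is moved to \<open>f\<close> by periodicity, and the step tends to zero.\<close>

lemma box_integral_jacobian:
  assumes f: "PC1 f" and p: "PC1 p" and T: "0 \<le> T" "\<And>x. f T x = 0" and p0: "\<And>x. Dx p 0 x = 0"
    and R: "\<And>t x. R < \<bar>t\<bar> \<Longrightarrow> Dx f t x = 0" "\<And>t x. R < \<bar>t\<bar> \<Longrightarrow> Dx p t x = 0"
  shows "box_integral T (\<lambda>t x. Dt f t x * Dx p t x - Dx f t x * Dt p t x) = 0"
proof -
  note F = PC1D[OF f] and P = PC1D[OF p]
  obtain A B where AB: "\<And>t x. \<bar>Dt f t x\<bar> \<le> A" "\<And>t x. \<bar>Dt p t x\<bar> \<le> B"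
    using F(5) P(5) by (auto simp: cbounded_def)
  have AB0: "0 \<le> A" "0 \<le> B" using AB[of 0 0] by linarith+
  let ?J = "\<lambda>t x. Dt f t x * Dx p t x - Dx f t x * Dt p t x"
  have cJ: "cbounded ?J" by (intro cbounded_diff cbounded_mult F P)
  have bound: "\<bar>box_integral T ?J\<bar> \<le> (A * e + e * B) * T" if e: "0 < e" for e
  proof -
    obtain d1 where d1: "0 < d1" "\<And>h t x. 0 < \<bar>h\<bar> \<Longrightarrow> \<bar>h\<bar> < d1 \<Longrightarrow> \<bar>(f t (x + h) - f t x) / h - Dx f t x\<bar> \<le> e"
      using difference_quotient_Dx[OF f R(1) e] by blast
    obtain d2 where d2: "0 < d2" "\<And>h t x. 0 < \<bar>h\<bar> \<Longrightarrow> \<bar>h\<bar> < d2 \<Longrightarrow> \<bar>(p t (x + h) - p t x) / h - Dx p t x\<bar> \<le> e"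
      using difference_quotient_Dx[OF p R(2) e] by blast
    (* A single step for both quotients; it enters with opposite signs. *)
    define h where "h = min (1 / 2) (min (d1 / 2) (d2 / 2))"
    have h: "0 < h" "h < 1" "h < d1" "h < d2" using d1 d2 by (auto simp: h_def min_def)
    define w where "w = (\<lambda>t x. p (t + 0) (x + h) + (- 1) * p t x)"
    have w: "PC1 w" unfolding w_def by (intro PC1_add(1) PC1_shift PC1_cmult(1) p)
    have "((\<lambda>t. w t x) has_real_derivative Dt p t (x + h) - Dt p t x) (at t)" for t x
      using DERIV_diff[OF P(2)[where x = "x + h" and t = t] P(2)[where x = x and t = t]] by (simp add: w_def)
    then have Dw: "Dt w t x = Dt p t (x + h) - Dt p t x" for t x
      by (rule DERIV_unique[OF PC1D(2)[OF w]])
    have w0: "w 0 x = 0" for x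
    proof -
      have "x < x + h" using h by simp
      from MVT2[OF this P(3)[where t = 0]] p0 show ?thesis by (auto simp: w_def)
    qed
    note fw = PC1_mult[OF f w]
    have "box_integral T (\<lambda>t x. Dt f t x * w t x + f t x * Dt w t x) = - integral {0..1} (\<lambda>x. f 0 x * w 0 x)"
      using box_integral_Dt[OF fw(1) T(1)] T(2) unfolding fw(2) by simp
    then have z: "box_integral T (\<lambda>t x. Dt f t x * w t x + f t x * Dt w t x) = 0" by (simp add: w0)
    define v where "v = (\<lambda>t x. f (t + 0) (x + - h))"
    have v: "PC1 v" unfolding v_def by (intro PC1_shift f)
    have sh: "integral {0..1} (\<lambda>x. f t x * Dt w t x) = integral {0..1} (\<lambda>x. (v t x - f t x) * Dt p t x)" for t
    proof -
      have c: "continuous_on S (f t)" "continuous_on S (Dt p t)" "continuous_on S (v t)" for S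
        by (intro cbounded_continuous F P PC1D(4)[OF v])+
      have cs: "continuous_on S (\<lambda>x. Dt p t (x + h))" for S
        by (intro continuous_on_compose2[OF c(2)[of UNIV]] continuous_intros) auto
      have "v t (x + 1) * Dt p t (x + 1) = v t x * Dt p t x" for x
        using PC1D(1)[OF v] Dt_Dx_periodic(2)[OF p] by simp
      from periodic_integral_shift[OF continuous_on_mult[OF c(3) c(2)] this h(1,2)]
      have "integral {0..1} (\<lambda>x. f t x * Dt p t (x + h)) = integral {0..1} (\<lambda>x. v t x * Dt p t x)"
        by (simp add: v_def)
      then show ?thesis unfolding Dw left_diff_distrib right_diff_distrib
        by (subst (1 2) integral_diff) (auto intro!: integrable_continuous_interval continuous_intros c cs)
    qed
    have cb: "cbounded (\<lambda>t x. Dt f t x * w t x)" "cbounded (\<lambda>t x. f t x * Dt w t x)"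
      "cbounded (\<lambda>t x. (v t x - f t x) * Dt p t x)"
      by (intro cbounded_mult cbounded_diff F P PC1D(4)[OF v] PC1D(4,5)[OF w])+
    have "box_integral T (\<lambda>t x. f t x * Dt w t x) = box_integral T (\<lambda>t x. (v t x - f t x) * Dt p t x)"
      unfolding box_integral_def sh ..
    then have z2: "box_integral T (\<lambda>t x. Dt f t x * w t x + (v t x - f t x) * Dt p t x) = 0"
      using z box_integral_add[OF cb(1,2)] box_integral_add[OF cb(1,3)] by simp
    let ?D = "\<lambda>t x. ?J t x + (- 1 / h) * (Dt f t x * w t x + (v t x - f t x) * Dt p t x)"
    have cD: "cbounded (\<lambda>t x. (- 1 / h) * (Dt f t x * w t x + (v t x - f t x) * Dt p t x))"
      by (intro cbounded_mult cbounded_add cb cbounded_const)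
    have "box_integral T ?D = box_integral T ?J + (- 1 / h) * 0"
      by (simp only: box_integral_add[OF cJ cD] box_integral_cmult z2)
    then have D: "box_integral T ?D = box_integral T ?J" by simp
    have alg: "a * b - c * d + - k * (a * w + (v - f) * d) = a * (b - k * w) + (- (k * (v - f)) - c) * d"
      for a b c d k w v f :: real by (simp add: algebra_simps)
    have DB: "\<bar>?D t x\<bar> \<le> A * e + e * B" for t x
    proof -
      have e1: "\<bar>Dx p t x - w t x / h\<bar> \<le> e" using d2(2)[of h t x] h by (simp add: w_def abs_minus_commute)
      have e2: "\<bar>(v t x - f t x) / (- h) - Dx f t x\<bar> \<le> e" using d1(2)[of "- h" t x] h by (simp add: v_def)
      have k: "w t x / h = (1 / h) * w t x" "(v t x - f t x) / (- h) = - ((1 / h) * (v t x - f t x))" "- 1 / h = - (1 / h)" by simp_all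
      have "?D t x = Dt f t x * (Dx p t x - w t x / h) + ((v t x - f t x) / (- h) - Dx f t x) * Dt p t x"
        unfolding k by (rule alg)
      then show ?thesis using abs_add_le[OF abs_mult_le[OF AB(1) e1] abs_mult_le[OF e2 AB(2)]] by simp
    qed
    show ?thesis using box_integral_bound[OF cbounded_add[OF cJ cD] T(1) DB] unfolding D .
  qed
  have "\<bar>box_integral T ?J\<bar> \<le> 0 + e" if "0 < e" for e
  proof -
    define e' where "e' = e / ((A + B) * T + 1)"
    have pos: "0 < (A + B) * T + 1" using AB0 T by (intro add_nonneg_pos mult_nonneg_nonneg) auto
    then have e': "0 < e'" "e' * ((A + B) * T + 1) = e" using that by (auto simp: e'_def)
    have "(A * e' + e' * B) * T \<le> e' * ((A + B) * T + 1)" using e' by (simp add: algebra_simps)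
    then show ?thesis using bound[OF e'(1)] e'(2) by linarith
  qed
  then show ?thesis using field_le_epsilon[of "\<bar>box_integral T ?J\<bar>" 0] by simp
qed

text \<open>Apart from the Jacobian the integrand consists of exact derivatives of the test function.\<close>

lemma conservation_identity:
  assumes f: "PC1 f" and p: "PC1 p" and T: "0 \<le> T" "\<And>x. f T x = 0" and p0: "\<And>x. Dx p 0 x = 0"
    and R: "\<And>t x. R < \<bar>t\<bar> \<Longrightarrow> Dx f t x = 0" "\<And>t x. R < \<bar>t\<bar> \<Longrightarrow> Dx p t x = 0"
  shows "box_integral T (\<lambda>t x. Dt f t x * (c + Dx p t x) + Dx f t x * (c' - Dt p t x)) + integral {0..1} (\<lambda>x. f 0 x * c) = 0"
proof -
  note F = PC1D[OF f] and P = PC1D[OF p]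
  let ?J = "\<lambda>t x. Dt f t x * Dx p t x - Dx f t x * Dt p t x"
  have cb: "cbounded (\<lambda>t x. c * Dt f t x)" "cbounded (\<lambda>t x. c' * Dx f t x)" "cbounded ?J"
    "cbounded (\<lambda>t x. c * Dt f t x + c' * Dx f t x)"
    by (intro cbounded_add cbounded_diff cbounded_mult cbounded_const F P)+
  have "(\<lambda>t x. Dt f t x * (c + Dx p t x) + Dx f t x * (c' - Dt p t x)) = (\<lambda>t x. (c * Dt f t x + c' * Dx f t x) + ?J t x)"
    by (intro ext) (simp add: algebra_simps)
  then have "box_integral T (\<lambda>t x. Dt f t x * (c + Dx p t x) + Dx f t x * (c' - Dt p t x))
      = c * box_integral T (Dt f) + c' * box_integral T (Dx f) + box_integral T ?J"
    by (simp only: box_integral_add[OF cb(4,3)] box_integral_add[OF cb(1,2)] box_integral_cmult)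
  moreover have "box_integral T (Dx f) = 0" by (simp add: box_integral_def integral_Dx_zero[OF f])
  moreover have "box_integral T ?J = 0" by (rule box_integral_jacobian[OF f p T p0 R])
  moreover have "integral {0..1} (\<lambda>x. f 0 x * c) = integral {0..1} (f 0) * c" by simp
  ultimately show ?thesis using box_integral_Dt[OF f T] by simp
qed

lemma cbounded_periodic:
  assumes c: "continuous_on UNIV (\<lambda>z. g (fst z) (snd z))" and per: "\<And>t x. g t (x + 1) = g t x"
    and R: "\<And>t x. R < \<bar>t\<bar> \<Longrightarrow> g t x = 0"
  shows "cbounded g"
proof -
  let ?K = "{- R..R} \<times> {0..1} :: (real \<times> real) set"
  have "compact ((\<lambda>z. g (fst z) (snd z)) ` ?K)"
    by (intro compact_continuous_image continuous_on_subset[OF c] compact_Times) auto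
  then obtain B where B: "\<And>z. z \<in> ?K \<Longrightarrow> \<bar>g (fst z) (snd z)\<bar> \<le> B"
    by (force simp: bounded_iff dest: compact_imp_bounded)
  have "\<bar>g t x\<bar> \<le> \<bar>B\<bar>" for t x
  proof (cases "R < \<bar>t\<bar>")
    case False
    have "g t x = g t (x + of_int (- \<lfloor>x\<rfloor>))" by (simp only: periodic_int[of "g t", OF per])
    moreover have "(t, x + of_int (- \<lfloor>x\<rfloor>)) \<in> ?K" using False by (auto simp: abs_le_iff; linarith)
    ultimately show ?thesis using B[of "(t, x + of_int (- \<lfloor>x\<rfloor>))"] by simp
  qed (simp add: R)
  then show ?thesis using c by (auto simp: cbounded_def)
qed

lemma test_function_PC1:
  assumes "test_function \<phi>"
  obtains R where "PC1 (\<lambda>t x. \<phi> (t, x))" "0 \<le> R" "\<And>t x. R < \<bar>t\<bar> \<Longrightarrow> \<phi> (t, x) = 0"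
    "\<And>t x. R < \<bar>t\<bar> \<Longrightarrow> Dt (\<lambda>t x. \<phi> (t, x)) t x = 0" "\<And>t x. R < \<bar>t\<bar> \<Longrightarrow> Dx (\<lambda>t x. \<phi> (t, x)) t x = 0"
proof -
  have diff: "\<And>z. \<phi> differentiable (at z)" and cont: "\<And>h. continuous_on UNIV (\<lambda>z. frechet_derivative \<phi> (at z) h)"
    and per: "\<And>t x. \<phi> (t, x + 1) = \<phi> (t, x)"
    using assms by (auto simp: test_function_def)
  obtain R0 where R0: "\<And>t x. R0 < \<bar>t\<bar> \<Longrightarrow> \<phi> (t, x) = 0" using assms unfolding test_function_def by blast
  define R where "R = \<bar>R0\<bar>"
  have R: "R < \<bar>t\<bar> \<Longrightarrow> \<phi> (t, x) = 0" for t x using R0[of t x] by (simp add: R_def)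
  have fd: "(\<phi> has_derivative frechet_derivative \<phi> (at z)) (at z)" for z
    by (rule diff[unfolded frechet_derivative_works])
  define ft fx where "ft = (\<lambda>t x. frechet_derivative \<phi> (at (t, x)) (1, 0))"
    and "fx = (\<lambda>t x. frechet_derivative \<phi> (at (t, x)) (0, 1))"
  have dt: "((\<lambda>s. \<phi> (s, x)) has_real_derivative ft t x) (at t)" for t x
  proof -
    have "((\<lambda>s. (s, x)) has_derivative (\<lambda>h. (h, 0))) (at t)"
      by (intro has_derivative_Pair has_derivative_ident has_derivative_const)
    from has_derivative_compose[OF this fd]
    have d: "((\<lambda>s. \<phi> (s, x)) has_derivative (\<lambda>h. frechet_derivative \<phi> (at (t, x)) (h, 0))) (at t)" .
    have eq: "frechet_derivative \<phi> (at (t, x)) (h, 0) = ft t x * h" for h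
    proof -
      have "(h, 0) = h *\<^sub>R ((1, 0) :: real \<times> real)" by simp
      then show ?thesis
        by (simp only: linear_cmul[OF linear_frechet_derivative[OF diff]] ft_def real_scaleR_def mult.commute)
    qed
    show ?thesis using d unfolding has_field_derivative_def eq .
  qed
  have dx: "((\<lambda>y. \<phi> (t, y)) has_real_derivative fx t x) (at x)" for t x
  proof -
    have "((\<lambda>y. (t, y)) has_derivative (\<lambda>h. (0, h))) (at x)"
      by (intro has_derivative_Pair has_derivative_ident has_derivative_const)
    from has_derivative_compose[OF this fd]
    have d: "((\<lambda>y. \<phi> (t, y)) has_derivative (\<lambda>h. frechet_derivative \<phi> (at (t, x)) (0, h))) (at x)" .
    have eq: "frechet_derivative \<phi> (at (t, x)) (0, h) = fx t x * h" for h
    proof -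
      have "(0, h) = h *\<^sub>R ((0, 1) :: real \<times> real)" by simp
      then show ?thesis
        by (simp only: linear_cmul[OF linear_frechet_derivative[OF diff]] fx_def real_scaleR_def mult.commute)
    qed
    show ?thesis using d unfolding has_field_derivative_def eq .
  qed
  have ft0: "ft t x = 0" if "R < \<bar>t\<bar>" for t x
  proof -
    have "((\<lambda>s. 0) has_real_derivative 0) (at t)" by simp
    then have "((\<lambda>s. \<phi> (s, x)) has_real_derivative 0) (at t)"
      by (rule has_field_derivative_transform_within_open[where S = "{s. R < \<bar>s\<bar>}"])
         (use that R in \<open>auto intro!: open_Collect_less continuous_intros\<close>)
    from DERIV_unique[OF dt this] show ?thesis by simp
  qed
  have fx0: "fx t x = 0" if "R < \<bar>t\<bar>" for t x
  proof -
    have "((\<lambda>y. \<phi> (t, y)) has_real_derivative 0) (at x)" using R[OF that] by simp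
    from DERIV_unique[OF dx this] show ?thesis by simp
  qed
  have ftp: "ft t (x + 1) = ft t x" for t x
  proof -
    have "((\<lambda>s. \<phi> (s, x)) has_real_derivative ft t (x + 1)) (at t)" using dt[of "x + 1" t] by (simp add: per)
    from DERIV_unique[OF dt this] show ?thesis by simp
  qed
  have fxp: "fx t (x + 1) = fx t x" for t x
  proof -
    have "((\<lambda>y. \<phi> (t, y)) has_real_derivative fx t (x + 1)) (at x)"
      using dx[of t "x + 1"] by (simp add: DERIV_shift per)
    from DERIV_unique[OF dx this] show ?thesis by simp
  qed
  have "continuous_on UNIV \<phi>" 
    by (intro continuous_at_imp_continuous_on ballI differentiable_imp_continuous_within diff)
  then have c: "cbounded (\<lambda>t x. \<phi> (t, x))" by (intro cbounded_periodic) (use per R in auto)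
  have ct: "cbounded ft" by (rule cbounded_periodic[where g = ft, OF _ ftp ft0]) (use cont in \<open>auto simp: ft_def\<close>)
  have cx: "cbounded fx" by (rule cbounded_periodic[where g = fx, OF _ fxp fx0]) (use cont in \<open>auto simp: fx_def\<close>)
  note P = PC1I[where f = "\<lambda>t x. \<phi> (t, x)", OF per dt dx c ct cx]
  show ?thesis
    by (rule that[of R]) (use P R ft0 fx0 in \<open>auto simp: R_def\<close>)
qed

lemma set_lebesgue_integral_continuous:
  fixes g :: "real \<Rightarrow> real \<times> real"
  assumes "continuous_on {a..b} g"
  shows "(LINT x:{a..b}|lebesgue. g x) = (integral {a..b} (\<lambda>x. fst (g x)), integral {a..b} (\<lambda>x. snd (g x)))"
proof -
  have "(LINT x:{a..b}|lebesgue. g x) = integral {a..b} g"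
    by (rule set_lebesgue_integral_eq_integral(2)[OF absolutely_integrable_continuous_real[OF assms]])
  moreover have "g integrable_on {a..b}" by (rule integrable_continuous_interval[OF assms])
  from integral_linear[OF this bounded_linear_fst] integral_linear[OF this bounded_linear_snd]
  have "fst (integral {a..b} g) = integral {a..b} (\<lambda>x. fst (g x))" "snd (integral {a..b} g) = integral {a..b} (\<lambda>x. snd (g x))"
    by (simp_all add: o_def)
  ultimately show ?thesis by (simp add: prod_eq_iff)
qed

text \<open>If the residuals vanish, the flux of \<open>w\<close> is a constant minus the time derivative of the potentials, while \<open>w\<close>
  is a constant plus their space derivative: the weak formulation is an instance of \<open>conservation_identity\<close> in
  each component.\<close>

lemma potential_weak_solution:
  assumes p: "PC1 p" and q: "PC1 q" and sup: "time_supported (Dx p)" "time_supported (Dx q)"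
    and res: "\<And>t x. residual1 u0 v0 p q t x = 0" "\<And>t x. residual2 u0 v0 p q t x = 0"
  defines "w \<equiv> \<lambda>z. (u0 + Dx p (fst z) (snd z), v0 + Dx q (fst z) (snd z))"
  shows "weak_solution flux (\<lambda>x. (u0, v0)) w" "continuous_on spacetime w" "w (0, x) = (u0, v0)"
proof -
  note P = PC1D[OF p] and Q = PC1D[OF q]
  have D0: "Dx p 0 x = 0" "Dx q 0 x = 0" for x using sup by (auto simp: time_supported_def)
  then show "w (0, x) = (u0, v0)" by (simp add: w_def)
  show cw: "continuous_on spacetime w"
    unfolding w_def using P(6) Q(6)
    by (auto simp: cbounded_def intro!: continuous_intros intro: continuous_on_subset)
  obtain A B where AB: "\<And>t x. \<bar>Dx p t x\<bar> \<le> A" "\<And>t x. \<bar>Dx q t x\<bar> \<le> B" using P(6) Q(6) by (auto simp: cbounded_def)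
  have "norm (w z) \<le> (\<bar>u0\<bar> + A) + (\<bar>v0\<bar> + B)" for z
  proof -
    have "norm (w z) \<le> norm (u0 + Dx p (fst z) (snd z)) + norm (v0 + Dx q (fst z) (snd z))"
      unfolding w_def by (rule norm_Pair_le)
    then show ?thesis using AB(1)[of "fst z" "snd z"] AB(2)[of "fst z" "snd z"] unfolding real_norm_def by linarith
  qed
  then have bw: "bounded (w ` spacetime)" by (auto simp: bounded_iff)
  have clo: "closed spacetime" by (intro closed_Times) auto
  have mw: "w \<in> borel_measurable (lebesgue_on spacetime)"
    by (rule continuous_imp_measurable_on_sets_lebesgue[OF cw sets_completionI_sets]) (simp add: borel_closed clo)
  define c1 c2 where "c1 = u0 * v0 / 2 + v0" and "c2 = u0 - v0\<^sup>2 / 2"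
  have fl: "flux (w (t, x)) = (c1 - Dt p t x, c2 - Dt q t x)" for t x
    using res[of t x] by (simp add: flux_def w_def residual1_def residual2_def c1_def c2_def)
  have id: "(LINT t:{0..}|lebesgue. (LINT x:{0..1}|lebesgue.
            deriv (\<lambda>s. \<phi> (s, x)) t *\<^sub>R w (t, x) + deriv (\<lambda>y. \<phi> (t, y)) x *\<^sub>R flux (w (t, x))))
        + (LINT x:{0..1}|lebesgue. \<phi> (0, x) *\<^sub>R (u0, v0)) = 0" if tf: "test_function \<phi>" for \<phi>
  proof -
    define f where "f = (\<lambda>t x. \<phi> (t, x))"
    obtain R where f: "PC1 f" and R: "0 \<le> R" "\<And>t x. R < \<bar>t\<bar> \<Longrightarrow> f t x = 0"
      "\<And>t x. R < \<bar>t\<bar> \<Longrightarrow> Dt f t x = 0" "\<And>t x. R < \<bar>t\<bar> \<Longrightarrow> Dx f t x = 0"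
      using test_function_PC1[OF tf] unfolding f_def by blast
    note F = PC1D[OF f]
    define T where "T = R + 3"
    have T: "0 \<le> T" "\<And>x. f T x = 0" using R by (auto simp: T_def)
    have RT: "Dx f t x = 0" "Dt f t x = 0" "Dx p t x = 0" "Dx q t x = 0" if "T < \<bar>t\<bar>" for t x
      using R(3,4)[of t x] time_supported_bound[OF sup(1), of t x] time_supported_bound[OF sup(2), of t x] that R(1)
      by (auto simp: T_def)
    define g1 where "g1 = (\<lambda>t x. Dt f t x * (u0 + Dx p t x) + Dx f t x * (c1 - Dt p t x))"
    define g2 where "g2 = (\<lambda>t x. Dt f t x * (v0 + Dx q t x) + Dx f t x * (c2 - Dt q t x))"
    have g: "cbounded g1" "cbounded g2" unfolding g1_def g2_def
      by (intro cbounded_add cbounded_diff cbounded_mult cbounded_const F P Q)+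
    have integrand: "deriv (\<lambda>s. \<phi> (s, x)) t *\<^sub>R w (t, x) + deriv (\<lambda>y. \<phi> (t, y)) x *\<^sub>R flux (w (t, x)) = (g1 t x, g2 t x)" for t x
      unfolding fl by (simp add: w_def g1_def g2_def f_def Dt_def Dx_def)
    have inner: "(LINT x:{0..1}|lebesgue. (g1 t x, g2 t x)) = (integral {0..1} (g1 t), integral {0..1} (g2 t))" for t
      by (subst set_lebesgue_integral_continuous) (intro continuous_on_Pair cbounded_continuous(2) g, simp)
    have zero: "(integral {0..1} (g1 t), integral {0..1} (g2 t)) = 0" if "T < t" for t
    proof -
      have "g1 t = (\<lambda>x. 0)" "g2 t = (\<lambda>x. 0)" unfolding g1_def g2_def using RT[of t] that by auto
      then show ?thesis by (simp add: zero_prod_def)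
    qed
    have "(LINT t:{0..}|lebesgue. (integral {0..1} (g1 t), integral {0..1} (g2 t)))
        = (LINT t:{0..T}|lebesgue. (integral {0..1} (g1 t), integral {0..1} (g2 t)))"
      unfolding set_lebesgue_integral_def
      by (rule Bochner_Integration.integral_cong) (use zero in \<open>auto simp: indicator_def zero_prod_def\<close>)
    also have "\<dots> = (box_integral T g1, box_integral T g2)"
      by (subst set_lebesgue_integral_continuous)
         (auto intro!: continuous_intros inner_integral_continuous g simp: box_integral_def)
    finally have outer: "(LINT t:{0..}|lebesgue. (integral {0..1} (g1 t), integral {0..1} (g2 t))) = (box_integral T g1, box_integral T g2)" .
    have init: "(LINT x:{0..1}|lebesgue. \<phi> (0, x) *\<^sub>R (u0, v0)) = (integral {0..1} (\<lambda>x. f 0 x * u0), integral {0..1} (\<lambda>x. f 0 x * v0))"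
      by (subst set_lebesgue_integral_continuous)
         (use cbounded_continuous(2)[OF F(4), of _ 0] in \<open>auto intro!: continuous_intros simp: f_def\<close>)
    have "box_integral T g1 + integral {0..1} (\<lambda>x. f 0 x * u0) = 0"
      unfolding g1_def by (rule conservation_identity[OF f p T D0(1) RT(1,3)])
    moreover have "box_integral T g2 + integral {0..1} (\<lambda>x. f 0 x * v0) = 0"
      unfolding g2_def by (rule conservation_identity[OF f q T D0(2) RT(1,4)])
    ultimately show ?thesis unfolding integrand inner outer init by (simp add: zero_prod_def)
  qed
  have per: "w (t, x + 1) = w (t, x)" for t x
    by (simp add: w_def Dt_Dx_periodic[OF p] Dt_Dx_periodic[OF q])
  show "weak_solution flux (\<lambda>x. (u0, v0)) w"
    unfolding weak_solution_def using id per mw bw by simp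
qed

section \<open>The characteristic fields of the flux\<close>

lemma Ck_on_cong:
  assumes "open S"
  shows "(\<And>x. x \<in> S \<Longrightarrow> f x = g x) \<Longrightarrow> Ck_on k f S \<Longrightarrow> Ck_on k g S"
proof (induction k arbitrary: f g)
  case 0
  then show ?case by (simp cong: continuous_on_cong)
next
  case (Suc k)
  have d: "(g has_derivative frechet_derivative f (at x)) (at x)" if "x \<in> S" for x
  proof (rule has_derivative_transform_within_open[OF _ assms that])
    show "(f has_derivative frechet_derivative f (at x)) (at x)"
      using Suc.prems(2) that by (simp add: frechet_derivative_works)
  qed (use Suc.prems(1) in auto)
  have eq: "frechet_derivative f (at x) h = frechet_derivative g (at x) h" if "x \<in> S" for x h
    using frechet_derivative_at[OF d[OF that]] by simp
  show ?case unfolding Ck_on.simps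
  proof (intro conjI ballI allI)
    show "g differentiable at x" if "x \<in> S" for x using d[OF that] by (auto simp: differentiable_def)
    show "Ck_on k (\<lambda>x. frechet_derivative g (at x) h) S" for h
      by (rule Suc.IH[where f = "\<lambda>x. frechet_derivative f (at x) h"]) (use eq Suc.prems(2) in auto)
  qed
qed

text \<open>The discriminant of the characteristic polynomial of \<open>Df\<close>, up to the factor four.\<close>

definition disc :: "real \<times> real \<Rightarrow> real" where "disc z = 9 / 16 * (snd z)\<^sup>2 + fst z / 2 + 1"

lemma disc_derivative: "(disc has_derivative (\<lambda>h. 9 / 8 * snd z * snd h + fst h / 2)) (at z)"
  unfolding disc_def[abs_def] by (auto intro!: derivative_eq_intros simp: field_simps)

text \<open>Smoothness of the eigenvectors: this class contains them and is closed under directional derivatives, so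
  continuity of its members gives all orders of differentiability at once.\<close>

inductive sqrt_expression :: "(real \<times> real \<Rightarrow> real) \<Rightarrow> bool" where
  const: "sqrt_expression (\<lambda>z. c)"
| fst: "sqrt_expression fst"
| snd: "sqrt_expression snd"
| root: "sqrt_expression (\<lambda>z. sqrt (disc z))"
| inv_root: "sqrt_expression (\<lambda>z. inverse (sqrt (disc z)))"
| add: "sqrt_expression f \<Longrightarrow> sqrt_expression g \<Longrightarrow> sqrt_expression (\<lambda>z. f z + g z)"
| mult: "sqrt_expression f \<Longrightarrow> sqrt_expression g \<Longrightarrow> sqrt_expression (\<lambda>z. f z * g z)"

lemma sqrt_disc_derivative:
  assumes "0 < disc z"
  shows "((\<lambda>z. sqrt (disc z)) has_derivative (\<lambda>h. (9 / 16 * snd h * snd z + fst h / 4) * inverse (sqrt (disc z)))) (at z)"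
proof -
  from has_derivative_compose[OF disc_derivative DERIV_real_sqrt[OF assms, unfolded has_field_derivative_def]]
  show ?thesis by (rule has_derivative_eq_rhs) (simp add: fun_eq_iff field_simps)
qed

lemma sqrt_expression_derivative:
  assumes "sqrt_expression g"
  shows "\<exists>D. (\<forall>h. sqrt_expression (D h)) \<and> (\<forall>z. 0 < disc z \<longrightarrow> (g has_derivative (\<lambda>h. D h z)) (at z))"
  using assms
proof induction
  case (const c)
  show ?case by (rule exI[of _ "\<lambda>h z. 0"]) (auto intro: sqrt_expression.const)
next
  case fst
  show ?case by (rule exI[of _ "\<lambda>h z. fst h"]) (auto intro: sqrt_expression.const has_derivative_fst[OF has_derivative_ident])
next
  case snd
  show ?case by (rule exI[of _ "\<lambda>h z. snd h"]) (auto intro: sqrt_expression.const has_derivative_snd[OF has_derivative_ident])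
next
  case root
  have "sqrt_expression (\<lambda>z. (9 / 16 * snd h * snd z + fst h / 4) * inverse (sqrt (disc z)))" for h
    by (intro sqrt_expression.intros)
  then show ?case
    by (intro exI[of _ "\<lambda>h z. (9 / 16 * snd h * snd z + fst h / 4) * inverse (sqrt (disc z))"] conjI allI impI
        sqrt_disc_derivative)
next
  case inv_root
  define D where "D = (\<lambda>h z. (- 1 * ((9 / 16 * snd h * snd z + fst h / 4) * inverse (sqrt (disc z)))) *
     (inverse (sqrt (disc z)) * inverse (sqrt (disc z))))"
  have "sqrt_expression (D h)" for h unfolding D_def by (intro sqrt_expression.intros)
  moreover have "((\<lambda>z. inverse (sqrt (disc z))) has_derivative (\<lambda>h. D h z)) (at z)" if "0 < disc z" for z
    by (rule has_derivative_eq_rhs[OF Deriv.has_derivative_inverse[OF _ sqrt_disc_derivative[OF that]]])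
       (use that in \<open>auto simp: D_def fun_eq_iff\<close>)
  ultimately show ?case by blast
next
  case (add f g)
  then obtain D E where D: "\<And>h. sqrt_expression (D h)" "\<And>z. 0 < disc z \<Longrightarrow> (f has_derivative (\<lambda>h. D h z)) (at z)"
    and E: "\<And>h. sqrt_expression (E h)" "\<And>z. 0 < disc z \<Longrightarrow> (g has_derivative (\<lambda>h. E h z)) (at z)" by blast
  show ?case
    by (rule exI[of _ "\<lambda>h z. D h z + E h z"]) (auto intro: sqrt_expression.add D E has_derivative_add)
next
  case (mult f g)
  then obtain D E where D: "\<And>h. sqrt_expression (D h)" "\<And>z. 0 < disc z \<Longrightarrow> (f has_derivative (\<lambda>h. D h z)) (at z)"
    and E: "\<And>h. sqrt_expression (E h)" "\<And>z. 0 < disc z \<Longrightarrow> (g has_derivative (\<lambda>h. E h z)) (at z)" by blast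
  show ?case
    by (rule exI[of _ "\<lambda>h z. f z * E h z + D h z * g z"])
       (auto intro!: sqrt_expression.add sqrt_expression.mult D E mult.hyps has_derivative_mult)
qed

lemma sqrt_expression_Ck_on:
  assumes S: "open S" "\<And>z. z \<in> S \<Longrightarrow> 0 < disc z"
  shows "sqrt_expression f \<Longrightarrow> sqrt_expression g \<Longrightarrow> Ck_on k (\<lambda>z. (f z, g z)) S"
proof (induction k arbitrary: f g)
  case 0
  obtain D where D: "\<And>z. 0 < disc z \<Longrightarrow> (f has_derivative (\<lambda>h. D h z)) (at z)"
    using sqrt_expression_derivative[OF 0(1)] by blast
  obtain E where E: "\<And>z. 0 < disc z \<Longrightarrow> (g has_derivative (\<lambda>h. E h z)) (at z)"
    using sqrt_expression_derivative[OF 0(2)] by blast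
  have "continuous_on S f" "continuous_on S g"
    using has_derivative_continuous[OF D[OF S(2)]] has_derivative_continuous[OF E[OF S(2)]]
    by (intro continuous_at_imp_continuous_on ballI; blast)+
  then show ?case by (simp add: continuous_on_Pair)
next
  case (Suc k)
  obtain D where D: "\<And>h. sqrt_expression (D h)" "\<And>z. 0 < disc z \<Longrightarrow> (f has_derivative (\<lambda>h. D h z)) (at z)"
    using sqrt_expression_derivative[OF Suc.prems(1)] by blast
  obtain E where E: "\<And>h. sqrt_expression (E h)" "\<And>z. 0 < disc z \<Longrightarrow> (g has_derivative (\<lambda>h. E h z)) (at z)"
    using sqrt_expression_derivative[OF Suc.prems(2)] by blast
  have d: "((\<lambda>z. (f z, g z)) has_derivative (\<lambda>h. (D h z, E h z))) (at z)" if "z \<in> S" for z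
    using D(2)[OF S(2)[OF that]] E(2)[OF S(2)[OF that]] by (rule has_derivative_Pair)
  show ?case unfolding Ck_on.simps
  proof (intro conjI ballI allI)
    show "(\<lambda>z. (f z, g z)) differentiable at z" if "z \<in> S" for z using d[OF that] by (auto simp: differentiable_def)
    show "Ck_on k (\<lambda>z. frechet_derivative (\<lambda>z. (f z, g z)) (at z) h) S" for h
      by (rule Ck_on_cong[OF S(1) _ Suc.IH[OF D(1) E(1)]]) (simp add: frechet_derivative_at[OF d, symmetric])
  qed
qed

lemma flux_derivative:
  "(flux has_derivative (\<lambda>h. (snd z * fst h / 2 + (fst z / 2 + 1) * snd h, fst h - snd z * snd h))) (at z)"
proof -
  have "flux = (\<lambda>z. (fst z * snd z / 2 + snd z, fst z - (snd z)\<^sup>2 / 2))" by (auto simp: flux_def)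
  moreover have "((\<lambda>z. (fst z * snd z / 2 + snd z, fst z - (snd z)\<^sup>2 / 2)) has_derivative
      (\<lambda>h. (snd z * fst h / 2 + (fst z / 2 + 1) * snd h, fst h - snd z * snd h))) (at z)"
    by (auto intro!: derivative_eq_intros simp: field_simps)
  ultimately show ?thesis by simp
qed

lemma frechet_derivative_flux:
  "frechet_derivative flux (at z) = (\<lambda>h. (snd z * fst h / 2 + (fst z / 2 + 1) * snd h, fst h - snd z * snd h))"
  using frechet_derivative_at[OF flux_derivative] by simp

definition speed :: "real \<Rightarrow> real \<times> real \<Rightarrow> real" where "speed \<sigma> z = - snd z / 4 + \<sigma> * sqrt (disc z)"

lemma speed_eigenvector:
  assumes "\<sigma> = 1 \<or> \<sigma> = -1" "0 < disc z"
  shows "frechet_derivative flux (at z) (speed \<sigma> z + snd z, 1) = speed \<sigma> z *\<^sub>R (speed \<sigma> z + snd z, 1)"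
proof -
  have "\<sigma> * \<sigma> = 1" "sqrt (disc z) * sqrt (disc z) = disc z" using assms by auto
  then have "(\<sigma> * sqrt (disc z)) * (\<sigma> * sqrt (disc z)) = disc z" by (simp add: mult_ac)
  then have "(speed \<sigma> z + snd z / 4) * (speed \<sigma> z + snd z / 4) = disc z" by (simp add: speed_def)
  then show ?thesis by (simp add: frechet_derivative_flux disc_def power2_eq_square field_simps)
qed

lemma eigenvalues_flux:
  assumes "0 < disc z" shows "eigenvalues (frechet_derivative flux (at z)) = {speed (-1) z, speed 1 z}"
proof -
  have A: "speed \<sigma> z \<in> eigenvalues (frechet_derivative flux (at z))" if "\<sigma> = 1 \<or> \<sigma> = -1" for \<sigma>
    unfolding eigenvalues_def
    by (intro CollectI exI[of _ "(speed \<sigma> z + snd z, 1)"] conjI speed_eigenvector[OF that assms]) (simp add: zero_prod_def)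
  have B: "l = speed (-1) z \<or> l = speed 1 z" if "l \<in> eigenvalues (frechet_derivative flux (at z))" for l
  proof -
    from that[unfolded eigenvalues_def mem_Collect_eq]
    obtain y where y: "y \<noteq> 0" "frechet_derivative flux (at z) y = l *\<^sub>R y"
      by (elim exE conjE)
    obtain a b where "y = (a, b)" by (cases y)
    with y have w: "(a, b) \<noteq> 0" "frechet_derivative flux (at z) (a, b) = l *\<^sub>R (a, b)" by simp_all
    have "snd z * a / 2 + (fst z / 2 + 1) * b = l * a \<and> a - snd z * b = l * b"
      using w(2) unfolding frechet_derivative_flux by simp
    then have e: "snd z * a / 2 + (fst z / 2 + 1) * b = l * a" "a = (l + snd z) * b"
      unfolding distrib_right by linarith+
    have b: "b \<noteq> 0" using w(1) e(2) by (auto simp: zero_prod_def)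
    have "b * ((l + snd z / 4) * (l + snd z / 4) - disc z) = l * a - (snd z * a / 2 + (fst z / 2 + 1) * b)"
      unfolding e(2) by (simp add: disc_def power2_eq_square field_simps)
    then have "(l + snd z / 4)\<^sup>2 = disc z" using b e(1) by (simp add: power2_eq_square)
    then have "(l + snd z / 4)\<^sup>2 = (sqrt (disc z))\<^sup>2" using assms by simp
    then have "l + snd z / 4 = sqrt (disc z) \<or> l + snd z / 4 = - sqrt (disc z)" by (simp only: power2_eq_iff)
    then show ?thesis unfolding speed_def by linarith
  qed
  show ?thesis
  proof (intro equalityI subsetI)
    show "l \<in> {speed (-1) z, speed 1 z}" if "l \<in> eigenvalues (frechet_derivative flux (at z))" for l
      using B[OF that] by simp
    show "l \<in> eigenvalues (frechet_derivative flux (at z))" if "l \<in> {speed (-1) z, speed 1 z}" for l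
      using that A[of 1] A[of "-1"] by auto
  qed
qed

lemma speeds_flux:
  assumes "0 < disc z"
  shows "speed_minus flux z = speed (-1) z" "speed_plus flux z = speed 1 z" "speed (-1) z < speed 1 z"
proof -
  show "speed (-1) z < speed 1 z" using assms by (simp add: speed_def)
  then show "speed_minus flux z = speed (-1) z" "speed_plus flux z = speed 1 z"
    by (simp_all add: speed_minus_def speed_plus_def eigenvalues_flux[OF assms])
qed

text \<open>With \<open>r = (\<Lambda> + v, 1)\<close> the derivative of the speed \<open>\<Lambda>\<close> along \<open>r\<close> is \<open>3 \<sigma> v / (4 sqrt disc)\<close>.\<close>

lemma genuinely_nonlinear_flux:
  assumes V: "open V" "\<And>z. z \<in> V \<Longrightarrow> 0 < disc z" "\<And>z. z \<in> V \<Longrightarrow> snd z \<noteq> 0"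
    and sig: "\<sigma> = 1 \<or> \<sigma> = -1" and L: "\<And>z. z \<in> V \<Longrightarrow> L z = speed \<sigma> z"
  shows "genuinely_nonlinear_on flux L V"
proof -
  have hyp: "strictly_hyperbolic_on flux V" unfolding strictly_hyperbolic_on_def
  proof (intro ballI conjI)
    fix z assume z: "z \<in> V"
    show "flux differentiable at z" by (rule differentiableI[OF flux_derivative])
    show "\<exists>a b. a < b \<and> eigenvalues (frechet_derivative flux (at z)) = {a, b}"
      by (rule exI[of _ "speed (-1) z"], rule exI[of _ "speed 1 z"])
         (simp add: eigenvalues_flux[OF V(2)[OF z]] speeds_flux(3)[OF V(2)[OF z]])
  qed
  define r where "r = (\<lambda>z. (speed \<sigma> z + snd z, 1 :: real))"
  have "sqrt_expression (\<lambda>z. (- 1 / 4 * snd z + \<sigma> * sqrt (disc z)) + snd z)"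
    by (intro sqrt_expression.intros)
  then have ex: "sqrt_expression (\<lambda>z. speed \<sigma> z + snd z)" by (simp add: speed_def)
  have "smooth_on r V" unfolding smooth_on_def r_def
    by (intro allI sqrt_expression_Ck_on V ex sqrt_expression.const)
  moreover have "r z \<noteq> 0 \<and> frechet_derivative flux (at z) (r z) = L z *\<^sub>R r z \<and> (\<exists>g. (GDERIV L z :> g) \<and> g \<bullet> r z \<noteq> 0)"
    if z: "z \<in> V" for z
  proof (intro conjI exI)
    show "r z \<noteq> 0" by (simp add: r_def zero_prod_def)
    show "frechet_derivative flux (at z) (r z) = L z *\<^sub>R r z"
      using speed_eigenvector[OF sig V(2)[OF z]] L[OF z] by (simp add: r_def)
    define s where "s = sqrt (disc z)"
    have s: "0 < s" using V(2)[OF z] by (simp add: s_def)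
    let ?g = "(\<sigma> / (4 * s), - 1 / 4 + \<sigma> * 9 * snd z / (16 * s))"
    have "((\<lambda>z :: real \<times> real. - snd z / 4) has_derivative (\<lambda>h. - snd h / 4)) (at z)"
      by (auto intro!: derivative_eq_intros)
    from has_derivative_add[OF this has_derivative_mult_right[OF sqrt_disc_derivative[OF V(2)[OF z]], of \<sigma>]]
    have d: "(speed \<sigma> has_derivative (\<lambda>h. - snd h / 4 + \<sigma> * ((9 / 16 * snd h * snd z + fst h / 4) * inverse s))) (at z)"
      by (simp only: speed_def[abs_def] s_def)
    have "- snd h / 4 + \<sigma> * ((9 / 16 * snd h * snd z + fst h / 4) * inverse s) = h \<bullet> ?g" for h
    proof -
      have "\<sigma> * ((9 / 16 * b * snd z + a / 4) * inverse s) = a * (\<sigma> / (4 * s)) + b * (\<sigma> * 9 * snd z / (16 * s))" for a b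
        using s by (simp add: field_simps)
      then show ?thesis by (simp add: inner_prod_def right_diff_distrib)
    qed
    with d have "(speed \<sigma> has_derivative (\<lambda>h. h \<bullet> ?g)) (at z)" by simp
    then have "(L has_derivative (\<lambda>h. h \<bullet> ?g)) (at z)"
      by (rule has_derivative_transform_within_open[OF _ V(1) z]) (simp add: L)
    then show "GDERIV L z :> ?g" by (simp add: gderiv_def)
    have "\<sigma> / (4 * s) * (- snd z / 4 + \<sigma> * s + snd z) = 3 / 16 * (\<sigma> * snd z / s) + \<sigma> * \<sigma> / 4"
      using s by (simp add: field_simps)
    moreover have "\<sigma> * \<sigma> = 1" using sig by auto
    ultimately have "?g \<bullet> r z = 3 / 4 * (\<sigma> * snd z / s)"
      by (simp add: inner_prod_def r_def speed_def s_def[symmetric])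
    then show "?g \<bullet> r z \<noteq> 0" using V(3)[OF z] s sig by auto
  qed
  ultimately show ?thesis unfolding genuinely_nonlinear_on_def using hyp by blast
qed

section \<open>Non-uniqueness\<close>

text \<open>The rectangle \<open>V\<close> avoids the degenerate line \<open>v = 0\<close> and is small enough for \<open>convex_integration\<close>. One solution is
  the centre of the ball, the other oscillates around it and starts from it.\<close>

theorem theorem1p2:
  shows "\<exists>V :: (real \<times> real) set. open V \<and> V \<noteq> {} \<and>
    genuinely_nonlinear_on flux (speed_minus flux) V \<and>
    genuinely_nonlinear_on flux (speed_plus flux) V \<and>
    (\<forall>c r. r > 0 \<and> ball c r \<subseteq> V \<longrightarrow>
      (\<exists>w0 w1 w2.
         continuous_on spacetime w1 \<and> w1 ` spacetime \<subseteq> ball c r \<and> weak_solution flux w0 w1 \<and>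
         continuous_on spacetime w2 \<and> w2 ` spacetime \<subseteq> ball c r \<and> weak_solution flux w0 w2 \<and>
         (\<forall>x. w1 (0, x) = w0 x \<and> w2 (0, x) = w0 x) \<and>
         (\<exists>z\<in>spacetime. w1 z \<noteq> w2 z)))"
proof -
  define \<epsilon> :: real where "\<epsilon> = 1 / 2000000"
  define V :: "(real \<times> real) set" where "V = {- \<epsilon><..<\<epsilon>} \<times> {0<..<\<epsilon>}"
  have V: "\<bar>fst z\<bar> < \<epsilon>" "0 < snd z" "snd z < \<epsilon>" if "z \<in> V" for z
    using that by (auto simp: V_def abs_less_iff)
  have openV: "open V" by (auto simp: V_def intro: open_Times)
  have "(0, \<epsilon> / 2) \<in> V" by (simp add: V_def \<epsilon>_def)
  then have neV: "V \<noteq> {}" by blast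
  have disc: "0 < disc z" if "z \<in> V" for z
    using V(1)[OF that] zero_le_power2[of "snd z"] unfolding disc_def \<epsilon>_def by linarith
  have sndV: "snd z \<noteq> 0" if "z \<in> V" for z using V(2)[OF that] by simp
  have gnl: "genuinely_nonlinear_on flux (speed_minus flux) V" "genuinely_nonlinear_on flux (speed_plus flux) V"
    by (rule genuinely_nonlinear_flux[where \<sigma> = "-1"]; use openV disc sndV speeds_flux in auto)
       (rule genuinely_nonlinear_flux[where \<sigma> = 1]; use openV disc sndV speeds_flux in auto)
  have wild: "\<exists>w0 w1 w2.
         continuous_on spacetime w1 \<and> w1 ` spacetime \<subseteq> ball c r \<and> weak_solution flux w0 w1 \<and>
         continuous_on spacetime w2 \<and> w2 ` spacetime \<subseteq> ball c r \<and> weak_solution flux w0 w2 \<and>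
         (\<forall>x. w1 (0, x) = w0 x \<and> w2 (0, x) = w0 x) \<and> (\<exists>z\<in>spacetime. w1 z \<noteq> w2 z)"
    if r: "r > 0" "ball c r \<subseteq> V" for c :: "real \<times> real" and r :: real
  proof -
    obtain u0 v0 where c: "c = (u0, v0)" by (cases c)
    have "c \<in> V" using r by auto
    then have uv: "\<bar>u0\<bar> \<le> 1 / 2000000" "\<bar>v0\<bar> \<le> 1 / 2000000"
      using V[of c] by (auto simp: c \<epsilon>_def)
    have "0 < r / 3" using r by simp
    from convex_integration[OF uv this] obtain p q where pq: "PC1 p" "PC1 q" "time_supported (Dx p)" "time_supported (Dx q)"
      "\<And>t x. \<bar>Dx p t x\<bar> \<le> r / 3" "\<And>t x. \<bar>Dx q t x\<bar> \<le> r / 3"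
      "\<And>t x. residual1 u0 v0 p q t x = 0" "\<And>t x. residual2 u0 v0 p q t x = 0"
      "\<exists>t\<ge>0. \<exists>x. Dx p t x \<noteq> 0 \<or> Dx q t x \<noteq> 0" by metis
    let ?w = "\<lambda>z. (u0 + Dx p (fst z) (snd z), v0 + Dx q (fst z) (snd z))"
    let ?O = "\<lambda>t x :: real. 0 :: real"
    have zero: "residual1 u0 v0 ?O ?O t x = 0" "residual2 u0 v0 ?O ?O t x = 0" "time_supported (Dx ?O)" for t x
      by (simp_all add: residual1_def residual2_def time_supported_def PC1_const)
    note W = potential_weak_solution[OF pq(1-4,7,8)]
    note W1 = potential_weak_solution[OF PC1_const(1) PC1_const(1) zero(3,3,1,2), unfolded PC1_const(3) add_0_right]
    have ball: "?w z \<in> ball c r" for z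
    proof -
      have "dist c (?w z) = norm (- Dx p (fst z) (snd z), - Dx q (fst z) (snd z))" by (simp add: c dist_norm)
      also have "\<dots> \<le> norm (- Dx p (fst z) (snd z)) + norm (- Dx q (fst z) (snd z))" by (rule norm_Pair_le)
      also have "\<dots> \<le> r / 3 + r / 3" using pq(5)[of "fst z" "snd z"] pq(6)[of "fst z" "snd z"] by simp
      also have "\<dots> < r" using r by simp
      finally show ?thesis by simp
    qed
    obtain t x where tx: "0 \<le> t" "Dx p t x \<noteq> 0 \<or> Dx q t x \<noteq> 0" using pq(9) by blast
    show ?thesis
    proof (intro exI conjI allI)
      show "continuous_on spacetime (\<lambda>z. (u0, v0))" by simp
      show "(\<lambda>z. (u0, v0)) ` spacetime \<subseteq> ball c r" using r by (auto simp: c)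
      show "weak_solution flux (\<lambda>x. (u0, v0)) (\<lambda>z. (u0, v0))" by (rule W1(1))
      show "continuous_on spacetime ?w" by (rule W(2))
      show "?w ` spacetime \<subseteq> ball c r" using ball by blast
      show "weak_solution flux (\<lambda>x. (u0, v0)) ?w" by (rule W(1))
      show "?w (0, x) = (u0, v0)" for x by (rule W(3))
      show "\<exists>z\<in>spacetime. (u0, v0) \<noteq> ?w z" using tx by (intro bexI[of _ "(t, x)"]) auto
    qed simp
  qed
  show ?thesis
    by (intro exI[of _ V] conjI openV neV gnl allI impI; elim conjE; rule wild)
qed

end
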